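(* Let $k\ge 5$ and let $\phi\in C^k(\mathbb{R})$ satisfy $\phi(0)=0$, $\phi(-r)=\phi(r)$ for all $r$, and $\phi''(0)=1$; let $\epsilon\ge 0$ and let $\mathcal{E}$ be the energy difference functional defined in the context. For each $R>0$ let $\Omega_R$ be a finite set with $B_R\cap\Lambda\subset\Omega_R\subset\Lambda$, and let $\mathcal{H}^0_R=\{v:\Lambda\to\mathbb{R}: v=0\text{ in }\Lambda\setminus\Omega_R\}$. If $\bar u$ is a solution to $$\text{find }\bar u\in\arg\min_{\dot{\mathcal{H}}^1}\mathcal{E}$$ that is strongly stable, in the sense that there exists $\lambda>0$ with $\delta^2\mathcal{E}(\bar u)[v,v]\ge\lambda\|v\|_{\dot{\mathcal{H}}^1}^2$ for all $v\in\dot{\mathcal{H}}^1$, then for all $\beta>0$ there exist $C,R_0>0$ such that for all $R>R_0$ there exists a stable solution $\bar u_R$ to $$\text{find }\bar u_R\in\arg\min_{\mathcal{H}^0_R}\mathcal{E}$$ satisfying $$\|\bar u_R-\bar u\|_{\dot{\mathcal{H}}^1}\le C R^{-1/2+\beta}.$$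
   Context: Lattice: $\Lambda=\{l-(\tfrac12,\tfrac12): l\in\mathbb{Z}^2\}$, $\Gamma_0=\{(x_1,0): x_1\le 0\}$, $\Gamma_\pm=\{m\in\Lambda: m_1<0,\ m_2=\pm\tfrac12\}$. $\mathcal{R}=\{e_1,e_2,-e_1,-e_2\}$; $\mathcal{R}(m)=\mathcal{R}$ if $m\notin\Gamma_+\cup\Gamma_-$, $\mathcal{R}(m)=\mathcal{R}\setminus\{-e_2\}$ if $m\in\Gamma_+$, and $\mathcal{R}(m)=\mathcal{R}\setminus\{e_2\}$ if $m\in\Gamma_-$. For $u:\Lambda\to\mathbb{R}$, $D_\rho u(m)=u(m+\rho)-u(m)$, and $Du(m)\in\mathbb{R}^{\mathcal{R}}$ has components $(Du(m))_\rho=D_\rho u(m)$ if $\rho\in\mathcal{R}(m)$ and $0$ otherwise. $B_R$ is the ball of radius $R$ centred at the origin. Function space: with $\hat x=(\tfrac12,\tfrac12)$, $\dot{\mathcal{H}}^1=\{u:\Lambda\to\mathbb{R}: Du\in\ell^2,\ u(\hat x)=0\}$, and $\|u\|_{\dot{\mathcal{H}}^1}=\|Du\|_{\ell^2}=(\sum_{m\in\Lambda}|Du(m)|^2)^{1/2}$; the latter expression (and $\mathcal{E}$, which depends only on $Du$) is also used for functions not vanishing at $\hat x$. Predictor: for $x=(r_x\cos\theta_x,r_x\sin\theta_x)\in\mathbb{R}^2\setminus\Gamma_0$ with $\theta_x\in(-\pi,\pi)$, $\omega(x)=(\omega_1(x),\omega_2(x))=(\sqrt{r_x}\cos(\theta_x/2),\sqrt{r_x}\sin(\theta_x/2))$,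 and $\hat u(x)=\epsilon\,\omega_2(x)$. Energy: $V(Du(m))=\sum_{\rho\in\mathcal{R}}\phi((Du(m))_\rho)$ and $\mathcal{E}(u)=\sum_{m\in\Lambda}\big(V(D\hat u(m)+Du(m))-V(D\hat u(m))\big)$, a finite sum for finitely supported $u$, extended by continuity to $\dot{\mathcal{H}}^1$. $\arg\min$ is understood in the sense of local minimisers. A solution $\bar u_R$ is stable if there is $\lambda'>0$ with $\delta^2\mathcal{E}(\bar u_R)[v,v]\ge\lambda'\|Dv\|_{\ell^2}^2$ for all $v\in\mathcal{H}^0_R$. *)

theory Defs
  imports "HOL-Analysis.Analysis"
begin

(* The lattice is indexed by the integer pairs: the index l stands for the point
   l - (1/2,1/2), so a function on the lattice is a function on site.  The plane is
   identified with the complex numbers, which makes cmod and Arg the polar coordinates. *)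
type_synonym site = "int \<times> int"

definition pos :: "site \<Rightarrow> complex" where
  "pos l = Complex (of_int (fst l) - 1/2) (of_int (snd l) - 1/2)"

definition xhat :: site where
  "xhat = (1, 1)"

lemma pos_xhat: "pos xhat = Complex (1/2) (1/2)"
  by (simp add: pos_def xhat_def)

definition Gamma_plus :: "site set" where
  "Gamma_plus = {m. Re (pos m) < 0 \<and> Im (pos m) = 1/2}"

definition Gamma_minus :: "site set" where
  "Gamma_minus = {m. Re (pos m) < 0 \<and> Im (pos m) = - 1/2}"

definition dirs :: "site set" where
  "dirs = {(1, 0), (0, 1), (- 1, 0), (0, - 1)}"

definition dirs_at :: "site \<Rightarrow> site set" where
  "dirs_at m = (if m \<in> Gamma_plus then dirs - {(0, - 1)}
                else if m \<in> Gamma_minus then dirs - {(0, 1)}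
                else dirs)"

definition grad :: "(site \<Rightarrow> real) \<Rightarrow> site \<Rightarrow> site \<Rightarrow> real" where
  "grad u m \<rho> = (if \<rho> \<in> dirs_at m then u (m + \<rho>) - u m else 0)"

definition grad_in_l2 :: "(site \<Rightarrow> real) \<Rightarrow> bool" where
  "grad_in_l2 u \<longleftrightarrow> (\<lambda>m. \<Sum>\<rho>\<in>dirs. (grad u m \<rho>)\<^sup>2) summable_on UNIV"

(* Only meaningful when grad_in_l2 u holds; infsum is 0 for a divergent sum. *)
definition dnorm :: "(site \<Rightarrow> real) \<Rightarrow> real" where
  "dnorm u = sqrt (\<Sum>\<^sub>\<infinity>m. \<Sum>\<rho>\<in>dirs. (grad u m \<rho>)\<^sup>2)"

definition H1dot :: "(site \<Rightarrow> real) set" where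
  "H1dot = {u. grad_in_l2 u \<and> u xhat = 0}"

definition H0 :: "site set \<Rightarrow> (site \<Rightarrow> real) set" where
  "H0 \<Omega> = {v. \<forall>m. m \<notin> \<Omega> \<longrightarrow> v m = 0}"

definition omega2 :: "complex \<Rightarrow> real" where
  "omega2 x = sqrt (cmod x) * sin (Arg x / 2)"

definition predictor :: "real \<Rightarrow> site \<Rightarrow> real" where
  "predictor \<epsilon> m = \<epsilon> * omega2 (pos m)"

definition site_energy :: "(real \<Rightarrow> real) \<Rightarrow> (site \<Rightarrow> real) \<Rightarrow> real" where
  "site_energy \<phi> g = (\<Sum>\<rho>\<in>dirs. \<phi> (g \<rho>))"

definition finitely_supported :: "(site \<Rightarrow> real) \<Rightarrow> bool" where
  "finitely_supported u \<longleftrightarrow> finite {m. u m \<noteq> 0}"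

(* For finitely supported u all but finitely many summands vanish. *)
definition energy_fin :: "(real \<Rightarrow> real) \<Rightarrow> real \<Rightarrow> (site \<Rightarrow> real) \<Rightarrow> real" where
  "energy_fin \<phi> \<epsilon> u =
     (\<Sum>\<^sub>\<infinity>m. site_energy \<phi> (\<lambda>\<rho>. grad (predictor \<epsilon>) m \<rho> + grad u m \<rho>)
            - site_energy \<phi> (grad (predictor \<epsilon>) m))"

(* Extension by continuity: the limit of energy_fin along finitely supported w
   with dnorm (w - u) tending to 0.  The approximants w need not vanish at xhat, since the
   energy depends on the gradient only. *)
definition energy :: "(real \<Rightarrow> real) \<Rightarrow> real \<Rightarrow> (site \<Rightarrow> real) \<Rightarrow> real" where
  "energy \<phi> \<epsilon> u =
     (if finitely_supported u then energy_fin \<phi> \<epsilon> u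
      else Lim (inf (filtercomap (\<lambda>w. dnorm (\<lambda>m. w m - u m)) (nhds 0))
                    (principal {w. finitely_supported w}))
               (energy_fin \<phi> \<epsilon>))"

definition second_variation ::
    "((site \<Rightarrow> real) \<Rightarrow> real) \<Rightarrow> (site \<Rightarrow> real) \<Rightarrow> (site \<Rightarrow> real) \<Rightarrow> real" where
  "second_variation F u v = (deriv ^^ 2) (\<lambda>t::real. F (\<lambda>m. u m + t * v m)) 0"

definition local_minimiser ::
    "((site \<Rightarrow> real) \<Rightarrow> real) \<Rightarrow> (site \<Rightarrow> real) set \<Rightarrow> (site \<Rightarrow> real) \<Rightarrow> bool" where
  "local_minimiser F S u \<longleftrightarrow>
     u \<in> S \<and> (\<exists>\<delta>>0. \<forall>w\<in>S. dnorm (\<lambda>m. w m - u m) < \<delta> \<longrightarrow> F u \<le> F w)"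

definition stable_on ::
    "((site \<Rightarrow> real) \<Rightarrow> real) \<Rightarrow> (site \<Rightarrow> real) set \<Rightarrow> (site \<Rightarrow> real) \<Rightarrow> bool" where
  "stable_on F S u \<longleftrightarrow>
     (\<exists>\<mu>>0. \<forall>v\<in>S. second_variation F u v \<ge> \<mu> * (dnorm v)\<^sup>2)"

definition C_k :: "nat \<Rightarrow> (real \<Rightarrow> real) \<Rightarrow> bool" where
  "C_k k f \<longleftrightarrow>
     (\<forall>j<k. \<forall>x. (deriv ^^ j) f field_differentiable at x) \<and>
     continuous_on UNIV ((deriv ^^ k) f)"

end

theory Submission
  imports Defs
begin

text \<open>
  Two things have to be shown: near a strongly stable equilibrium, minimising over any finite
  set of sites loses only a constant factor against the best approximation of the equilibrium
  by functions supported there; and cutting the equilibrium off at radius R costs no more than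
  R^(-1/2+\<beta>).

  The energy is a sum over nearest-neighbour bonds of a smooth function of the bond strain.
  With a divergence-free reference flux F subtracted, which does not change the energy of
  finitely supported displacements, it becomes an absolutely convergent series for every
  square summable strain, twice differentiable in the l2 norm (\<open>energy_eq\<close>,
  \<open>second_variation_eq\<close>). Strong stability makes it uniformly convex on a small
  ball around the equilibrium u, on which E(u) + c e^2 \<le> E(v) \<le> E(u) + K e^2 for the
  distance e of v from u, where E is the energy. If v0 is supported in \<Omega> and close to
  u, a minimiser w over the functions supported in \<Omega> and in a small closed ball about
  v0 exists by compactness. From E(w) \<le> E(v0) its distance from u is at most a constant
  times that of v0, hence w lies in the interior of the ball, is a genuine local minimiser,
  and is stable (\<open>quasi_optimal\<close>).

  For v0 take u minus a constant, cut off linearly between the radii n and 2n for n comparable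
  to R. With the constant chosen by a Poincare inequality on the slit annulus
  (\<open>annulus_poincare\<close>), the error is bounded by the gradient energy of u outside
  the radius n (\<open>truncation\<close>). The rate therefore follows from the summability of
  |m|^(2\<alpha>) |Du(m)|^2 for every \<alpha> < 1/2, which is the heart of the proof
  (\<open>equilibrium_decay\<close>).

  Why does the strain decay like this? The equilibrium stress p = \<phi>'(a + Du) - F, where a
  is the strain of the predictor, is divergence free and carries no flux across the crack, so
  it is the rotated gradient of a stream function s on the dual lattice that vanishes on the
  crack (\<open>stream_function_exists\<close>): the free boundary condition has become a
  Dirichlet condition. Since strains are orthogonal to rotated gradients
  (\<open>gradients_are_curl_free\<close>), s solves a discrete Poisson equation with source q
  = p - Du. The predictor is the imaginary part of the square root, and F is the exactly
  divergence-free flux obtained from differences of its harmonic conjugate; a and F differ by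
  O(|m|^(-3/2)) (\<open>predictor_consistent\<close>). As \<phi> is even, forces are linear up
  to cubic terms, and so q consists of a part O(|m|^(-3/2)), square summable against
  |m|^\<alpha>, and a part that is small compared with p far out.

  Testing the equation with w^2 s for a weight w comparable to |m|^\<alpha> bounds the energy
  of w s by the sum of |dw|^2 s^2, where |dw|^2 is about \<alpha>^2 w^2/|m|^2, plus source
  terms. A Hardy inequality for functions that vanish on a half line and near its tip controls
  the sum of |m|^(-2) (w s)^2 by 1/k^2 times the energy of w s, for every k < 1/2 up to an
  arbitrarily small loss (\<open>crack_hardy\<close>); the constant comes from cos(k
  \<theta>), which is bounded away from zero on the slit plane exactly because k < 1/2, and is
  a supersolution of the discrete problem far from the tip
  (\<open>angular_supersolution\<close>). Choosing \<alpha> < k < 1/2 absorbs the first term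
  (\<open>stream_decay\<close>). This is also where the limit 1/2 for the exponent comes from.
\<close>

section \<open>Square summable families\<close>

definition l2 :: "('i \<Rightarrow> real) \<Rightarrow> bool" where
  "l2 g \<longleftrightarrow> (\<lambda>i. (g i)\<^sup>2) summable_on UNIV"

definition l2norm :: "('i \<Rightarrow> real) \<Rightarrow> real" where
  "l2norm g = sqrt (\<Sum>\<^sub>\<infinity>i. (g i)\<^sup>2)"

lemma l2norm_nonneg [simp]: "0 \<le> l2norm g"
  by (simp add: l2norm_def infsum_nonneg)

lemma l2norm_sq: "(l2norm g)\<^sup>2 = (\<Sum>\<^sub>\<infinity>i. (g i)\<^sup>2)"
  by (simp add: l2norm_def infsum_nonneg)

lemma summable_by_bound:
  fixes f :: "'i \<Rightarrow> real"
  assumes "g summable_on A" "\<And>i. i \<in> A \<Longrightarrow> \<bar>f i\<bar> \<le> g i"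
  shows "f summable_on A"
proof -
  have "(\<lambda>i. norm (f i)) summable_on A"
    using assms by (intro summable_on_comparison_test[OF assms(1)]) auto
  then show ?thesis by (rule abs_summable_summable)
qed

lemma summable_finite_support:
  fixes f :: "'i \<Rightarrow> real"
  assumes "finite S" "\<And>i. i \<notin> S \<Longrightarrow> f i = 0"
  shows "f summable_on UNIV"
  by (rule finite_nonzero_values_imp_summable_on, rule finite_subset[OF _ assms(1)]) (use assms(2) in auto)

lemma infsum_abs_le:
  fixes f :: "'i \<Rightarrow> real"
  assumes "g summable_on A" "\<And>i. i \<in> A \<Longrightarrow> \<bar>f i\<bar> \<le> g i"
  shows "\<bar>infsum f A\<bar> \<le> infsum g A"
proof -
  have f: "f summable_on A" by (rule summable_by_bound[OF assms])
  have "infsum f A \<le> infsum g A"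
    by (rule infsum_mono[OF f assms(1)]) (use assms(2) in force)
  moreover have "infsum (\<lambda>i. - f i) A \<le> infsum g A"
    by (rule infsum_mono[OF summable_on_uminus[THEN iffD2, OF f] assms(1)]) (use assms(2) in force)
  ultimately show ?thesis by (simp add: infsum_uminus)
qed

lemma infsum_bounded_finite:
  fixes f :: "'i \<Rightarrow> real"
  assumes nn: "\<And>i. 0 \<le> f i" and b: "\<And>S. finite S \<Longrightarrow> sum f S \<le> K"
  shows "f summable_on UNIV" "infsum f UNIV \<le> K"
proof -
  show s: "f summable_on UNIV"
    by (rule nonneg_bdd_above_summable_on) (use nn b in \<open>auto intro!: bdd_aboveI[of _ K]\<close>)
  show "infsum f UNIV \<le> K"
    by (rule infsum_le_finite_sums[OF s]) (use b in auto)
qed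

lemma summable_on_diff_real:
  fixes f g :: "'i \<Rightarrow> real"
  shows "f summable_on A \<Longrightarrow> g summable_on A \<Longrightarrow> (\<lambda>i. f i - g i) summable_on A"
  using summable_on_add[of f A "\<lambda>i. - g i"] by (simp add: summable_on_uminus)

lemma infsum_diff_real:
  fixes f g :: "'i \<Rightarrow> real"
  shows "f summable_on A \<Longrightarrow> g summable_on A \<Longrightarrow> infsum (\<lambda>i. f i - g i) A = infsum f A - infsum g A"
  using infsum_add[of f A "\<lambda>i. - g i"] by (simp add: summable_on_uminus infsum_uminus)

lemma l2_mult_summable:
  assumes "l2 f" "l2 g" shows "(\<lambda>i. f i * g i) summable_on UNIV"
proof (rule summable_by_bound)
  show "(\<lambda>i. (f i)\<^sup>2 + (g i)\<^sup>2) summable_on UNIV"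
    using assms by (auto simp: l2_def intro: summable_on_add)
  show "\<bar>f i * g i\<bar> \<le> (f i)\<^sup>2 + (g i)\<^sup>2" for i
    using sum_squares_bound[of "\<bar>f i\<bar>" "\<bar>g i\<bar>"] mult_nonneg_nonneg[OF abs_ge_zero[of "f i"] abs_ge_zero[of "g i"]]
    unfolding abs_mult power2_abs by linarith
qed

lemma l2_add [intro]:
  assumes "l2 f" "l2 g" shows "l2 (\<lambda>i. f i + g i)"
  unfolding l2_def
proof (rule summable_by_bound)
  show "(\<lambda>i. 2 * (f i)\<^sup>2 + 2 * (g i)\<^sup>2) summable_on UNIV"
    using assms by (auto simp: l2_def intro: summable_on_add summable_on_cmult_right)
  show "\<bar>(f i + g i)\<^sup>2\<bar> \<le> 2 * (f i)\<^sup>2 + 2 * (g i)\<^sup>2" for i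
    using sum_squares_bound[of "f i" "g i"] abs_of_nonneg[OF zero_le_power2[of "f i + g i"]]
    unfolding power2_sum by linarith
qed

lemma l2_cmult [intro]: "l2 f \<Longrightarrow> l2 (\<lambda>i. c * f i)"
  by (auto simp: l2_def power_mult_distrib intro: summable_on_cmult_right)

lemma l2_diff [intro]:
  assumes "l2 f" "l2 g" shows "l2 (\<lambda>i. f i - g i)"
  using l2_add[OF assms(1) l2_cmult[OF assms(2), of "-1"]] by simp

lemma l2_bound:
  assumes "l2 g" "\<And>i. \<bar>f i\<bar> \<le> C * \<bar>g i\<bar>" shows "l2 f"
  unfolding l2_def
proof (rule summable_by_bound)
  show "(\<lambda>i. C\<^sup>2 * (g i)\<^sup>2) summable_on UNIV"
    using assms(1) by (auto simp: l2_def intro: summable_on_cmult_right)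
  show "\<bar>(f i)\<^sup>2\<bar> \<le> C\<^sup>2 * (g i)\<^sup>2" for i
    using power_mono[OF assms(2)[of i], of 2] by (simp add: power_mult_distrib)
qed

lemma L2_set_le_l2norm: "l2 f \<Longrightarrow> finite S \<Longrightarrow> L2_set f S \<le> l2norm f"
  unfolding L2_set_def l2norm_def l2_def
  by (intro real_sqrt_le_mono finite_sum_le_infsum) auto

lemma l2norm_le_finite:
  assumes "0 \<le> K" "\<And>S. finite S \<Longrightarrow> L2_set f S \<le> K" shows "l2norm f \<le> K"
proof -
  have "sum (\<lambda>i. (f i)\<^sup>2) S \<le> K\<^sup>2" if "finite S" for S
    using assms(2)[OF that] assms(1) by (simp add: L2_set_def sqrt_le_D)
  from infsum_bounded_finite(2)[OF _ this] show ?thesis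
    unfolding l2norm_def using assms(1) by (simp add: real_le_lsqrt infsum_nonneg)
qed

lemma l2norm_triangle:
  assumes "l2 f" "l2 g" shows "l2norm (\<lambda>i. f i + g i) \<le> l2norm f + l2norm g"
proof (rule l2norm_le_finite)
  fix S :: "'a set" assume "finite S"
  then show "L2_set (\<lambda>i. f i + g i) S \<le> l2norm f + l2norm g"
    using L2_set_triangle_ineq[of f g S] L2_set_le_l2norm assms by (meson add_mono order_trans)
qed simp

lemma l2norm_cmult: "l2norm (\<lambda>i. c * f i) = \<bar>c\<bar> * l2norm f"
  by (simp add: l2norm_def power_mult_distrib infsum_cmult_right' real_sqrt_mult)

lemma l2norm_minus_commute: "l2norm (\<lambda>i. f i - g i) = l2norm (\<lambda>i. g i - f i)"
  by (simp add: l2norm_def power2_commute)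

lemma l2_inner_le:
  assumes "l2 f" "l2 g"
  shows "\<bar>\<Sum>\<^sub>\<infinity>i. f i * g i\<bar> \<le> l2norm f * l2norm g"
proof -
  have "sum (\<lambda>i. \<bar>f i * g i\<bar>) S \<le> l2norm f * l2norm g" if "finite S" for S
  proof -
    have "sum (\<lambda>i. \<bar>f i * g i\<bar>) S \<le> L2_set f S * L2_set g S"
      using L2_set_mult_ineq[of f g S] by (simp add: abs_mult)
    also have "\<dots> \<le> l2norm f * l2norm g"
      using that assms L2_set_le_l2norm by (intro mult_mono) auto
    finally show ?thesis .
  qed
  from infsum_bounded_finite[OF _ this]
  have "(\<lambda>i. \<bar>f i * g i\<bar>) summable_on UNIV" "(\<Sum>\<^sub>\<infinity>i. \<bar>f i * g i\<bar>) \<le> l2norm f * l2norm g" by auto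
  with infsum_abs_le[of "\<lambda>i. \<bar>f i * g i\<bar>" UNIV "\<lambda>i. f i * g i"] show ?thesis by force
qed

lemma l2_pointwise: "l2 f \<Longrightarrow> \<bar>f i\<bar> \<le> l2norm f"
  using L2_set_le_l2norm[of f "{i}"] by simp

lemma l2_finite_large:
  assumes "l2 f" "0 < d" shows "finite {i. d \<le> \<bar>f i\<bar>}"
proof (rule ccontr)
  assume inf: "infinite {i. d \<le> \<bar>f i\<bar>}"
  obtain n :: nat where n: "(\<Sum>\<^sub>\<infinity>i. (f i)\<^sup>2) < of_nat n * d\<^sup>2"
    using \<open>0 < d\<close> ex_less_of_nat_mult[of "d\<^sup>2"] by auto
  obtain S where S: "finite S" "card S = n" "S \<subseteq> {i. d \<le> \<bar>f i\<bar>}"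
    using infinite_arbitrarily_large[OF inf] by blast
  have "of_nat n * d\<^sup>2 = (\<Sum>i\<in>S. d\<^sup>2)" using S by simp
  also have "\<dots> \<le> (\<Sum>i\<in>S. (f i)\<^sup>2)"
    using S \<open>0 < d\<close> by (intro sum_mono) (auto simp: abs_le_square_iff[symmetric])
  also have "\<dots> \<le> (\<Sum>\<^sub>\<infinity>i. (f i)\<^sup>2)"
    using assms S unfolding l2_def by (intro finite_sum_le_infsum) auto
  finally show False using n by simp
qed

lemma infsum_diff3:
  fixes f g h :: "'i \<Rightarrow> real"
  assumes "f summable_on A" "g summable_on A" "h summable_on A"
  shows "infsum f A - infsum g A - infsum h A = infsum (\<lambda>i. f i - g i - h i) A"
  using infsum_diff_real[OF summable_on_diff_real[OF assms(1,2)] assms(3)] infsum_diff_real[OF assms(1,2)] by simp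

lemma infsum_diff4:
  fixes f g h k :: "'i \<Rightarrow> real"
  assumes "f summable_on A" "g summable_on A" "h summable_on A" "k summable_on A"
  shows "infsum f A - infsum g A - infsum h A - infsum k A = infsum (\<lambda>i. f i - g i - h i - k i) A"
  using infsum_diff_real[OF summable_on_diff_real[OF assms(1,2)] assms(3)] infsum_diff_real[OF assms(1,2)]
    infsum_diff_real[OF summable_on_diff_real[OF summable_on_diff_real[OF assms(1,2)] assms(3)] assms(4)] by simp

section \<open>Bonds\<close>

text \<open>The bond (l,False) joins l to l + (1,0), and (l,True) joins l to l + (0,1). The same pairs index
  the edges of the dual lattice, each crossing one bond.\<close>

type_synonym bond = "site \<times> bool"

text \<open>Site l sits at l - (1/2,1/2), while the dual vertex l sits at l itself. The same index set
  therefore describes the sites whose upward bond crosses the crack and the dual vertices lying on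
  the crack.\<close>

definition cracked :: "site set" where
  "cracked = {l. fst l \<le> 0 \<and> snd l = 0}"

text \<open>Bonds that cross the crack are severed, which is encoded by a zero difference.\<close>

definition bdiff :: "(site \<Rightarrow> real) \<Rightarrow> bond \<Rightarrow> real" where
  "bdiff u b = (if snd b then (if fst b \<in> cracked then 0 else u (fst b + (0,1)) - u (fst b))
                else u (fst b + (1,0)) - u (fst b))"

text \<open>The difference of a function on the dual lattice along the dual edge that crosses a bond, with
  the sign of a flux through that edge: the discrete rotated gradient.\<close>

definition cdiff :: "(site \<Rightarrow> real) \<Rightarrow> bond \<Rightarrow> real" where
  "cdiff s b = (if snd b then s (fst b - (1,0)) - s (fst b)
                else s (fst b) - s (fst b - (0,1)))"

lemma Gamma_minus_iff: "l \<in> Gamma_minus \<longleftrightarrow> l \<in> cracked"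
proof -
  have "real_of_int (fst l) - 1/2 < 0 \<longleftrightarrow> fst l \<le> 0" by linarith
  then show ?thesis by (auto simp: Gamma_minus_def pos_def cracked_def)
qed

lemma Gamma_plus_iff: "l \<in> Gamma_plus \<longleftrightarrow> l - (0,1) \<in> cracked"
proof -
  have "real_of_int (fst l) - 1/2 < 0 \<longleftrightarrow> fst l \<le> 0" by linarith
  then show ?thesis by (auto simp: Gamma_plus_def pos_def cracked_def)
qed

lemma grad_east: "grad u m (1,0) = bdiff u (m, False)"
  by (auto simp: grad_def dirs_at_def dirs_def bdiff_def)

lemma grad_north: "grad u m (0,1) = bdiff u (m, True)"
  by (auto simp: grad_def dirs_at_def dirs_def bdiff_def Gamma_minus_iff Gamma_plus_iff cracked_def)

lemma grad_west: "grad u m (-1,0) = - bdiff u (m - (1,0), False)"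
  by (cases m) (auto simp: grad_def dirs_at_def dirs_def bdiff_def)

lemma grad_south: "grad u m (0,-1) = - bdiff u (m - (0,1), True)"
  by (cases m) (auto simp: grad_def dirs_at_def dirs_def bdiff_def Gamma_minus_iff Gamma_plus_iff cracked_def)

lemma sum_dirs: "(\<Sum>\<rho>\<in>dirs. h \<rho>) = h (1,0) + h (0,1) + h (-1,0) + (h (0,-1)::real)"
  by (simp add: dirs_def)

lemma has_sum_shift: "((\<lambda>l. h (l - a)) has_sum S) UNIV \<longleftrightarrow> ((h :: site \<Rightarrow> real) has_sum S) UNIV"
  by (rule has_sum_reindex_bij_witness[where i="\<lambda>l. l + a" and j="\<lambda>l. l - a"]) auto

lemma infsum_shift: "(\<Sum>\<^sub>\<infinity>l. h (l - a)) = (\<Sum>\<^sub>\<infinity>l. (h :: site \<Rightarrow> real) l)"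
  by (rule infsum_reindex_bij_witness[where i="\<lambda>l. l + a" and j="\<lambda>l. l - a"]) auto

lemma bond_UNIV: "(UNIV :: bond set) = range (\<lambda>l. (l, False)) \<union> range (\<lambda>l. (l, True))"
proof -
  have "b \<in> range (\<lambda>l. (l, False)) \<union> range (\<lambda>l. (l, True))" for b :: bond by (cases b; cases "snd b") auto
  then show ?thesis by auto
qed

lemma has_sum_bond:
  fixes h :: "bond \<Rightarrow> real"
  assumes "((\<lambda>l. h (l, False)) has_sum A) UNIV" "((\<lambda>l. h (l, True)) has_sum B) UNIV"
  shows "(h has_sum (A + B)) UNIV"
  unfolding bond_UNIV
proof (rule has_sum_Un_disjoint)
  show "(h has_sum A) (range (\<lambda>l. (l, False)))"
    using assms(1) by (subst has_sum_reindex) (auto simp: inj_on_def o_def)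
  show "(h has_sum B) (range (\<lambda>l. (l, True)))"
    using assms(2) by (subst has_sum_reindex) (auto simp: inj_on_def o_def)
qed auto

lemma summable_bond_iff:
  fixes h :: "bond \<Rightarrow> real"
  shows "h summable_on UNIV \<longleftrightarrow> (\<lambda>l. h (l, False)) summable_on UNIV \<and> (\<lambda>l. h (l, True)) summable_on UNIV"
proof
  assume h: "h summable_on UNIV"
  have "h summable_on range (\<lambda>l. (l, i))" for i by (rule summable_on_subset_banach[OF h]) simp
  then show "(\<lambda>l. h (l, False)) summable_on UNIV \<and> (\<lambda>l. h (l, True)) summable_on UNIV"
    by (auto simp: summable_on_reindex inj_on_def o_def dest!: summable_on_reindex[THEN iffD1, rotated])
next
  assume "(\<lambda>l. h (l, False)) summable_on UNIV \<and> (\<lambda>l. h (l, True)) summable_on UNIV"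
  then show "h summable_on UNIV" using has_sum_bond[of h] by (auto simp: summable_on_def)
qed

lemma infsum_bond:
  fixes h :: "bond \<Rightarrow> real"
  assumes "h summable_on UNIV"
  shows "(\<Sum>\<^sub>\<infinity>b. h b) = (\<Sum>\<^sub>\<infinity>l. h (l, False) + h (l, True))"
proof -
  have s: "(\<lambda>l. h (l, False)) summable_on UNIV" "(\<lambda>l. h (l, True)) summable_on UNIV"
    using assms summable_bond_iff by blast+
  show ?thesis
    using infsumI[OF has_sum_bond[OF has_sum_infsum[OF s(1)] has_sum_infsum[OF s(2)]]]
    by (simp add: infsum_add[OF s])
qed

text \<open>Each bond is seen from both of its end points.\<close>

lemma infsum_star_edges:
  fixes h :: "bond \<Rightarrow> real"
  assumes "h summable_on UNIV"
  shows "((\<lambda>m. h (m, False) + h (m, True) + h (m - (1,0), False) + h (m - (0,1), True))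
           has_sum 2 * (\<Sum>\<^sub>\<infinity>b. h b)) UNIV"
proof -
  have s: "(\<lambda>l. h (l, False)) summable_on UNIV" "(\<lambda>l. h (l, True)) summable_on UNIV"
    using assms summable_bond_iff by blast+
  let ?A = "\<Sum>\<^sub>\<infinity>l. h (l, False)" and ?B = "\<Sum>\<^sub>\<infinity>l. h (l, True)"
  have A: "((\<lambda>l. h (l, False)) has_sum ?A) UNIV" and B: "((\<lambda>l. h (l, True)) has_sum ?B) UNIV"
    using s by auto
  have A': "((\<lambda>l. h (l - (1,0), False)) has_sum ?A) UNIV" using A by (subst has_sum_shift[of "\<lambda>l. h (l, False)"])
  have B': "((\<lambda>l. h (l - (0,1), True)) has_sum ?B) UNIV" using B by (subst has_sum_shift[of "\<lambda>l. h (l, True)"])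
  have "(\<Sum>\<^sub>\<infinity>b. h b) = ?A + ?B" using infsumI[OF has_sum_bond[OF A B]] .
  with has_sum_add[OF has_sum_add[OF has_sum_add[OF A B] A'] B'] show ?thesis
    by (simp add: algebra_simps)
qed

lemma infsum_star:
  fixes f :: "site \<Rightarrow> site \<Rightarrow> real" and h :: "bond \<Rightarrow> real"
  assumes "h summable_on UNIV"
    and "\<And>m. f m (1,0) = h (m, False)" "\<And>m. f m (0,1) = h (m, True)"
    and "\<And>m. f m (-1,0) = h (m - (1,0), False)" "\<And>m. f m (0,-1) = h (m - (0,1), True)"
  shows "((\<lambda>m. \<Sum>\<rho>\<in>dirs. f m \<rho>) has_sum 2 * (\<Sum>\<^sub>\<infinity>b. h b)) UNIV"
  using infsum_star_edges[OF assms(1)] assms(2-) by (simp add: sum_dirs)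

lemma grad_in_l2_iff: "grad_in_l2 u \<longleftrightarrow> l2 (bdiff u)"
proof
  assume g: "grad_in_l2 u"
  have "(\<lambda>l. (bdiff u (l, i))\<^sup>2) summable_on UNIV" for i
    by (rule summable_by_bound[OF g[unfolded grad_in_l2_def]], cases i)
       (auto simp: sum_dirs grad_east grad_north grad_west grad_south intro: add_nonneg_nonneg)
  then show "l2 (bdiff u)" by (simp add: l2_def summable_bond_iff)
next
  assume "l2 (bdiff u)"
  from infsum_star[OF this[unfolded l2_def], where f="\<lambda>m \<rho>. (grad u m \<rho>)\<^sup>2"]
  show "grad_in_l2 u"
    by (auto simp: grad_in_l2_def grad_east grad_north grad_west grad_south summable_on_def)
qed

lemma dnorm_eq:
  assumes "l2 (bdiff u)" shows "dnorm u = sqrt 2 * l2norm (bdiff u)"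
  using infsumI[OF infsum_star[OF assms[unfolded l2_def], where f="\<lambda>m \<rho>. (grad u m \<rho>)\<^sup>2"]]
  by (simp add: dnorm_def l2norm_def grad_east grad_north grad_west grad_south real_sqrt_mult)

lemma bdiff_linear: "bdiff (\<lambda>m. a * u m + c * v m) b = a * bdiff u b + c * bdiff v b"
  by (simp add: bdiff_def algebra_simps)

lemma bdiff_add: "bdiff (\<lambda>m. u m + v m) = (\<lambda>b. bdiff u b + bdiff v b)"
  using bdiff_linear[of 1 u 1 v] by auto
lemma bdiff_diff: "bdiff (\<lambda>m. u m - v m) = (\<lambda>b. bdiff u b - bdiff v b)"
  using bdiff_linear[of 1 u "-1" v] by auto
lemma bdiff_cmult: "bdiff (\<lambda>m. t * v m) = (\<lambda>b. t * bdiff v b)"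
  using bdiff_linear[of t v 0 v] by auto
lemma bdiff_const: "bdiff (\<lambda>m. u m - c) = bdiff u"
  by (auto simp: bdiff_def)

lemma finite_shift_img: "finite S \<Longrightarrow> finite {l :: site. l + a \<in> S}"
  by (rule finite_subset[where B="(\<lambda>l. l - a) ` S"]) (auto simp: image_iff, force)

lemma finite_shift_img': "finite S \<Longrightarrow> finite {l :: site. l - a \<in> S}"
  using finite_shift_img[of S "-a"] by simp

lemma finite_bdiff_support:
  assumes "finitely_supported v" shows "finite {b. bdiff v b \<noteq> 0}"
proof (rule finite_subset)
  let ?S = "{l. v l \<noteq> 0}"
  have S: "finite ?S" using assms by (simp add: finitely_supported_def)
  show "{b. bdiff v b \<noteq> 0} \<subseteq> (?S \<union> {l. l + (1,0) \<in> ?S} \<union> {l. l + (0,1) \<in> ?S}) \<times> UNIV"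
    by (auto simp: bdiff_def split: if_splits)
  show "finite ((?S \<union> {l. l + (1,0) \<in> ?S} \<union> {l. l + (0,1) \<in> ?S}) \<times> (UNIV::bool set))"
    using S finite_shift_img[OF S] by auto
qed

lemma l2_bdiff_finite: "finitely_supported v \<Longrightarrow> l2 (bdiff v)"
  unfolding l2_def by (rule summable_finite_support[OF finite_bdiff_support]) auto

definition divg :: "(bond \<Rightarrow> real) \<Rightarrow> site \<Rightarrow> real" where
  "divg r l = r (l, False) - r (l - (1,0), False) + r (l, True) - r (l - (0,1), True)"

text \<open>The hypothesis on r says that no flux passes through the severed bonds. There the difference of
  v is replaced by zero, so a flux through them would leave a boundary term.\<close>

lemma summation_by_parts:
  assumes v: "finitely_supported v" and r: "\<And>l. l \<in> cracked \<Longrightarrow> r (l, True) = 0"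
  shows "(\<Sum>\<^sub>\<infinity>b. r b * bdiff v b) = - (\<Sum>\<^sub>\<infinity>l. v l * divg r l)"
proof -
  let ?S = "{l. v l \<noteq> 0}"
  have S: "finite ?S" using v by (simp add: finitely_supported_def)
  have sm: "(\<lambda>b. r b * bdiff v b) summable_on UNIV"
    by (rule summable_finite_support[OF finite_bdiff_support[OF v]]) auto
  have 1: "(\<lambda>l. r (l,i) * v l) summable_on UNIV" for i
    by (rule summable_finite_support[OF S]) auto
  have 2: "(\<lambda>l. r (l,i) * v (l + a)) summable_on UNIV" for i a
    by (rule summable_finite_support[OF finite_shift_img[OF S, of a]]) auto
  have 3: "(\<lambda>l. r (l - a,i) * v l) summable_on UNIV" for i a
    by (rule summable_finite_support[OF S]) auto
  have sh: "(\<Sum>\<^sub>\<infinity>l. r (l,i) * v (l + a)) = (\<Sum>\<^sub>\<infinity>l. r (l - a,i) * v l)" for i a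
    using infsum_shift[of "\<lambda>l. r (l,i) * v (l + a)" a] by simp
  have "(\<Sum>\<^sub>\<infinity>b. r b * bdiff v b) = (\<Sum>\<^sub>\<infinity>l. (r (l,False) * v (l+(1,0)) - r (l,False) * v l)
            + (r (l,True) * v (l+(0,1)) - r (l,True) * v l))"
    unfolding infsum_bond[OF sm] using r by (intro infsum_cong) (auto simp: bdiff_def algebra_simps)
  also have "\<dots> = ((\<Sum>\<^sub>\<infinity>l. r (l,False) * v (l+(1,0))) - (\<Sum>\<^sub>\<infinity>l. r (l,False) * v l))
            + ((\<Sum>\<^sub>\<infinity>l. r (l,True) * v (l+(0,1))) - (\<Sum>\<^sub>\<infinity>l. r (l,True) * v l))"
    using 1 2 by (subst infsum_add | subst infsum_diff_real | intro summable_on_diff_real | simp)+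
  also have "\<dots> = - (\<Sum>\<^sub>\<infinity>l. (r (l,False) * v l - r (l-(1,0),False) * v l) + (r (l,True) * v l - r (l-(0,1),True) * v l))"
    unfolding sh using 1 3 by (subst infsum_add | subst infsum_diff_real | intro summable_on_diff_real | simp)+
  also have "\<dots> = - (\<Sum>\<^sub>\<infinity>l. v l * divg r l)"
    by (simp add: divg_def algebra_simps)
  finally show ?thesis .
qed

lemma divg_cdiff: "divg (cdiff s) l = 0"
  by (cases l) (simp add: divg_def cdiff_def)

section \<open>Energies of square summable strains\<close>

text \<open>The mean value theorem in the form that yields every Taylor estimate below, raising the order of
  vanishing at x by one each time.\<close>

lemma increment_bound:
  fixes f f' :: "real \<Rightarrow> real"
  assumes "\<And>y. (f has_real_derivative f' y) (at y)"
    and b: "\<And>y. \<bar>y\<bar> \<le> B \<Longrightarrow> \<bar>f' y\<bar> \<le> C * \<bar>y - x\<bar> ^ n"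
    and "\<bar>x\<bar> \<le> B" "\<bar>z\<bar> \<le> B" "0 \<le> C"
  shows "\<bar>f z - f x\<bar> \<le> C * \<bar>z - x\<bar> ^ Suc n"
proof -
  have "\<exists>\<xi>. \<bar>\<xi>\<bar> \<le> B \<and> \<bar>\<xi> - x\<bar> \<le> \<bar>z - x\<bar> \<and> f z - f x = (z - x) * f' \<xi>"
  proof (cases "x = z")
    case False
    then consider "x < z" | "z < x" by linarith
    then show ?thesis
    proof cases
      case 1
      from MVT2[OF 1, of f f'] assms(1) obtain \<xi> where "x < \<xi>" "\<xi> < z" "f z - f x = (z - x) * f' \<xi>" by blast
      then show ?thesis using assms(3,4) by (intro exI[of _ \<xi>]) auto
    next
      case 2
      from MVT2[OF 2, of f f'] assms(1) obtain \<xi> where "z < \<xi>" "\<xi> < x" "f x - f z = (x - z) * f' \<xi>" by blast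
      then show ?thesis using assms(3,4) by (intro exI[of _ \<xi>]) (auto simp: algebra_simps)
    qed
  qed (intro exI[of _ x], use assms(3) in simp)
  then obtain \<xi> where x: "\<bar>\<xi>\<bar> \<le> B" "\<bar>\<xi> - x\<bar> \<le> \<bar>z - x\<bar>" "f z - f x = (z - x) * f' \<xi>" by blast
  have "\<bar>f' \<xi>\<bar> \<le> C * \<bar>z - x\<bar> ^ n"
    using b[OF x(1)] x(2) \<open>0 \<le> C\<close> by (meson abs_ge_zero mult_left_mono order_trans power_mono)
  then have "\<bar>z - x\<bar> * \<bar>f' \<xi>\<bar> \<le> \<bar>z - x\<bar> * (C * \<bar>z - x\<bar> ^ n)" by (rule mult_left_mono) simp
  then show ?thesis unfolding x(3) abs_mult by (simp add: mult.commute mult.left_commute)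
qed

lemma has_derivative_of_quadratic_bound:
  fixes f :: "real \<Rightarrow> real"
  assumes b: "\<And>t. \<bar>t\<bar> \<le> 1 \<Longrightarrow> \<bar>f (x + t) - f x - D * t\<bar> \<le> C * t\<^sup>2"
  shows "(f has_real_derivative D) (at x)"
  unfolding DERIV_def LIM_eq
proof (intro allI impI)
  fix e :: real assume "0 < e"
  have C: "0 \<le> C" using order_trans[OF abs_ge_zero b[of 1]] by simp
  let ?d = "min 1 (e / (C + 1))"
  have "\<bar>(f (x + t) - f x) / t - D\<bar> < e" if t: "t \<noteq> 0" "\<bar>t\<bar> < ?d" for t
  proof -
    have "(f (x + t) - f x) / t - D = (f (x + t) - f x - D * t) / t" using t by (simp add: field_simps)
    then have "\<bar>(f (x + t) - f x) / t - D\<bar> \<le> C * t\<^sup>2 / \<bar>t\<bar>"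
      using b[of t] t by (simp add: abs_divide divide_right_mono)
    also have "\<dots> = C * \<bar>t\<bar>" by (cases "t \<ge> 0") (auto simp: power2_eq_square)
    also have "\<dots> \<le> C * (e / (C + 1))" using C t by (intro mult_left_mono) auto
    also have "\<dots> < e" using C \<open>0 < e\<close> by (simp add: field_simps)
    finally show ?thesis .
  qed
  then show "\<exists>s>0. \<forall>xa. xa \<noteq> 0 \<and> norm (xa - 0) < s \<longrightarrow> norm ((f (x + xa) - f x) / xa - D) < e"
    using \<open>0 < e\<close> C by (intro exI[of _ ?d]) auto
qed

text \<open>The successive derivatives of the potential are parameters; the normalisation makes the
  linearised model the discrete Laplacian.\<close>

locale potential =
  fixes \<phi> \<phi>1 \<phi>2 \<phi>3 \<phi>4 :: "real \<Rightarrow> real"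
  assumes D0: "\<And>x. (\<phi> has_real_derivative \<phi>1 x) (at x)"
    and D1: "\<And>x. (\<phi>1 has_real_derivative \<phi>2 x) (at x)"
    and D2: "\<And>x. (\<phi>2 has_real_derivative \<phi>3 x) (at x)"
    and D3: "\<And>x. (\<phi>3 has_real_derivative \<phi>4 x) (at x)"
    and cont4: "continuous_on UNIV \<phi>4"
    and even: "\<And>x. \<phi> (- x) = \<phi> x"
    and zero: "\<phi> 0 = 0"
    and unit: "\<phi>2 0 = 1"
begin

text \<open>One constant for all derivatives keeps the estimates below uniform on bounded sets of strains.\<close>

definition derivative_bound :: "real \<Rightarrow> real \<Rightarrow> bool" where
  "derivative_bound B K \<longleftrightarrow> 0 < K \<and> (\<forall>y. \<bar>y\<bar> \<le> B \<longrightarrow> \<bar>\<phi>2 y\<bar> \<le> K \<and> \<bar>\<phi>3 y\<bar> \<le> K \<and> \<bar>\<phi>4 y\<bar> \<le> K)"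

lemma ex_derivative_bound: "\<exists>K. derivative_bound B K"
proof -
  have cont: "continuous_on UNIV \<phi>2" "continuous_on UNIV \<phi>3"
    using D2 D3 by (meson DERIV_isCont continuous_at_imp_continuous_on)+
  have bdd: "\<exists>K. \<forall>y. \<bar>y\<bar> \<le> B \<longrightarrow> \<bar>f y\<bar> \<le> K" if "continuous_on UNIV f" for f :: "real \<Rightarrow> real"
  proof -
    have "compact (f ` {-B..B})"
      by (rule compact_continuous_image[OF continuous_on_subset[OF that subset_UNIV] compact_Icc])
    then obtain K where K: "\<forall>z\<in>f ` {-B..B}. norm z \<le> K"
      using compact_imp_bounded bounded_iff by blast
    have "\<bar>f y\<bar> \<le> K" if "\<bar>y\<bar> \<le> B" for y
    proof -
      have "y \<in> {-B..B}" using that by auto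
      then show ?thesis using K by force
    qed
    then show ?thesis by blast
  qed
  obtain K2 where 2: "\<forall>y. \<bar>y\<bar> \<le> B \<longrightarrow> \<bar>\<phi>2 y\<bar> \<le> K2" using bdd[OF cont(1)] by blast
  obtain K3 where 3: "\<forall>y. \<bar>y\<bar> \<le> B \<longrightarrow> \<bar>\<phi>3 y\<bar> \<le> K3" using bdd[OF cont(2)] by blast
  obtain K4 where 4: "\<forall>y. \<bar>y\<bar> \<le> B \<longrightarrow> \<bar>\<phi>4 y\<bar> \<le> K4" using bdd[OF cont4] by blast
  let ?K = "max 1 (max K2 (max K3 K4))"
  have "\<bar>\<phi>2 y\<bar> \<le> ?K \<and> \<bar>\<phi>3 y\<bar> \<le> ?K \<and> \<bar>\<phi>4 y\<bar> \<le> ?K" if "\<bar>y\<bar> \<le> B" for y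
    using 2[rule_format, OF that] 3[rule_format, OF that] 4[rule_format, OF that] by linarith
  then have "derivative_bound B ?K" unfolding derivative_bound_def by simp
  then show ?thesis by blast
qed

lemma force_odd: "\<phi>1 (- x) = - \<phi>1 x"
proof -
  have "((\<lambda>x. \<phi> (- x)) has_real_derivative - \<phi>1 (- x)) (at x)"
    using DERIV_chain2[OF D0[of "- x"] DERIV_minus[OF DERIV_ident]] by simp
  then have "(\<phi> has_real_derivative - \<phi>1 (- x)) (at x)" by (simp add: even)
  with D0[of x] show ?thesis using DERIV_unique by fastforce
qed

lemma stiffness_even: "\<phi>2 (- x) = \<phi>2 x"
proof -
  have "((\<lambda>x. - \<phi>1 (- x)) has_real_derivative \<phi>2 (- x)) (at x)"
    using DERIV_minus[OF DERIV_chain2[OF D1[of "- x"] DERIV_minus[OF DERIV_ident]]] by simp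
  then have "(\<phi>1 has_real_derivative \<phi>2 (- x)) (at x)" by (simp add: force_odd)
  with D1[of x] show ?thesis using DERIV_unique by fastforce
qed

lemma third_derivative_zero: "\<phi>3 0 = 0"
proof -
  have "((\<lambda>x. \<phi>2 (- x)) has_real_derivative - \<phi>3 (- 0)) (at 0)"
    using DERIV_chain2[OF D2[of "- 0"] DERIV_minus[OF DERIV_ident]] by simp
  then have "(\<phi>2 has_real_derivative - \<phi>3 0) (at 0)" by (simp add: stiffness_even)
  with D2[of 0] have "\<phi>3 0 = - \<phi>3 0" using DERIV_unique by blast
  then show ?thesis by simp
qed

context
  fixes B K assumes derivative_bound: "derivative_bound B K"
begin

lemma K_pos: "0 < K" using derivative_bound by (simp add: derivative_bound_def)

lemma stiffness_bound: "\<bar>x\<bar> \<le> B \<Longrightarrow> \<bar>\<phi>2 x\<bar> \<le> K" using derivative_bound by (simp add: derivative_bound_def)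

lemma force_lipschitz: assumes "\<bar>x\<bar> \<le> B" "\<bar>x + h\<bar> \<le> B" shows "\<bar>\<phi>1 (x + h) - \<phi>1 x\<bar> \<le> K * \<bar>h\<bar>"
  using increment_bound[of \<phi>1 \<phi>2 B K x 0 "x + h"] D1 derivative_bound assms by (simp add: derivative_bound_def)

lemma stiffness_lipschitz: assumes "\<bar>x\<bar> \<le> B" "\<bar>x + h\<bar> \<le> B" shows "\<bar>\<phi>2 (x + h) - \<phi>2 x\<bar> \<le> K * \<bar>h\<bar>"
  using increment_bound[of \<phi>2 \<phi>3 B K x 0 "x + h"] D2 derivative_bound assms by (simp add: derivative_bound_def)

lemma potential_taylor1:
  assumes "\<bar>x\<bar> \<le> B" "\<bar>x + h\<bar> \<le> B"
  shows "\<bar>\<phi> (x + h) - \<phi> x - \<phi>1 x * h\<bar> \<le> K * h\<^sup>2"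
proof -
  have "\<bar>(\<phi> (x + h) - \<phi>1 x * (x + h)) - (\<phi> x - \<phi>1 x * x)\<bar> \<le> K * \<bar>x + h - x\<bar> ^ Suc 1"
  proof (rule increment_bound[where f="\<lambda>y. \<phi> y - \<phi>1 x * y" and f'="\<lambda>y. \<phi>1 y - \<phi>1 x"])
    show "((\<lambda>y. \<phi> y - \<phi>1 x * y) has_real_derivative \<phi>1 y - \<phi>1 x) (at y)" for y
      by (auto intro!: derivative_eq_intros D0)
    show "\<bar>\<phi>1 y - \<phi>1 x\<bar> \<le> K * \<bar>y - x\<bar> ^ 1" if "\<bar>y\<bar> \<le> B" for y
      using force_lipschitz[of x "y - x"] that assms by simp
  qed (use assms K_pos in auto)
  then show ?thesis by (simp add: algebra_simps power2_eq_square)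
qed

lemma force_taylor1:
  assumes "\<bar>x\<bar> \<le> B" "\<bar>x + h\<bar> \<le> B"
  shows "\<bar>\<phi>1 (x + h) - \<phi>1 x - \<phi>2 x * h\<bar> \<le> K * h\<^sup>2"
proof -
  have "\<bar>(\<phi>1 (x + h) - \<phi>2 x * (x + h)) - (\<phi>1 x - \<phi>2 x * x)\<bar> \<le> K * \<bar>x + h - x\<bar> ^ Suc 1"
  proof (rule increment_bound[where f="\<lambda>y. \<phi>1 y - \<phi>2 x * y" and f'="\<lambda>y. \<phi>2 y - \<phi>2 x"])
    show "((\<lambda>y. \<phi>1 y - \<phi>2 x * y) has_real_derivative \<phi>2 y - \<phi>2 x) (at y)" for y
      by (auto intro!: derivative_eq_intros D1)
    show "\<bar>\<phi>2 y - \<phi>2 x\<bar> \<le> K * \<bar>y - x\<bar> ^ 1" if "\<bar>y\<bar> \<le> B" for y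
      using stiffness_lipschitz[of x "y - x"] that assms by simp
  qed (use assms K_pos in auto)
  then show ?thesis by (simp add: algebra_simps power2_eq_square)
qed

lemma potential_taylor2:
  assumes "\<bar>x\<bar> \<le> B" "\<bar>x + h\<bar> \<le> B"
  shows "\<bar>\<phi> (x + h) - \<phi> x - \<phi>1 x * h - \<phi>2 x * h\<^sup>2 / 2\<bar> \<le> K * \<bar>h\<bar> ^ 3"
proof -
  let ?f = "\<lambda>y. \<phi> y - \<phi>1 x * y - \<phi>2 x * (y - x)\<^sup>2 / 2"
  have "\<bar>?f (x + h) - ?f x\<bar> \<le> K * \<bar>x + h - x\<bar> ^ Suc 2"
  proof (rule increment_bound[where f="?f" and f'="\<lambda>y. \<phi>1 y - \<phi>1 x - \<phi>2 x * (y - x)"])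
    show "(?f has_real_derivative \<phi>1 y - \<phi>1 x - \<phi>2 x * (y - x)) (at y)" for y
      by (auto intro!: derivative_eq_intros D0)
    show "\<bar>\<phi>1 y - \<phi>1 x - \<phi>2 x * (y - x)\<bar> \<le> K * \<bar>y - x\<bar> ^ 2" if "\<bar>y\<bar> \<le> B" for y
      using force_taylor1[of x "y - x"] that assms by simp
  qed (use assms K_pos in auto)
  then show ?thesis by (simp add: algebra_simps numeral_3_eq_3)
qed

text \<open>An even potential has no third-order term, so the force deviates from linearity only at third
  order. This is what makes the nonlinear part of the predictor's stress decay like |m|^(-3/2).\<close>

lemma force_cubic:
  assumes "\<bar>x\<bar> \<le> B" shows "\<bar>\<phi>1 x - x\<bar> \<le> K * \<bar>x\<bar> ^ 3"
proof -
  have B: "\<bar>0\<bar> \<le> B" "\<bar>x\<bar> \<le> B" "0 \<le> K" using assms K_pos by auto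
  have 3: "\<bar>\<phi>3 y\<bar> \<le> K * \<bar>y - 0\<bar> ^ 1" if "\<bar>y\<bar> \<le> B" for y
    using increment_bound[of \<phi>3 \<phi>4 B K 0 0 y] D3 derivative_bound that B third_derivative_zero by (simp add: derivative_bound_def)
  have 2: "\<bar>\<phi>2 y - 1\<bar> \<le> K * \<bar>y - 0\<bar> ^ 2" if "\<bar>y\<bar> \<le> B" for y
    using increment_bound[of \<phi>2 \<phi>3 B K 0 1 y] D2 that B 3 unit by (simp add: numeral_2_eq_2)
  have "((\<lambda>y. \<phi>1 y - y) has_real_derivative \<phi>2 y - 1) (at y)" for y
    by (auto intro!: derivative_eq_intros D1)
  from increment_bound[OF this, of B K 0 2 x] 2 B force_odd[of 0] show ?thesis by (simp add: numeral_3_eq_3)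
qed

end

end

text \<open>Here a is the reference strain and F a reference flux. The energy difference alone need not
  converge for square summable g, because its linear part pairs g with a force that may fail to be
  square summable; subtracting F * g compensates it.\<close>

locale bond_energy = potential +
  fixes a F :: "'i \<Rightarrow> real" and A :: real
  assumes a_le: "\<And>i. \<bar>a i\<bar> \<le> A" and residual: "l2 (\<lambda>i. \<phi>1 (a i) - F i)"
begin

definition en :: "('i \<Rightarrow> real) \<Rightarrow> real" where
  "en g = (\<Sum>\<^sub>\<infinity>i. \<phi> (a i + g i) - \<phi> (a i) - F i * g i)"

definition stress :: "('i \<Rightarrow> real) \<Rightarrow> 'i \<Rightarrow> real" where
  "stress g i = \<phi>1 (a i + g i) - F i"

definition hess :: "('i \<Rightarrow> real) \<Rightarrow> ('i \<Rightarrow> real) \<Rightarrow> real" where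
  "hess g h = (\<Sum>\<^sub>\<infinity>i. \<phi>2 (a i + g i) * (h i)\<^sup>2)"

lemma strain_le: "l2 g \<Longrightarrow> A + l2norm g \<le> B \<Longrightarrow> \<bar>a i + g i\<bar> \<le> B"
  using a_le[of i] l2_pointwise[of g i] by linarith

lemma strain_le1: "l2 g \<Longrightarrow> A + l2norm g + l2norm h \<le> B \<Longrightarrow> \<bar>a i + g i\<bar> \<le> B"
  using strain_le[of g B i] l2norm_nonneg[of h] by linarith

lemma strain_le2: "l2 g \<Longrightarrow> l2 h \<Longrightarrow> A + l2norm g + l2norm h \<le> B \<Longrightarrow> \<bar>a i + g i + h i\<bar> \<le> B"
  using a_le[of i] l2_pointwise[of g i] l2_pointwise[of h i] by linarith

lemma stress_l2: assumes "l2 g" shows "l2 (stress g)"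
proof -
  obtain K where K: "derivative_bound (A + l2norm g) K" using ex_derivative_bound by blast
  have "l2 (\<lambda>i. \<phi>1 (a i + g i) - \<phi>1 (a i))"
  proof (rule l2_bound[OF assms])
    show "\<bar>\<phi>1 (a i + g i) - \<phi>1 (a i)\<bar> \<le> K * \<bar>g i\<bar>" for i
      by (rule force_lipschitz[OF K]) (use a_le[of i] l2norm_nonneg[of g] strain_le[OF assms order_refl, of i] in linarith)+
  qed
  note 1 = l2_add[OF this residual]
  have eq: "stress g = (\<lambda>i. (\<phi>1 (a i + g i) - \<phi>1 (a i)) + (\<phi>1 (a i) - F i))" by (rule ext) (simp add: stress_def)
  show ?thesis unfolding eq by (rule 1)
qed

lemma en_summable: assumes "l2 g" shows "(\<lambda>i. \<phi> (a i + g i) - \<phi> (a i) - F i * g i) summable_on UNIV"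
proof -
  obtain K where K: "derivative_bound (A + l2norm g) K" using ex_derivative_bound by blast
  have 1: "(\<lambda>i. \<phi> (a i + g i) - \<phi> (a i) - \<phi>1 (a i) * g i) summable_on UNIV"
  proof (rule summable_by_bound)
    show "(\<lambda>i. K * (g i)\<^sup>2) summable_on UNIV" using assms by (auto simp: l2_def intro: summable_on_cmult_right)
    show "\<bar>\<phi> (a i + g i) - \<phi> (a i) - \<phi>1 (a i) * g i\<bar> \<le> K * (g i)\<^sup>2" for i
      by (rule potential_taylor1[OF K]) (use a_le[of i] l2norm_nonneg[of g] strain_le[OF assms order_refl, of i] in linarith)+
  qed
  have 2: "(\<lambda>i. (\<phi> (a i + g i) - \<phi> (a i) - \<phi>1 (a i) * g i) + (\<phi>1 (a i) - F i) * g i) summable_on UNIV"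
    using summable_on_add[OF 1 l2_mult_summable[OF residual assms]] .
  have "(\<phi> (a i + g i) - \<phi> (a i) - \<phi>1 (a i) * g i) + (\<phi>1 (a i) - F i) * g i = \<phi> (a i + g i) - \<phi> (a i) - F i * g i" for i
    by (simp add: left_diff_distrib)
  with 2 show ?thesis by simp
qed

lemma hess_summable: assumes "l2 g" "l2 h" shows "(\<lambda>i. \<phi>2 (a i + g i) * (h i)\<^sup>2) summable_on UNIV"
proof -
  obtain K where K: "derivative_bound (A + l2norm g) K" using ex_derivative_bound by blast
  show ?thesis
  proof (rule summable_by_bound)
    show "(\<lambda>i. K * (h i)\<^sup>2) summable_on UNIV" using assms by (auto simp: l2_def intro: summable_on_cmult_right)
    show "\<bar>\<phi>2 (a i + g i) * (h i)\<^sup>2\<bar> \<le> K * (h i)\<^sup>2" for i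
      using stiffness_bound[OF K strain_le[OF assms(1) order_refl, of i]] by (simp add: abs_mult mult_right_mono)
  qed
qed

lemma infsum_sq_le:
  assumes "l2 h" "\<And>i. \<bar>f i\<bar> \<le> C * (h i)\<^sup>2"
  shows "\<bar>\<Sum>\<^sub>\<infinity>i. f i\<bar> \<le> C * (l2norm h)\<^sup>2"
proof -
  have "(\<lambda>i. C * (h i)\<^sup>2) summable_on UNIV" using assms(1) by (auto simp: l2_def intro: summable_on_cmult_right)
  from infsum_abs_le[OF this, of f] assms(2) show ?thesis by (simp add: l2norm_sq infsum_cmult_right')
qed

text \<open>The remainder is bounded bond by bond; a square summable strain is bounded by its norm, so all
  strains that occur stay in one compact interval.\<close>

lemma en_taylor1:
  assumes g: "l2 g" and h: "l2 h" and K: "derivative_bound B K" "A + l2norm g + l2norm h \<le> B"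
  shows "\<bar>en (\<lambda>i. g i + h i) - en g - (\<Sum>\<^sub>\<infinity>i. stress g i * h i)\<bar> \<le> K * (l2norm h)\<^sup>2"
proof -
  have s1: "(\<lambda>i. \<phi> (a i + (g i + h i)) - \<phi> (a i) - F i * (g i + h i)) summable_on UNIV"
    by (rule en_summable[OF l2_add[OF g h]])
  have s2: "(\<lambda>i. \<phi> (a i + g i) - \<phi> (a i) - F i * g i) summable_on UNIV"
    by (rule en_summable[OF g])
  have s3: "(\<lambda>i. stress g i * h i) summable_on UNIV"
    by (rule l2_mult_summable[OF stress_l2[OF g] h])
  have eq: "en (\<lambda>i. g i + h i) - en g - (\<Sum>\<^sub>\<infinity>i. stress g i * h i)
     = (\<Sum>\<^sub>\<infinity>i. (\<phi> (a i + (g i + h i)) - \<phi> (a i) - F i * (g i + h i)) - (\<phi> (a i + g i) - \<phi> (a i) - F i * g i) - stress g i * h i)"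
    by (rule infsum_diff3[OF s1 s2 s3, folded en_def])
  show ?thesis unfolding eq
  proof (rule infsum_sq_le[OF h])
    fix i
    have "\<bar>\<phi> (a i + g i + h i) - \<phi> (a i + g i) - \<phi>1 (a i + g i) * h i\<bar> \<le> K * (h i)\<^sup>2"
      by (rule potential_taylor1[OF K(1) strain_le1[OF g K(2)] strain_le2[OF g h K(2)]])
    moreover have "(\<phi> (a i + (g i + h i)) - \<phi> (a i) - F i * (g i + h i)) - (\<phi> (a i + g i) - \<phi> (a i) - F i * g i) - stress g i * h i
        = \<phi> (a i + g i + h i) - \<phi> (a i + g i) - \<phi>1 (a i + g i) * h i"
      by (simp add: stress_def algebra_simps)
    ultimately show "\<bar>(\<phi> (a i + (g i + h i)) - \<phi> (a i) - F i * (g i + h i)) - (\<phi> (a i + g i) - \<phi> (a i) - F i * g i) - stress g i * h i\<bar> \<le> K * (h i)\<^sup>2"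
      by (simp only:)
  qed
qed

text \<open>The cubic remainder costs one factor of the supremum of h, which is at most its l2 norm.\<close>

lemma en_taylor2:
  assumes g: "l2 g" and h: "l2 h" and K: "derivative_bound B K" "A + l2norm g + l2norm h \<le> B"
  shows "\<bar>en (\<lambda>i. g i + h i) - en g - (\<Sum>\<^sub>\<infinity>i. stress g i * h i) - hess g h / 2\<bar> \<le> K * l2norm h * (l2norm h)\<^sup>2"
proof -
  have s1: "(\<lambda>i. \<phi> (a i + (g i + h i)) - \<phi> (a i) - F i * (g i + h i)) summable_on UNIV"
    by (rule en_summable[OF l2_add[OF g h]])
  have s2: "(\<lambda>i. \<phi> (a i + g i) - \<phi> (a i) - F i * g i) summable_on UNIV"
    by (rule en_summable[OF g])
  have s3: "(\<lambda>i. stress g i * h i) summable_on UNIV"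
    by (rule l2_mult_summable[OF stress_l2[OF g] h])
  have s4: "(\<lambda>i. 1/2 * (\<phi>2 (a i + g i) * (h i)\<^sup>2)) summable_on UNIV"
    by (rule summable_on_cmult_right[OF hess_summable[OF g h]])
  have half: "hess g h / 2 = (\<Sum>\<^sub>\<infinity>i. 1/2 * (\<phi>2 (a i + g i) * (h i)\<^sup>2))"
    unfolding hess_def infsum_cmult_right' by simp
  have eq: "en (\<lambda>i. g i + h i) - en g - (\<Sum>\<^sub>\<infinity>i. stress g i * h i) - hess g h / 2
     = (\<Sum>\<^sub>\<infinity>i. (\<phi> (a i + (g i + h i)) - \<phi> (a i) - F i * (g i + h i)) - (\<phi> (a i + g i) - \<phi> (a i) - F i * g i) - stress g i * h i
        - 1/2 * (\<phi>2 (a i + g i) * (h i)\<^sup>2))"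
    unfolding half by (rule infsum_diff4[OF s1 s2 s3 s4, folded en_def])
  show ?thesis unfolding eq
  proof (rule infsum_sq_le[OF h])
    fix i
    have "\<bar>\<phi> (a i + g i + h i) - \<phi> (a i + g i) - \<phi>1 (a i + g i) * h i - \<phi>2 (a i + g i) * (h i)\<^sup>2 / 2\<bar> \<le> K * \<bar>h i\<bar> ^ 3"
      by (rule potential_taylor2[OF K(1) strain_le1[OF g K(2)] strain_le2[OF g h K(2)]])
    also have "\<dots> = K * \<bar>h i\<bar> * (h i)\<^sup>2"
      using power2_abs[of "h i"] by (simp add: numeral_3_eq_3 numeral_2_eq_2)
    also have "\<dots> \<le> K * l2norm h * (h i)\<^sup>2"
      using l2_pointwise[OF h, of i] K_pos[OF K(1)] by (intro mult_right_mono mult_left_mono) auto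
    finally have "\<bar>\<phi> (a i + g i + h i) - \<phi> (a i + g i) - \<phi>1 (a i + g i) * h i - \<phi>2 (a i + g i) * (h i)\<^sup>2 / 2\<bar> \<le> K * l2norm h * (h i)\<^sup>2" .
    moreover have "(\<phi> (a i + (g i + h i)) - \<phi> (a i) - F i * (g i + h i)) - (\<phi> (a i + g i) - \<phi> (a i) - F i * g i) - stress g i * h i - 1/2 * (\<phi>2 (a i + g i) * (h i)\<^sup>2)
        = \<phi> (a i + g i + h i) - \<phi> (a i + g i) - \<phi>1 (a i + g i) * h i - \<phi>2 (a i + g i) * (h i)\<^sup>2 / 2"
      by (simp add: stress_def algebra_simps)
    ultimately show "\<bar>(\<phi> (a i + (g i + h i)) - \<phi> (a i) - F i * (g i + h i)) - (\<phi> (a i + g i) - \<phi> (a i) - F i * g i) - stress g i * h i - 1/2 * (\<phi>2 (a i + g i) * (h i)\<^sup>2)\<bar> \<le> K * l2norm h * (h i)\<^sup>2"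
      by (simp only:)
  qed
qed

lemma stress_taylor:
  assumes g: "l2 g" and k: "l2 k" and h: "l2 h" and K: "derivative_bound B K" "A + l2norm g + l2norm k \<le> B"
  shows "\<bar>(\<Sum>\<^sub>\<infinity>i. stress (\<lambda>i. g i + k i) i * h i) - (\<Sum>\<^sub>\<infinity>i. stress g i * h i) - (\<Sum>\<^sub>\<infinity>i. \<phi>2 (a i + g i) * k i * h i)\<bar>
     \<le> K * l2norm h * (l2norm k)\<^sup>2"
proof -
  have 2: "l2 (\<lambda>i. \<phi>2 (a i + g i) * k i)"
  proof (rule l2_bound[OF k])
    show "\<bar>\<phi>2 (a i + g i) * k i\<bar> \<le> K * \<bar>k i\<bar>" for i
      using stiffness_bound[OF K(1) strain_le1[OF g K(2), of i]] by (simp add: abs_mult mult_right_mono)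
  qed
  have s1: "(\<lambda>i. stress (\<lambda>i. g i + k i) i * h i) summable_on UNIV"
    by (rule l2_mult_summable[OF stress_l2[OF l2_add[OF g k]] h])
  have s2: "(\<lambda>i. stress g i * h i) summable_on UNIV"
    by (rule l2_mult_summable[OF stress_l2[OF g] h])
  have s3: "(\<lambda>i. \<phi>2 (a i + g i) * k i * h i) summable_on UNIV"
    by (rule l2_mult_summable[OF 2 h])
  have eq: "(\<Sum>\<^sub>\<infinity>i. stress (\<lambda>i. g i + k i) i * h i) - (\<Sum>\<^sub>\<infinity>i. stress g i * h i) - (\<Sum>\<^sub>\<infinity>i. \<phi>2 (a i + g i) * k i * h i)
     = (\<Sum>\<^sub>\<infinity>i. stress (\<lambda>i. g i + k i) i * h i - stress g i * h i - \<phi>2 (a i + g i) * k i * h i)"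
    by (rule infsum_diff3[OF s1 s2 s3])
  show ?thesis unfolding eq
  proof (rule infsum_sq_le[OF k])
    fix i
    have 1: "\<bar>\<phi>1 (a i + g i + k i) - \<phi>1 (a i + g i) - \<phi>2 (a i + g i) * k i\<bar> \<le> K * (k i)\<^sup>2"
      by (rule force_taylor1[OF K(1) strain_le1[OF g K(2)] strain_le2[OF g k K(2)]])
    have eq: "stress (\<lambda>i. g i + k i) i * h i - stress g i * h i - \<phi>2 (a i + g i) * k i * h i
       = (\<phi>1 (a i + g i + k i) - \<phi>1 (a i + g i) - \<phi>2 (a i + g i) * k i) * h i"
      by (simp add: stress_def algebra_simps)
    have "\<bar>(\<phi>1 (a i + g i + k i) - \<phi>1 (a i + g i) - \<phi>2 (a i + g i) * k i) * h i\<bar> \<le> K * (k i)\<^sup>2 * l2norm h"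
      unfolding abs_mult by (rule mult_mono[OF 1 l2_pointwise[OF h]]) (use K_pos[OF K(1)] in auto)
    then show "\<bar>stress (\<lambda>i. g i + k i) i * h i - stress g i * h i - \<phi>2 (a i + g i) * k i * h i\<bar> \<le> K * l2norm h * (k i)\<^sup>2"
      unfolding eq by (simp only: mult.commute mult.left_commute)
  qed
qed

lemma hess_lipschitz:
  assumes g: "l2 g" and k: "l2 k" and h: "l2 h" and K: "derivative_bound B K" "A + l2norm g + l2norm k \<le> B"
  shows "\<bar>hess (\<lambda>i. g i + k i) h - hess g h\<bar> \<le> K * l2norm k * (l2norm h)\<^sup>2"
proof -
  have eq: "hess (\<lambda>i. g i + k i) h - hess g h = (\<Sum>\<^sub>\<infinity>i. \<phi>2 (a i + (g i + k i)) * (h i)\<^sup>2 - \<phi>2 (a i + g i) * (h i)\<^sup>2)"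
    unfolding hess_def using hess_summable[OF l2_add[OF g k] h] hess_summable[OF g h] by (subst infsum_diff_real) auto
  show ?thesis unfolding eq
  proof (rule infsum_sq_le[OF h])
    fix i
    have 1: "\<bar>\<phi>2 (a i + g i + k i) - \<phi>2 (a i + g i)\<bar> \<le> K * \<bar>k i\<bar>"
      by (rule stiffness_lipschitz[OF K(1) strain_le1[OF g K(2)] strain_le2[OF g k K(2)]])
    also have "\<dots> \<le> K * l2norm k" using l2_pointwise[OF k, of i] K_pos[OF K(1)] by (intro mult_left_mono) auto
    finally have "\<bar>\<phi>2 (a i + g i + k i) - \<phi>2 (a i + g i)\<bar> * (h i)\<^sup>2 \<le> K * l2norm k * (h i)\<^sup>2" by (rule mult_right_mono) simp
    then show "\<bar>\<phi>2 (a i + (g i + k i)) * (h i)\<^sup>2 - \<phi>2 (a i + g i) * (h i)\<^sup>2\<bar> \<le> K * l2norm k * (h i)\<^sup>2"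
      by (simp add: left_diff_distrib[symmetric] abs_mult add.assoc)
  qed
qed

lemma en_deriv:
  assumes g: "l2 g" and h: "l2 h"
  shows "((\<lambda>t. en (\<lambda>i. g i + t * h i)) has_real_derivative (\<Sum>\<^sub>\<infinity>i. stress (\<lambda>i. g i + t * h i) i * h i)) (at t)"
proof -
  let ?g = "\<lambda>i. g i + t * h i"
  have g': "l2 ?g" using g h by auto
  obtain K where K: "derivative_bound (A + l2norm ?g + l2norm h) K" using ex_derivative_bound by blast
  show ?thesis
  proof (rule has_derivative_of_quadratic_bound)
    fix s :: real assume "\<bar>s\<bar> \<le> 1"
    then have "l2norm (\<lambda>i. s * h i) \<le> l2norm h" by (simp add: l2norm_cmult mult_left_le_one_le)
    from en_taylor1[OF g' l2_cmult[OF h, of s] K] this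
    have "\<bar>en (\<lambda>i. ?g i + s * h i) - en ?g - (\<Sum>\<^sub>\<infinity>i. stress ?g i * (s * h i))\<bar> \<le> K * (l2norm (\<lambda>i. s * h i))\<^sup>2" by simp
    moreover have "(\<Sum>\<^sub>\<infinity>i. stress ?g i * (s * h i)) = (\<Sum>\<^sub>\<infinity>i. stress ?g i * h i) * s"
      by (subst infsum_cmult_left'[symmetric]) (simp add: algebra_simps)
    ultimately show "\<bar>en (\<lambda>i. g i + (t + s) * h i) - en ?g - (\<Sum>\<^sub>\<infinity>i. stress ?g i * h i) * s\<bar> \<le> K * (l2norm h)\<^sup>2 * s\<^sup>2"
      by (simp add: l2norm_cmult power_mult_distrib algebra_simps)
  qed
qed

lemma stress_deriv:
  assumes g: "l2 g" and h: "l2 h"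
  shows "((\<lambda>t. \<Sum>\<^sub>\<infinity>i. stress (\<lambda>i. g i + t * h i) i * h i) has_real_derivative hess g h) (at 0)"
proof -
  obtain K where K: "derivative_bound (A + l2norm g + l2norm h) K" using ex_derivative_bound by blast
  show ?thesis
  proof (rule has_derivative_of_quadratic_bound)
    fix s :: real assume "\<bar>s\<bar> \<le> 1"
    then have "l2norm (\<lambda>i. s * h i) \<le> l2norm h" by (simp add: l2norm_cmult mult_left_le_one_le)
    from stress_taylor[OF g l2_cmult[OF h, of s] h K] this
    have "\<bar>(\<Sum>\<^sub>\<infinity>i. stress (\<lambda>i. g i + s * h i) i * h i) - (\<Sum>\<^sub>\<infinity>i. stress g i * h i) - (\<Sum>\<^sub>\<infinity>i. \<phi>2 (a i + g i) * (s * h i) * h i)\<bar>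
       \<le> K * l2norm h * (l2norm (\<lambda>i. s * h i))\<^sup>2" by simp
    moreover have "(\<Sum>\<^sub>\<infinity>i. \<phi>2 (a i + g i) * (s * h i) * h i) = hess g h * s"
      unfolding hess_def by (subst infsum_cmult_left'[symmetric]) (simp add: algebra_simps power2_eq_square)
    ultimately show "\<bar>(\<Sum>\<^sub>\<infinity>i. stress (\<lambda>i. g i + (0 + s) * h i) i * h i) - (\<Sum>\<^sub>\<infinity>i. stress (\<lambda>i. g i + 0 * h i) i * h i) - hess g h * s\<bar>
       \<le> (K * l2norm h * (l2norm h)\<^sup>2) * s\<^sup>2"
      by (simp add: l2norm_cmult power_mult_distrib algebra_simps)
  qed
qed

lemma en_second_deriv:
  assumes g: "l2 g" and h: "l2 h"
  shows "(deriv ^^ 2) (\<lambda>t. c * en (\<lambda>i. g i + t * h i)) 0 = c * hess g h"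
proof -
  have "deriv (\<lambda>t. c * en (\<lambda>i. g i + t * h i)) = (\<lambda>t. c * (\<Sum>\<^sub>\<infinity>i. stress (\<lambda>i. g i + t * h i) i * h i))"
    using DERIV_cmult[OF en_deriv[OF g h]] by (intro ext DERIV_imp_deriv) auto
  moreover have "deriv (\<lambda>t. c * (\<Sum>\<^sub>\<infinity>i. stress (\<lambda>i. g i + t * h i) i * h i)) 0 = c * hess g h"
    by (rule DERIV_imp_deriv[OF DERIV_cmult[OF stress_deriv[OF g h]]])
  ultimately show ?thesis by (simp add: numeral_2_eq_2)
qed

end

section \<open>The angular supersolution\<close>

lemma sin_cubic: "\<bar>sin t - t\<bar> \<le> \<bar>t\<bar> ^ 3" for t :: real
proof -
  have 1: "\<bar>cos y - 1\<bar> \<le> 1 * \<bar>y - 0\<bar> ^ 2" for y :: real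
  proof -
    have "\<bar>sin (y/2)\<bar>\<^sup>2 \<le> \<bar>y/2\<bar>\<^sup>2" by (rule power_mono[OF abs_sin_x_le_abs_x]) simp
    then have "4 * (sin (y/2))\<^sup>2 \<le> y\<^sup>2" by (simp add: power_divide)
    moreover have "1 - cos y = 2 * (sin (y/2))\<^sup>2" using cos_double_sin[of "y/2"] by simp
    moreover have "0 \<le> 2 * (sin (y/2))\<^sup>2" by simp
    ultimately have "\<bar>cos y - 1\<bar> \<le> y\<^sup>2" by linarith
    then show ?thesis by simp
  qed
  have d: "((\<lambda>t. sin t - t) has_real_derivative cos y - 1) (at y)" for y :: real
    by (auto intro!: derivative_eq_intros)
  from increment_bound[OF d, of "\<bar>t\<bar>" 1 0 2 t] 1 show ?thesis by (simp add: numeral_3_eq_3)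
qed

lemma cos_quartic: "\<bar>cos t - 1 + t\<^sup>2 / 2\<bar> \<le> t ^ 4" for t :: real
proof -
  have d: "((\<lambda>t. cos t - 1 + t\<^sup>2 / 2) has_real_derivative y - sin y) (at y)" for y :: real
    by (auto intro!: derivative_eq_intros)
  have 1: "\<bar>y - sin y\<bar> \<le> 1 * \<bar>y - 0\<bar> ^ 3" for y :: real
    using sin_cubic[of y] by (simp add: abs_minus_commute)
  from increment_bound[OF d, of "\<bar>t\<bar>" 1 0 3 t] 1 have "\<bar>cos t - 1 + t\<^sup>2 / 2\<bar> \<le> \<bar>t\<bar> ^ 4"
    by (simp add: eval_nat_numeral)
  then show ?thesis by (simp add: power_even_abs)
qed

lemma Ln_first_order:
  fixes x :: complex assumes "norm x < 1/2" shows "norm (Ln (1 + x) - x) \<le> 2 * (norm x)\<^sup>2"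
proof -
  have "norm (Ln (1 + x) - x) \<le> (norm x)\<^sup>2 / (1 - norm x)" using Ln_approx_linear[of x] assms by simp
  also have "\<dots> \<le> (norm x)\<^sup>2 / (1/2)" using assms by (intro divide_left_mono) auto
  finally show ?thesis by simp
qed

lemma sq_perturb:
  fixes u v e X :: real
  assumes "\<bar>v - u\<bar> \<le> 2 * X\<^sup>2" "\<bar>u\<bar> \<le> X" "X \<le> 1/2"
  shows "u\<^sup>2 - 4 * X ^ 3 \<le> v\<^sup>2" "v\<^sup>2 \<le> u\<^sup>2 + 6 * X ^ 3"
proof -
  have X: "0 \<le> X" using assms by linarith
  have a: "v\<^sup>2 = u\<^sup>2 + 2 * u * (v - u) + (v - u)\<^sup>2" by (simp add: power2_eq_square algebra_simps)
  have "\<bar>u * (v - u)\<bar> \<le> X * (2 * X\<^sup>2)" unfolding abs_mult by (rule mult_mono) (use assms X in auto)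
  then have b: "\<bar>u * (v - u)\<bar> \<le> 2 * X ^ 3" by (simp add: power2_eq_square power3_eq_cube)
  have "(v - u)\<^sup>2 \<le> (2 * X\<^sup>2)\<^sup>2" using assms by (metis abs_ge_zero power2_abs power_mono)
  also have "\<dots> = (4 * X) * X ^ 3" by (simp add: power2_eq_square power3_eq_cube)
  also have "\<dots> \<le> 2 * X ^ 3" using assms X by (intro mult_right_mono) auto
  finally have c: "(v - u)\<^sup>2 \<le> 2 * X ^ 3" .
  show "u\<^sup>2 - 4 * X ^ 3 \<le> v\<^sup>2" "v\<^sup>2 \<le> u\<^sup>2 + 6 * X ^ 3"
    using a b c zero_le_power2[of "v - u"] by (linarith, linarith)
qed

text \<open>Pairing opposite directions gives the logarithms of 1 - x^2 and 1 + x^2, whose first-order terms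
  cancel: discrete harmonicity of the logarithm up to fourth order.\<close>

lemma sum_logs:
  fixes x :: complex assumes x: "norm x < 1/2"
  shows "norm (Ln (1 + x) + Ln (1 + \<i> * x) + Ln (1 - x) + Ln (1 - \<i> * x)) \<le> 4 * norm x ^ 4"
proof -
  have pair: "Ln (1 + y) + Ln (1 - y) = Ln (1 - y\<^sup>2)" if y: "norm y < 1/2" for y :: complex
  proof -
    have re: "Re (1 + y) > 0" "Re (1 - y) > 0" using y abs_Re_le_cmod[of y] by auto
    have "\<bar>Im (Ln (1 + y))\<bar> < pi/2" "\<bar>Im (Ln (1 - y))\<bar> < pi/2"
      using re by (blast intro: Re_Ln_pos_lt_imp)+
    moreover have "1 + y \<noteq> 0" "1 - y \<noteq> 0" using re by (metis less_irrefl zero_complex.simps(1))+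
    ultimately have "Ln ((1 + y) * (1 - y)) = Ln (1 + y) + Ln (1 - y)"
      by (intro Ln_times_simple) (auto simp: abs_less_iff)
    then show ?thesis by (simp add: algebra_simps power2_eq_square)
  qed
  have p1: "Ln (1 + x) + Ln (1 - x) = Ln (1 + - x\<^sup>2)" using pair[OF x] by simp
  have p2: "Ln (1 + \<i> * x) + Ln (1 - \<i> * x) = Ln (1 + x\<^sup>2)"
    using pair[of "\<i> * x"] x by (simp add: norm_mult power_mult_distrib)
  have "(norm x)\<^sup>2 \<le> (1/2)\<^sup>2" using x by (intro power_mono) auto
  then have n: "norm (x\<^sup>2) < 1/2" unfolding norm_power by (simp add: power_divide)
  have e1: "norm (Ln (1 + - x\<^sup>2) - (- x\<^sup>2)) \<le> 2 * (norm (- x\<^sup>2))\<^sup>2" by (rule Ln_first_order) (use n in simp)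
  have e2: "norm (Ln (1 + x\<^sup>2) - x\<^sup>2) \<le> 2 * (norm (x\<^sup>2))\<^sup>2" by (rule Ln_first_order) (use n in simp)
  have "Ln (1 + x) + Ln (1 + \<i> * x) + Ln (1 - x) + Ln (1 - \<i> * x)
     = (Ln (1 + - x\<^sup>2) - (- x\<^sup>2)) + (Ln (1 + x\<^sup>2) - x\<^sup>2)"
    using p1 p2 by (simp add: algebra_simps)
  then have "norm (Ln (1 + x) + Ln (1 + \<i> * x) + Ln (1 - x) + Ln (1 - \<i> * x))
    \<le> norm (Ln (1 + - x\<^sup>2) - (- x\<^sup>2)) + norm (Ln (1 + x\<^sup>2) - x\<^sup>2)" by (simp only: norm_triangle_ineq)
  also have "\<dots> \<le> 2 * (norm (- x\<^sup>2))\<^sup>2 + 2 * (norm (x\<^sup>2))\<^sup>2" using e1 e2 by linarith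
  also have "\<dots> = 4 * norm x ^ 4" by (simp add: norm_power)
  finally show ?thesis .
qed

lemma log_parts:
  fixes x :: complex assumes x: "norm x < 1/2"
  shows "(Im x)\<^sup>2 - 4 * norm x ^ 3 \<le> (Im (Ln (1 + x)))\<^sup>2" "(Re (Ln (1 + x)))\<^sup>2 \<le> (Re x)\<^sup>2 + 6 * norm x ^ 3"
proof -
  have "\<bar>Im (Ln (1 + x)) - Im x\<bar> \<le> 2 * (norm x)\<^sup>2" "\<bar>Re (Ln (1 + x)) - Re x\<bar> \<le> 2 * (norm x)\<^sup>2"
    using Ln_first_order[OF x] abs_Im_le_cmod[of "Ln (1 + x) - x"] abs_Re_le_cmod[of "Ln (1 + x) - x"] by auto
  then show "(Im x)\<^sup>2 - 4 * norm x ^ 3 \<le> (Im (Ln (1 + x)))\<^sup>2" "(Re (Ln (1 + x)))\<^sup>2 \<le> (Re x)\<^sup>2 + 6 * norm x ^ 3"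
    using sq_perturb[of _ _ "norm x"] abs_Im_le_cmod[of x] abs_Re_le_cmod[of x] x by auto
qed

text \<open>The squares of the real parts of x, i x, -x, -i x add up to 2 |x|^2, and so do those of the
  imaginary parts; the logarithm perturbs them at third order.\<close>

lemma sum_log_squares:
  fixes x :: complex assumes x: "norm x < 1/2"
  shows "2 * (norm x)\<^sup>2 - 16 * norm x ^ 3
      \<le> (Im (Ln (1 + x)))\<^sup>2 + (Im (Ln (1 + \<i> * x)))\<^sup>2 + (Im (Ln (1 - x)))\<^sup>2 + (Im (Ln (1 - \<i> * x)))\<^sup>2"
    and "(Re (Ln (1 + x)))\<^sup>2 + (Re (Ln (1 + \<i> * x)))\<^sup>2 + (Re (Ln (1 - x)))\<^sup>2 + (Re (Ln (1 - \<i> * x)))\<^sup>2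
      \<le> 2 * (norm x)\<^sup>2 + 24 * norm x ^ 3"
  using log_parts[of x] log_parts[of "\<i> * x"] log_parts[of "- x"] log_parts[of "- (\<i> * x)"] x
  by (simp_all add: norm_mult cmod_power2)

lemma cos_Arg_cnj: "cos (k * Arg (cnj z)) = cos (k * Arg z)"
  by (simp add: Arg_cnj)

text \<open>The side condition keeps the step from a to a + \<rho> away from the branch cut of the argument.\<close>

lemma Arg_shift:
  assumes a: "2 < norm a" and \<rho>: "norm \<rho> = 1"
    and side: "(0 < Im a \<and> 0 \<le> Im (a + \<rho>)) \<or> (Im a = 0 \<and> 0 < Re a)"
  shows "Arg (a + \<rho>) = Arg a + Im (Ln (1 + \<rho> / a))"
proof -
  let ?w = "1 + \<rho> / a"
  have a0: "a \<noteq> 0" using a by auto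
  have "norm (\<rho> / a) < 1" using a \<rho> by (simp add: norm_divide divide_less_eq)
  then have re: "0 < Re ?w" using abs_Re_le_cmod[of "\<rho>/a"] by auto
  then have w0: "?w \<noteq> 0" by (metis less_irrefl zero_complex.simps(1))
  have im: "\<bar>Im (Ln ?w)\<bar> < pi/2" by (rule Re_Ln_pos_lt_imp[OF re])
  have eq: "a + \<rho> = a * ?w" using a0 by (simp add: field_simps)
  have aw: "a * ?w \<noteq> 0" using a0 w0 by simp
  show ?thesis
  proof (cases "Im a = 0 \<and> 0 < Re a")
    case True
    then have "Arg a = 0" by (simp add: Arg_eq_0 complex_is_Real_iff)
    then have "Ln (a * ?w) = Ln a + Ln ?w"
      using im a0 w0 by (intro Ln_times_simple) (auto simp: Arg_eq_Im_Ln)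
    then show ?thesis unfolding eq using Arg_eq_Im_Ln[OF a0] Arg_eq_Im_Ln[OF aw] by simp
  next
    case False
    then have s: "0 < Im a" "0 \<le> Im (a * ?w)" using side eq by auto
    then have A: "0 < Im (Ln a)" "Im (Ln a) < pi" using Arg_lt_pi[of a] Arg_eq_Im_Ln[OF a0] by auto
    have B: "0 \<le> Im (Ln (a * ?w))" using Arg_less_0[of "a * ?w"] Arg_eq_Im_Ln[OF aw] s by simp
    have "Ln (a * ?w) = Ln a + Ln ?w"
    proof (rule Ln_times_simple[OF a0 w0])
      show "- pi < Im (Ln a) + Im (Ln ?w)" using A im by linarith
      show "Im (Ln a) + Im (Ln ?w) \<le> pi"
      proof (rule ccontr)
        assume c: "\<not> ?thesis"
        then have "Ln (a * ?w) = (Ln a + Ln ?w) - \<i> * of_real (2*pi)"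
          using Ln_times[OF a0 w0] pi_gt_zero by simp
        then have "Im (Ln (a * ?w)) = Im (Ln a) + Im (Ln ?w) - 2 * pi" by simp
        then show False using A im B pi_gt_zero by linarith
      qed
    qed
    then show ?thesis unfolding eq using Arg_eq_Im_Ln[OF a0] Arg_eq_Im_Ln[OF aw] by simp
  qed
qed

text \<open>The four increments of the angle around a add up to O(|a|^(-3)) and their squares to 2/|a|^2 +
  O(|a|^(-3)). Expanding the cosine to second order therefore reproduces the Laplacian -k^2/|a|^2
  cos(k \<theta>) of the continuous function.\<close>

lemma angular_supersolution_upper:
  assumes k: "0 < k" "k < 1/2" and a: "2 < norm a"
    and side: "1 \<le> Im a \<or> (Im a = 0 \<and> 0 < Re a)"
  shows "cos (k * Arg (a + 1)) + cos (k * Arg (a + \<i>)) + cos (k * Arg (a - 1)) + cos (k * Arg (a - \<i>))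
       \<le> (4 - k\<^sup>2 / (norm a)\<^sup>2) * cos (k * Arg a) + 20 / norm a ^ 3"
proof -
  define x where "x = 1 / a"
  define X where "X = norm x"
  have X: "X = 1 / norm a" by (simp add: X_def x_def norm_divide)
  have x2: "norm x < 1/2" using a X by (simp add: X_def[symmetric] divide_less_eq)
  have X0: "0 \<le> X" "X \<le> 1/2" using x2 by (auto simp: X_def)
  define D where "D \<rho> = Im (Ln (1 + \<rho> / a))" for \<rho>
  define \<theta> where "\<theta> = Arg a"
  have ar: "Arg (a + \<rho>) = \<theta> + D \<rho>" if "\<rho> \<in> {1, \<i>, -1, -\<i>}" for \<rho>
    unfolding \<theta>_def D_def by (rule Arg_shift[OF a]) (use that side in auto)
  have eqD: "D 1 = Im (Ln (1 + x))" "D \<i> = Im (Ln (1 + \<i> * x))" "D (-1) = Im (Ln (1 - x))" "D (-\<i>) = Im (Ln (1 - \<i> * x))"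
    by (simp_all add: D_def x_def)
  have Dle: "\<bar>D \<rho>\<bar> \<le> 2 * X" if "\<rho> \<in> {1, \<i>, -1, -\<i>}" for \<rho>
  proof -
    have n: "norm (\<rho> / a) = X" using that by (auto simp: X norm_divide)
    have "norm (Ln (1 + \<rho> / a)) \<le> 2 * norm (\<rho> / a)" by (rule norm_Ln_le) (use n x2 X_def in simp)
    then show ?thesis using abs_Im_le_cmod[of "Ln (1 + \<rho> / a)"] n by (simp add: D_def)
  qed
  have kD: "\<bar>k * D \<rho>\<bar> \<le> X" if "\<rho> \<in> {1, \<i>, -1, -\<i>}" for \<rho>
  proof -
    have "\<bar>k * D \<rho>\<bar> \<le> (1/2) * (2 * X)" unfolding abs_mult by (rule mult_mono) (use Dle[OF that] k in auto)
    then show ?thesis by simp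
  qed
  have X43: "X ^ 4 \<le> X ^ 3" using X0 by (intro power_decreasing) auto
  have c: "cos (k * D \<rho>) \<le> 1 - k\<^sup>2 / 2 * (D \<rho>)\<^sup>2 + X ^ 3" if "\<rho> \<in> {1, \<i>, -1, -\<i>}" for \<rho>
  proof -
    have "(k * D \<rho>) ^ 4 = \<bar>k * D \<rho>\<bar> ^ 4" by (simp add: power_even_abs)
    also have "\<dots> \<le> X ^ 4" by (rule power_mono[OF kD[OF that]]) simp
    finally show ?thesis using cos_quartic[of "k * D \<rho>"] X43 by (simp add: power_mult_distrib abs_le_iff)
  qed
  have s: "\<bar>sin (k * D \<rho>) - k * D \<rho>\<bar> \<le> X ^ 3" if "\<rho> \<in> {1, \<i>, -1, -\<i>}" for \<rho>
    using sin_cubic[of "k * D \<rho>"] power_mono[OF kD[OF that], of 3] by simp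
  \<comment> \<open>The first-order terms cancel here: opposite directions compensate each other.\<close>
  have SD: "\<bar>D 1 + D \<i> + D (-1) + D (-\<i>)\<bar> \<le> 4 * X ^ 3"
  proof -
    have "D 1 + D \<i> + D (-1) + D (-\<i>) = Im (Ln (1 + x) + Ln (1 + \<i> * x) + Ln (1 - x) + Ln (1 - \<i> * x))"
      by (simp add: eqD)
    then show ?thesis
      using abs_Im_le_cmod[of "Ln (1 + x) + Ln (1 + \<i> * x) + Ln (1 - x) + Ln (1 - \<i> * x)"] sum_logs[OF x2] X43
      unfolding X_def by linarith
  qed
  define S where "S = sin (k * D 1) + sin (k * D \<i>) + sin (k * D (-1)) + sin (k * D (-\<i>))"
  define C where "C = cos (k * D 1) + cos (k * D \<i>) + cos (k * D (-1)) + cos (k * D (-\<i>))"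
  have "\<bar>k * (D 1 + D \<i> + D (-1) + D (-\<i>))\<bar> \<le> (1/2) * (4 * X ^ 3)"
    unfolding abs_mult by (rule mult_mono) (use SD k in auto)
  then have S: "\<bar>S\<bar> \<le> 6 * X ^ 3"
    using s[of 1] s[of "\<i>"] s[of "-1"] s[of "-\<i>"] unfolding S_def distrib_left by (simp; linarith)
  have kk: "k\<^sup>2 * X ^ 3 \<le> 1/4 * X ^ 3"
    using k power_mono[of k "1/2" 2] X0 by (intro mult_right_mono) (auto simp: power2_eq_square)
  have e: "k\<^sup>2 / 2 * (2 * X\<^sup>2 - 16 * X ^ 3) = k\<^sup>2 * X\<^sup>2 - 8 * (k\<^sup>2 * X ^ 3)" by (simp add: right_diff_distrib)
  have "k\<^sup>2 / 2 * (2 * X\<^sup>2 - 16 * X ^ 3) \<le> k\<^sup>2 / 2 * ((D 1)\<^sup>2 + (D \<i>)\<^sup>2 + (D (-1))\<^sup>2 + (D (-\<i>))\<^sup>2)"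
    using sum_log_squares(1)[OF x2] unfolding eqD X_def by (intro mult_left_mono) auto
  moreover have "C \<le> 4 - k\<^sup>2 / 2 * ((D 1)\<^sup>2 + (D \<i>)\<^sup>2 + (D (-1))\<^sup>2 + (D (-\<i>))\<^sup>2) + 4 * X ^ 3"
    using c[of 1] c[of "\<i>"] c[of "-1"] c[of "-\<i>"] unfolding C_def distrib_left by (simp; linarith)
  ultimately have C: "C \<le> 4 - k\<^sup>2 * X\<^sup>2 + 6 * X ^ 3"
    using kk unfolding e by linarith
  have th: "\<bar>k * \<theta>\<bar> \<le> pi/2"
  proof -
    have "\<bar>\<theta>\<bar> \<le> pi" using mpi_less_Arg[of a] Arg_le_pi[of a] by (auto simp: \<theta>_def)
    then have "\<bar>k * \<theta>\<bar> \<le> (1/2) * pi" unfolding abs_mult by (rule mult_mono[rotated]) (use k in auto)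
    then show ?thesis by simp
  qed
  have c0: "0 \<le> cos (k * \<theta>)" using th by (intro cos_ge_zero) auto
  have e2: "cos (k * \<theta>) * (4 - k\<^sup>2 * X\<^sup>2 + 6 * X ^ 3) = (4 - k\<^sup>2 * X\<^sup>2) * cos (k * \<theta>) + cos (k * \<theta>) * (6 * X ^ 3)"
    by (simp add: algebra_simps)
  have A: "Arg (a + 1) = \<theta> + D 1" "Arg (a + \<i>) = \<theta> + D \<i>" "Arg (a - 1) = \<theta> + D (-1)" "Arg (a - \<i>) = \<theta> + D (-\<i>)"
    using ar[of 1] ar[of "\<i>"] ar[of "-1"] ar[of "-\<i>"] by simp_all
  have "cos (k * Arg (a + 1)) + cos (k * Arg (a + \<i>)) + cos (k * Arg (a - 1)) + cos (k * Arg (a - \<i>))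
      = cos (k * \<theta>) * C - sin (k * \<theta>) * S"
    unfolding A C_def S_def distrib_left cos_add right_diff_distrib by (simp only: add_diff_eq diff_add_eq)
  moreover have "cos (k * \<theta>) * C \<le> (4 - k\<^sup>2 * X\<^sup>2) * cos (k * \<theta>) + cos (k * \<theta>) * (6 * X ^ 3)" unfolding e2[symmetric] by (rule mult_left_mono[OF C c0])
  moreover have "cos (k * \<theta>) * (6 * X ^ 3) \<le> 1 * (6 * X ^ 3)" using X0 by (intro mult_right_mono) auto
  moreover have "- (sin (k * \<theta>) * S) \<le> 6 * X ^ 3"
  proof -
    have "\<bar>sin (k * \<theta>) * S\<bar> \<le> 1 * (6 * X ^ 3)" unfolding abs_mult by (rule mult_mono) (use S in auto)
    then show ?thesis by linarith
  qed
  moreover have "0 \<le> X ^ 3" using X0 by simp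
  ultimately have "cos (k * Arg (a + 1)) + cos (k * Arg (a + \<i>)) + cos (k * Arg (a - 1)) + cos (k * Arg (a - \<i>))
     \<le> (4 - k\<^sup>2 * X\<^sup>2) * cos (k * \<theta>) + 20 * X ^ 3"
    by linarith
  moreover have "k\<^sup>2 / (norm a)\<^sup>2 = k\<^sup>2 * X\<^sup>2" "20 / norm a ^ 3 = 20 * X ^ 3" by (simp_all add: X power_divide)
  ultimately show ?thesis unfolding \<theta>_def by (simp only:)
qed

text \<open>In the lower half plane the estimate follows by complex conjugation, since cos(k \<theta>) is
  even in the angle.\<close>

lemma angular_supersolution:
  assumes k: "0 < k" "k < 1/2" and a: "2 < norm a"
    and side: "1 \<le> \<bar>Im a\<bar> \<or> (Im a = 0 \<and> 0 < Re a)"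
  shows "cos (k * Arg (a + 1)) + cos (k * Arg (a + \<i>)) + cos (k * Arg (a - 1)) + cos (k * Arg (a - \<i>))
       \<le> (4 - k\<^sup>2 / (norm a)\<^sup>2) * cos (k * Arg a) + 20 / norm a ^ 3"
proof (cases "Im a \<le> -1")
  case True
  have "cos (k * Arg (cnj a + 1)) + cos (k * Arg (cnj a + \<i>)) + cos (k * Arg (cnj a - 1)) + cos (k * Arg (cnj a - \<i>))
       \<le> (4 - k\<^sup>2 / (norm (cnj a))\<^sup>2) * cos (k * Arg (cnj a)) + 20 / norm (cnj a) ^ 3"
    by (rule angular_supersolution_upper[OF k]) (use a True in auto)
  moreover have e: "cnj a + 1 = cnj (a + 1)" "cnj a + \<i> = cnj (a - \<i>)" "cnj a - 1 = cnj (a - 1)" "cnj a - \<i> = cnj (a + \<i>)" by auto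
  ultimately show ?thesis unfolding e cos_Arg_cnj complex_mod_cnj by linarith
next
  case False
  then show ?thesis by (intro angular_supersolution_upper[OF k a]) (use side in auto)
qed

section \<open>A discrete Hardy inequality outside the crack\<close>

definition dual_pos :: "site \<Rightarrow> complex" where
  "dual_pos l = Complex (of_int (fst l)) (of_int (snd l))"

text \<open>The dual edge crossing a bond b runs between the dual vertices fst b and dual_end b.\<close>

definition dual_end :: "bond \<Rightarrow> site" where
  "dual_end b = fst b - (if snd b then (1,0) else (0,1))"

lemma dual_pos_dirs: "dual_pos (l + (1,0)) = dual_pos l + 1" "dual_pos (l + (0,1)) = dual_pos l + \<i>"
  "dual_pos (l + (-1,0)) = dual_pos l - 1" "dual_pos (l + (0,-1)) = dual_pos l - \<i>"
  by (auto simp: dual_pos_def complex_eq_iff)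

lemma dual_pos_shift: "\<rho> \<in> dirs \<Longrightarrow> \<exists>z. norm z = 1 \<and> dual_pos (l + \<rho>) = dual_pos l + z"
  by (rule exI[of _ "dual_pos (l + \<rho>) - dual_pos l"]) (auto simp: dirs_def dual_pos_dirs)

lemma dual_pos_dist: "\<rho> \<in> dirs \<Longrightarrow> \<bar>norm (dual_pos (l + \<rho>)) - norm (dual_pos l)\<bar> \<le> 1"
  using dual_pos_shift[of \<rho> l] norm_triangle_ineq3 by (metis add_diff_cancel_left')

lemma dual_end_dir: "\<exists>\<rho>\<in>dirs. dual_end b = fst b + \<rho>"
  by (cases b) (auto simp: dual_end_def dirs_def)

lemma cdiff_sq: "(cdiff s b)\<^sup>2 = (s (fst b) - s (dual_end b))\<^sup>2"
  by (auto simp: cdiff_def dual_end_def power2_commute)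

lemma dual_end_simps: "dual_end (l, False) = l - (0,1)" "dual_end (l, True) = l - (1,0)"
  by (auto simp: dual_end_def)

text \<open>Regrouping a sum over undirected edges as a sum over vertices and directions.\<close>

lemma edge_sum:
  fixes f :: "site \<Rightarrow> site \<Rightarrow> real"
  assumes S: "finite S" and f0: "\<And>x \<rho>. x \<notin> S \<Longrightarrow> \<rho> \<in> dirs \<Longrightarrow> f x (x + \<rho>) = 0"
  shows "(\<lambda>b. f (fst b) (dual_end b) + f (dual_end b) (fst b)) summable_on UNIV"
    and "(\<Sum>\<^sub>\<infinity>b. f (fst b) (dual_end b) + f (dual_end b) (fst b)) = (\<Sum>\<^sub>\<infinity>l. \<Sum>\<rho>\<in>dirs. f l (l + \<rho>))"
proof -
  have neg: "l - (0,1) = l + (0,-1)" "l - (1,0) = l + (-1,0)" for l :: site by (cases l; simp)+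
  have s1: "(\<lambda>l. f l (l + a)) summable_on UNIV" if "a \<in> dirs" for a
    by (rule summable_finite_support[OF S]) (use f0 that in auto)
  have s2: "(\<lambda>l. f (l - a) l) summable_on UNIV" if "a \<in> dirs" for a
  proof (rule summable_finite_support[OF finite_shift_img'[OF S, of a]])
    show "f (l - a) l = 0" if "l \<notin> {l. l - a \<in> S}" for l
      using f0[of "l - a" a] that \<open>a \<in> dirs\<close> by simp
  qed
  have sh: "(\<Sum>\<^sub>\<infinity>l. f (l - a) l) = (\<Sum>\<^sub>\<infinity>l. f l (l + a))" for a
    using infsum_shift[of "\<lambda>l. f l (l + a)" a] by simp
  have d: "(1,0) \<in> dirs" "(0,1) \<in> dirs" "(-1,0) \<in> dirs" "(0,-1) \<in> dirs" by (auto simp: dirs_def)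
  have t: "(\<lambda>l. f l (l - (0,1))) summable_on UNIV" "(\<lambda>l. f l (l - (1,0))) summable_on UNIV"
    unfolding neg by (rule s1[OF d(4)], rule s1[OF d(3)])
  show sm: "(\<lambda>b. f (fst b) (dual_end b) + f (dual_end b) (fst b)) summable_on UNIV"
    unfolding summable_bond_iff dual_end_simps fst_conv by (intro conjI summable_on_add t s2 d)
  have "(\<Sum>\<^sub>\<infinity>b. f (fst b) (dual_end b) + f (dual_end b) (fst b))
     = (\<Sum>\<^sub>\<infinity>l. (f l (l - (0,1)) + f (l - (0,1)) l) + (f l (l - (1,0)) + f (l - (1,0)) l))"
    unfolding infsum_bond[OF sm] dual_end_simps fst_conv ..
  moreover have "\<dots> = ((\<Sum>\<^sub>\<infinity>l. f l (l - (0,1))) + (\<Sum>\<^sub>\<infinity>l. f l (l + (0,1)))) + ((\<Sum>\<^sub>\<infinity>l. f l (l - (1,0))) + (\<Sum>\<^sub>\<infinity>l. f l (l + (1,0))))"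
    unfolding infsum_add[OF summable_on_add[OF t(1) s2[OF d(2)]] summable_on_add[OF t(2) s2[OF d(1)]]]
      infsum_add[OF t(1) s2[OF d(2)]] infsum_add[OF t(2) s2[OF d(1)]] sh ..
  moreover have "(\<Sum>\<^sub>\<infinity>l. \<Sum>\<rho>\<in>dirs. f l (l + \<rho>)) = (\<Sum>\<^sub>\<infinity>l. ((f l (l + (1,0)) + f l (l + (0,1))) + f l (l + (-1,0))) + f l (l + (0,-1)))"
    by (simp add: sum_dirs)
  moreover have "\<dots> = (((\<Sum>\<^sub>\<infinity>l. f l (l + (1,0))) + (\<Sum>\<^sub>\<infinity>l. f l (l + (0,1)))) + (\<Sum>\<^sub>\<infinity>l. f l (l + (-1,0)))) + (\<Sum>\<^sub>\<infinity>l. f l (l + (0,-1)))"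
    unfolding infsum_add[OF summable_on_add[OF summable_on_add[OF s1[OF d(1)] s1[OF d(2)]] s1[OF d(3)]] s1[OF d(4)]]
      infsum_add[OF summable_on_add[OF s1[OF d(1)] s1[OF d(2)]] s1[OF d(3)]] infsum_add[OF s1[OF d(1)] s1[OF d(2)]] ..
  ultimately show "(\<Sum>\<^sub>\<infinity>b. f (fst b) (dual_end b) + f (dual_end b) (fst b)) = (\<Sum>\<^sub>\<infinity>l. \<Sum>\<rho>\<in>dirs. f l (l + \<rho>))"
    unfolding neg by simp
qed

text \<open>With t = pb/pa the difference of the two sides is the square (sa t - sb)^2 / t.\<close>

lemma ground_state_edge:
  fixes sa sb pa pb :: real
  assumes "0 < pa" "0 < pb"
  shows "sa\<^sup>2 * (1 - pb / pa) + sb\<^sup>2 * (1 - pa / pb) \<le> (sa - sb)\<^sup>2"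
proof -
  define t where "t = pb / pa"
  have t: "0 < t" "pa / pb = 1 / t" using assms by (auto simp: t_def)
  have "0 \<le> (sa * t - sb)\<^sup>2 / t" using t by simp
  also have "(sa * t - sb)\<^sup>2 / t = sa\<^sup>2 * t + sb\<^sup>2 / t - 2 * sa * sb"
    using t by (simp add: power2_eq_square field_simps)
  finally show ?thesis unfolding t(2) t_def[symmetric] by (simp add: power2_diff algebra_simps)
qed

lemma finite_bond_neighbourhood:
  assumes "finite S" shows "finite {b. fst b \<in> S \<or> dual_end b \<in> S}"
proof (rule finite_subset)
  show "{b. fst b \<in> S \<or> dual_end b \<in> S} \<subseteq> (S \<union> {l. l - (1,0) \<in> S} \<union> {l. l - (0,1) \<in> S}) \<times> UNIV"
    by (auto simp: dual_end_def split: if_splits)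
  show "finite ((S \<union> {l. l - (1,0) \<in> S} \<union> {l. l - (0,1) \<in> S}) \<times> (UNIV :: bool set))"
    using assms finite_shift_img'[OF assms] by auto
qed

lemma cdiff_finite:
  assumes "finitely_supported \<tau>" shows "finite {b. cdiff \<tau> b \<noteq> 0}"
proof -
  have S: "finite {l. \<tau> l \<noteq> 0}" using assms by (simp add: finitely_supported_def)
  show ?thesis
    by (rule finite_subset[OF _ finite_bond_neighbourhood[OF S]]) (auto simp: cdiff_def dual_end_def split: if_splits)
qed

lemma cdiff_sq_summable:
  assumes "finitely_supported \<sigma>" shows "(\<lambda>b. (cdiff \<sigma> b)\<^sup>2) summable_on UNIV"
  by (rule summable_finite_support[OF cdiff_finite[OF assms]]) simp

text \<open>A positive function \<psi> yields a lower bound for the Dirichlet energy with potential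
  -\<Delta>\<psi>/\<psi>.\<close>

lemma ground_state_inequality:
  assumes \<sigma>: "finitely_supported \<sigma>" and \<psi>: "\<And>l. 0 < \<psi> l"
  shows "(\<Sum>\<^sub>\<infinity>l. (\<sigma> l)\<^sup>2 * (\<Sum>\<rho>\<in>dirs. 1 - \<psi> (l + \<rho>) / \<psi> l)) \<le> (\<Sum>\<^sub>\<infinity>b. (cdiff \<sigma> b)\<^sup>2)"
proof -
  let ?f = "\<lambda>x y. (\<sigma> x)\<^sup>2 * (1 - \<psi> y / \<psi> x)"
  have S: "finite {l. \<sigma> l \<noteq> 0}" using \<sigma> by (simp add: finitely_supported_def)
  have f0: "?f x (x + \<rho>) = 0" if "x \<notin> {l. \<sigma> l \<noteq> 0}" "\<rho> \<in> dirs" for x \<rho> using that by simp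
  have "(\<Sum>\<^sub>\<infinity>b. ?f (fst b) (dual_end b) + ?f (dual_end b) (fst b)) \<le> (\<Sum>\<^sub>\<infinity>b. (cdiff \<sigma> b)\<^sup>2)"
    by (rule infsum_mono[OF edge_sum(1)[of _ ?f, OF S f0] cdiff_sq_summable[OF \<sigma>]])
       (auto simp: cdiff_sq intro!: ground_state_edge \<psi>)
  moreover have "(\<Sum>\<^sub>\<infinity>b. ?f (fst b) (dual_end b) + ?f (dual_end b) (fst b)) = (\<Sum>\<^sub>\<infinity>l. \<Sum>\<rho>\<in>dirs. ?f l (l + \<rho>))"
    by (rule edge_sum(2)[of _ ?f, OF S f0])
  ultimately show ?thesis by (simp add: sum_distrib_left)
qed

text \<open>The ground state cos(k \<theta>) stays above cos(k \<pi>) > 0 because k < 1/2. Hence the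
  O(r^(-3)) error of the supersolution is eventually dominated by \<delta>/r^2 times the ground
  state, which fixes R. On the crack itself the supersolution property fails, and there \<sigma>
  has to vanish.\<close>

theorem crack_hardy:
  assumes k: "0 < k" "k < 1/2" and \<delta>: "0 < \<delta>"
  obtains R where "2 < R"
    "\<And>\<sigma>. finitely_supported \<sigma> \<Longrightarrow> (\<And>l. \<sigma> l \<noteq> 0 \<Longrightarrow> R \<le> norm (dual_pos l) \<and> l \<notin> cracked) \<Longrightarrow>
       (k\<^sup>2 - \<delta>) * (\<Sum>\<^sub>\<infinity>l. (\<sigma> l)\<^sup>2 / (norm (dual_pos l))\<^sup>2) \<le> (\<Sum>\<^sub>\<infinity>b. (cdiff \<sigma> b)\<^sup>2)"
proof -
  define m where "m = cos (k * pi)"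
  have kpi: "0 < k * pi" "k * pi < pi / 2" using k by auto
  have m: "0 < m" unfolding m_def by (rule cos_gt_zero_pi) (use kpi in linarith)+
  \<comment> \<open>From this radius on, 20/r^3 is at most \<delta>/r^2 times the lower bound m of the
    ground state.\<close>
  define R where "R = max 3 (20 / (\<delta> * m))"
  define \<psi> where "\<psi> = (\<lambda>l. cos (k * Arg (dual_pos l)))"
  have \<psi>m: "m \<le> \<psi> l" for l
  proof -
    have "\<bar>Arg (dual_pos l)\<bar> \<le> pi" using mpi_less_Arg[of "dual_pos l"] Arg_le_pi[of "dual_pos l"] by auto
    then have "\<bar>k * Arg (dual_pos l)\<bar> \<le> k * pi" using k by (simp add: abs_mult)
    then have "cos (k * pi) \<le> cos \<bar>k * Arg (dual_pos l)\<bar>" using kpi by (intro cos_monotone_0_pi_le) auto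
    then show ?thesis by (simp add: m_def \<psi>_def)
  qed
  have sup: "(k\<^sup>2 - \<delta>) / (norm (dual_pos l))\<^sup>2 \<le> (\<Sum>\<rho>\<in>dirs. 1 - \<psi> (l + \<rho>) / \<psi> l)"
    if l: "R \<le> norm (dual_pos l)" "l \<notin> cracked" for l
  proof -
    let ?r = "norm (dual_pos l)"
    have r: "2 < ?r" "20 / (\<delta> * m) \<le> ?r" using l(1) by (auto simp: R_def)
    have p: "0 < \<psi> l" using \<psi>m[of l] m by linarith
    have side: "1 \<le> \<bar>Im (dual_pos l)\<bar> \<or> (Im (dual_pos l) = 0 \<and> 0 < Re (dual_pos l))"
    proof (cases "snd l = 0")
      case True
      then have "0 < fst l" using l(2) by (auto simp: cracked_def)
      then show ?thesis using True by (simp add: dual_pos_def)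
    next
      case False
      then have "1 \<le> \<bar>snd l\<bar>" by linarith
      then have "1 \<le> \<bar>real_of_int (snd l)\<bar>" by linarith
      then show ?thesis by (simp add: dual_pos_def)
    qed
    have "(\<Sum>\<rho>\<in>dirs. \<psi> (l + \<rho>)) \<le> (4 - k\<^sup>2 / ?r\<^sup>2) * \<psi> l + 20 / ?r ^ 3"
      using angular_supersolution[OF k r(1) side] by (simp add: sum_dirs dual_pos_dirs \<psi>_def)
    also have "20 / ?r ^ 3 \<le> (\<delta> / ?r\<^sup>2) * \<psi> l"
    proof -
      have "20 \<le> ?r * (\<delta> * m)" using r(2) m \<delta> by (simp add: pos_divide_le_eq)
      then have "20 / ?r ^ 3 \<le> ?r * (\<delta> * m) / ?r ^ 3" by (intro divide_right_mono) auto
      also have "\<dots> = (\<delta> / ?r\<^sup>2) * m" using r by (simp add: power2_eq_square power3_eq_cube)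
      also have "\<dots> \<le> (\<delta> / ?r\<^sup>2) * \<psi> l" using \<psi>m \<delta> by (intro mult_left_mono) auto
      finally show ?thesis .
    qed
    finally have "(\<Sum>\<rho>\<in>dirs. \<psi> (l + \<rho>)) \<le> (4 - (k\<^sup>2 - \<delta>) / ?r\<^sup>2) * \<psi> l" by (simp add: algebra_simps diff_divide_distrib)
    then have "(\<Sum>\<rho>\<in>dirs. \<psi> (l + \<rho>)) / \<psi> l \<le> 4 - (k\<^sup>2 - \<delta>) / ?r\<^sup>2" using p by (simp add: pos_divide_le_eq)
    then show ?thesis by (simp add: sum_dirs add_divide_distrib)
  qed
  show ?thesis
  proof (rule that[of R])
    show "2 < R" by (simp add: R_def)
    fix \<sigma> assume \<sigma>: "finitely_supported \<sigma>" and supp: "\<And>l. \<sigma> l \<noteq> 0 \<Longrightarrow> R \<le> norm (dual_pos l) \<and> l \<notin> cracked"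
    have S: "finite {l. \<sigma> l \<noteq> 0}" using \<sigma> by (simp add: finitely_supported_def)
    have "(k\<^sup>2 - \<delta>) * (\<Sum>\<^sub>\<infinity>l. (\<sigma> l)\<^sup>2 / (norm (dual_pos l))\<^sup>2) = (\<Sum>\<^sub>\<infinity>l. (\<sigma> l)\<^sup>2 * ((k\<^sup>2 - \<delta>) / (norm (dual_pos l))\<^sup>2))"
      by (subst infsum_cmult_right'[symmetric]) (simp add: algebra_simps)
    also have "\<dots> \<le> (\<Sum>\<^sub>\<infinity>l. (\<sigma> l)\<^sup>2 * (\<Sum>\<rho>\<in>dirs. 1 - \<psi> (l + \<rho>) / \<psi> l))"
    proof (rule infsum_mono)
      show "(\<lambda>l. (\<sigma> l)\<^sup>2 * ((k\<^sup>2 - \<delta>) / (norm (dual_pos l))\<^sup>2)) summable_on UNIV"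
        "(\<lambda>l. (\<sigma> l)\<^sup>2 * (\<Sum>\<rho>\<in>dirs. 1 - \<psi> (l + \<rho>) / \<psi> l)) summable_on UNIV"
        by (rule summable_finite_support[OF S], simp)+
      show "(\<sigma> l)\<^sup>2 * ((k\<^sup>2 - \<delta>) / (norm (dual_pos l))\<^sup>2) \<le> (\<sigma> l)\<^sup>2 * (\<Sum>\<rho>\<in>dirs. 1 - \<psi> (l + \<rho>) / \<psi> l)" for l
        using sup[of l] supp[of l] by (cases "\<sigma> l = 0") (auto intro: mult_left_mono simp del: times_divide_eq_right)
    qed
    also have "\<dots> \<le> (\<Sum>\<^sub>\<infinity>b. (cdiff \<sigma> b)\<^sup>2)"
      by (rule ground_state_inequality[OF \<sigma>]) (use \<psi>m m in \<open>meson less_le_trans\<close>)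
    finally show "(k\<^sup>2 - \<delta>) * (\<Sum>\<^sub>\<infinity>l. (\<sigma> l)\<^sup>2 / (norm (dual_pos l))\<^sup>2) \<le> (\<Sum>\<^sub>\<infinity>b. (cdiff \<sigma> b)\<^sup>2)" .
  qed
qed

section \<open>Power weights\<close>

text \<open>Up to the radius N this is the power r^\<alpha>; beyond, it decays like r^(-\<alpha>). As ln r
  increases, the logarithm of the tent changes at rate at most \<alpha> on both sides, so that the
  relative gradient is at most \<alpha>/r everywhere, while the decay at infinity allows the tent
  to be cut off far out at negligible cost.\<close>

definition tent :: "real \<Rightarrow> real \<Rightarrow> site \<Rightarrow> real" where
  "tent \<alpha> N l = exp (\<alpha> * min (ln (norm (dual_pos l))) (2 * ln N - ln (norm (dual_pos l))))"

lemma exp_minus_one_le: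
  fixes t :: real assumes "\<bar>t\<bar> \<le> 1" shows "\<bar>exp t - 1\<bar> \<le> \<bar>t\<bar> * (1 + \<bar>t\<bar>)"
proof (cases "0 \<le> t")
  case True then show ?thesis using exp_bound[of t] assms by (simp add: power2_eq_square algebra_simps)
next
  case False
  then have "exp t < 1" by simp
  then have "\<bar>exp t - 1\<bar> \<le> \<bar>t\<bar> * 1" using exp_ge_add_one_self[of t] by linarith
  also have "\<dots> \<le> \<bar>t\<bar> * (1 + \<bar>t\<bar>)" by (intro mult_left_mono) auto
  finally show ?thesis .
qed

lemma tent_step:
  assumes a: "2 < norm (dual_pos l)" and z: "norm z = 1" "dual_pos l' = dual_pos l + z" and \<alpha>: "0 \<le> \<alpha>" "\<alpha> \<le> 1/2"
  shows "\<bar>tent \<alpha> N l' - tent \<alpha> N l\<bar> \<le> tent \<alpha> N l * (\<alpha> * \<bar>Re (Ln (1 + z / dual_pos l))\<bar> * (1 + 1 / norm (dual_pos l)))"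
    and "\<bar>tent \<alpha> N l' - tent \<alpha> N l\<bar> \<le> tent \<alpha> N l * (2 / norm (dual_pos l))"
proof -
  let ?a = "dual_pos l" let ?L = "Re (Ln (1 + z / ?a))"
  have a0: "?a \<noteq> 0" using a by auto
  have n: "norm (z / ?a) = 1 / norm ?a" using z by (simp add: norm_divide)
  then have n2: "norm (z / ?a) < 1/2" using a by (simp add: divide_less_eq)
  have w0: "1 + z / ?a \<noteq> 0" using n2
  proof -
    have "Re (1 + z / ?a) > 0" using abs_Re_le_cmod[of "z / ?a"] n2 by auto
    then show ?thesis by (metis less_irrefl zero_complex.simps(1))
  qed
  have eq: "dual_pos l' = ?a * (1 + z / ?a)" using z a0 by (simp add: field_simps)
  have L: "?L = ln (norm (dual_pos l')) - ln (norm ?a)"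
    unfolding eq using a0 w0 by (simp add: norm_mult ln_mult)
  have "\<bar>?L\<bar> \<le> norm (Ln (1 + z / ?a))" by (rule abs_Re_le_cmod)
  then have Ls: "\<bar>?L\<bar> \<le> 2 / norm ?a" using norm_Ln_le[OF n2] n by simp
  \<comment> \<open>The exponent of the ratio of the two values; its size is at most \<alpha> times the
    change of ln r.\<close>
  define t where "t = \<alpha> * (min (ln (norm (dual_pos l'))) (2 * ln N - ln (norm (dual_pos l'))) - min (ln (norm ?a)) (2 * ln N - ln (norm ?a)))"
  have tL: "\<bar>t\<bar> \<le> \<alpha> * \<bar>?L\<bar>" unfolding t_def abs_mult L using \<alpha>
    by (intro mult_mono) (auto simp: min_def abs_if)
  have "\<alpha> * \<bar>?L\<bar> \<le> (1/2) * (2 / norm ?a)" using \<alpha> Ls by (intro mult_mono) auto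
  then have ta: "\<alpha> * \<bar>?L\<bar> \<le> 1 / norm ?a" by simp
  have one: "1 / norm ?a \<le> 1" using a by (simp add: divide_le_eq)
  have "tent \<alpha> N l' = tent \<alpha> N l * exp t"
    by (simp add: tent_def t_def exp_add[symmetric] algebra_simps)
  then have "\<bar>tent \<alpha> N l' - tent \<alpha> N l\<bar> = tent \<alpha> N l * \<bar>exp t - 1\<bar>"
    using abs_mult[of "tent \<alpha> N l" "exp t - 1"] by (simp add: right_diff_distrib tent_def)
  moreover have e: "\<bar>exp t - 1\<bar> \<le> \<bar>t\<bar> * (1 + \<bar>t\<bar>)" by (rule exp_minus_one_le) (use tL ta one in linarith)
  moreover have e1: "\<bar>t\<bar> * (1 + \<bar>t\<bar>) \<le> (\<alpha> * \<bar>?L\<bar>) * (1 + 1 / norm ?a)"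
    using tL ta \<alpha> by (intro mult_mono) auto
  moreover have e2: "(\<alpha> * \<bar>?L\<bar>) * (1 + 1 / norm ?a) \<le> (1 / norm ?a) * 2"
    using ta one \<alpha> by (intro mult_mono) auto
  moreover have "0 \<le> tent \<alpha> N l" by (simp add: tent_def)
  ultimately show "\<bar>tent \<alpha> N l' - tent \<alpha> N l\<bar> \<le> tent \<alpha> N l * (\<alpha> * \<bar>?L\<bar> * (1 + 1 / norm ?a))"
    and "\<bar>tent \<alpha> N l' - tent \<alpha> N l\<bar> \<le> tent \<alpha> N l * (2 / norm ?a)"
    using mult_left_mono[of "\<bar>exp t - 1\<bar>" "\<alpha> * \<bar>?L\<bar> * (1 + 1 / norm ?a)" "tent \<alpha> N l"]
      mult_left_mono[of "\<bar>exp t - 1\<bar>" "2 / norm ?a" "tent \<alpha> N l"] by linarith+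
qed

text \<open>Half the squared increments in the four directions is the discrete squared gradient; its leading
  term \<alpha>^2 w^2/r^2 is exactly what the Hardy inequality has to beat.\<close>

lemma tent_gradient:
  assumes a: "2 < norm (dual_pos l)" and \<alpha>: "0 \<le> \<alpha>" "\<alpha> \<le> 1/2"
  shows "(\<Sum>\<rho>\<in>dirs. (tent \<alpha> N l - tent \<alpha> N (l + \<rho>))\<^sup>2) / 2 \<le> (\<alpha>\<^sup>2 + 50 / norm (dual_pos l)) / (norm (dual_pos l))\<^sup>2 * (tent \<alpha> N l)\<^sup>2"
proof -
  let ?a = "dual_pos l" let ?T = "tent \<alpha> N l"
  define x where "x = 1 / ?a"
  define X where "X = norm x"
  have X: "X = 1 / norm ?a" by (simp add: X_def x_def norm_divide)
  have x2: "norm x < 1/2" using a X by (simp add: X_def[symmetric] divide_less_eq)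
  have X0: "0 \<le> X" "X \<le> 1/2" using x2 by (auto simp: X_def)
  have st: "(?T - tent \<alpha> N l')\<^sup>2 \<le> ?T\<^sup>2 * \<alpha>\<^sup>2 * (1 + X)\<^sup>2 * (Re (Ln (1 + z * x)))\<^sup>2"
    if "norm z = 1" "dual_pos l' = ?a + z" for z l'
  proof -
    have "\<bar>?T - tent \<alpha> N l'\<bar> \<le> ?T * (\<alpha> * \<bar>Re (Ln (1 + z / ?a))\<bar> * (1 + 1 / norm ?a))"
      using tent_step(1)[OF a that \<alpha>] by (simp add: abs_minus_commute)
    then have "\<bar>?T - tent \<alpha> N l'\<bar>\<^sup>2 \<le> (?T * (\<alpha> * \<bar>Re (Ln (1 + z / ?a))\<bar> * (1 + 1 / norm ?a)))\<^sup>2"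
      by (rule power_mono) simp
    then show ?thesis by (simp add: power_mult_distrib x_def X mult_ac)
  qed
  have "(\<Sum>\<rho>\<in>dirs. (?T - tent \<alpha> N (l + \<rho>))\<^sup>2)
     \<le> ?T\<^sup>2 * \<alpha>\<^sup>2 * (1 + X)\<^sup>2 * ((Re (Ln (1 + x)))\<^sup>2 + (Re (Ln (1 + \<i> * x)))\<^sup>2 + (Re (Ln (1 - x)))\<^sup>2 + (Re (Ln (1 - \<i> * x)))\<^sup>2)"
    using st[of 1 "l + (1,0)"] st[of "\<i>" "l + (0,1)"] st[of "-1" "l + (-1,0)"] st[of "-\<i>" "l + (0,-1)"]
    by (simp add: dual_pos_dirs sum_dirs distrib_left)
  also have "\<dots> \<le> ?T\<^sup>2 * \<alpha>\<^sup>2 * (1 + X)\<^sup>2 * (2 * X\<^sup>2 + 24 * X ^ 3)"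
    unfolding X_def by (rule mult_left_mono[OF sum_log_squares(2)[OF x2]]) simp
  also have "\<dots> = ?T\<^sup>2 * X\<^sup>2 * (\<alpha>\<^sup>2 * ((1 + X)\<^sup>2 * (2 + 24 * X)))"
    by (simp add: power2_eq_square power3_eq_cube algebra_simps)
  also have "\<dots> \<le> ?T\<^sup>2 * X\<^sup>2 * (2 * \<alpha>\<^sup>2 + 100 * X)"
  proof (rule mult_left_mono)
    have "X\<^sup>2 \<le> X" using X0 by (simp add: power2_eq_square mult_left_le)
    then have "(1 + X)\<^sup>2 \<le> 1 + 3 * X" by (simp add: power2_eq_square algebra_simps)
    then have "(1 + X)\<^sup>2 * (2 + 24 * X) \<le> (1 + 3 * X) * (2 + 24 * X)" using X0 by (intro mult_right_mono) auto
    also have "\<dots> = 2 + 30 * X + 72 * X\<^sup>2" by (simp add: power2_eq_square algebra_simps)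
    also have "\<dots> \<le> 2 + 102 * X" using \<open>X\<^sup>2 \<le> X\<close> by simp
    finally have "\<alpha>\<^sup>2 * ((1 + X)\<^sup>2 * (2 + 24 * X)) \<le> \<alpha>\<^sup>2 * (2 + 102 * X)" by (rule mult_left_mono) simp
    also have "\<dots> = 2 * \<alpha>\<^sup>2 + \<alpha>\<^sup>2 * (102 * X)" by (simp add: algebra_simps)
    also have "\<alpha>\<^sup>2 * (102 * X) \<le> (1/4) * (102 * X)"
      using power_mono[of \<alpha> "1/2" 2] \<alpha> X0 by (intro mult_right_mono) (auto simp: power2_eq_square)
    finally show "\<alpha>\<^sup>2 * ((1 + X)\<^sup>2 * (2 + 24 * X)) \<le> 2 * \<alpha>\<^sup>2 + 100 * X" using X0 by simp
  qed simp
  finally show ?thesis by (simp add: X power_divide field_simps)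
qed

section \<open>Paths and box estimates\<close>

lemma telescope_int:
  fixes f :: "int \<Rightarrow> real"
  assumes "i \<le> j" shows "f j - f i = (\<Sum>k\<in>{i<..j}. f k - f (k - 1))"
  using assms
proof (induction j rule: int_ge_induct)
  case (step j)
  have "{i<..j+1} = insert (j+1) {i<..j}" using step by auto
  then show ?case using step by simp
qed simp

text \<open>Cauchy-Schwarz along a path, in a form independent of the order of the end points.\<close>

lemma path_estimate:
  fixes f :: "int \<Rightarrow> real"
  assumes "A \<le> i" "i \<le> B" "A \<le> j" "j \<le> B"
  shows "(f j - f i)\<^sup>2 \<le> of_int (B - A) * (\<Sum>k\<in>{A<..B}. (f k - f (k - 1))\<^sup>2)"
proof -
  have *: "(f j - f i)\<^sup>2 \<le> of_int (B - A) * (\<Sum>k\<in>{A<..B}. (f k - f (k - 1))\<^sup>2)"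
    if "A \<le> i" "i \<le> j" "j \<le> B" for i j
  proof -
    have "(f j - f i)\<^sup>2 \<le> (\<Sum>k\<in>{i<..j}. (f k - f (k - 1))\<^sup>2) * card {i<..j}"
      unfolding telescope_int[OF that(2)] by (rule sum_squared_le_sum_of_squares)
    also have "\<dots> \<le> (\<Sum>k\<in>{A<..B}. (f k - f (k - 1))\<^sup>2) * of_int (B - A)"
      using that by (intro mult_mono sum_mono2) (auto intro: sum_nonneg)
    finally show ?thesis by (simp add: mult.commute)
  qed
  show ?thesis
  proof (cases "i \<le> j")
    case True then show ?thesis using * assms by blast
  next
    case False then show ?thesis using *[of j i] assms by (simp add: power2_commute)
  qed
qed

lemma bond_rectangle_le:
  fixes h :: "bond \<Rightarrow> real"
  assumes "h summable_on UNIV" "\<And>b. 0 \<le> h b" "finite I" "finite J"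
  shows "(\<Sum>x\<in>I. \<Sum>y\<in>J. h ((x, y), i)) \<le> (\<Sum>\<^sub>\<infinity>b. h b)"
proof -
  have "(\<Sum>x\<in>I. \<Sum>y\<in>J. h ((x, y), i)) = sum h ((\<lambda>l. (l, i)) ` (I \<times> J))"
    by (subst sum.reindex) (auto simp: inj_on_def sum.cartesian_product)
  also have "\<dots> \<le> (\<Sum>\<^sub>\<infinity>b. h b)"
    using assms by (intro finite_sum_le_infsum) auto
  finally show ?thesis .
qed

text \<open>A path along the row from (x,y) to (-|x|,y), and then along the column to (-|x|,0), ends on the
  crack, where s vanishes. Hence s is controlled by its gradient in boxes around the tip.\<close>

lemma box_estimate:
  assumes s0: "\<And>l. l \<in> cracked \<Longrightarrow> s l = 0" and sm: "(\<lambda>b. (cdiff s b)\<^sup>2) summable_on UNIV" and K: "1 \<le> K"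
  shows "(\<Sum>x\<in>{-K..K}. \<Sum>y\<in>{-K..K}. (s (x, y))\<^sup>2) \<le> 36 * (of_int K)\<^sup>2 * (\<Sum>\<^sub>\<infinity>b. (cdiff s b)\<^sup>2)"
proof -
  let ?I = "{-K..K}" let ?J = "{-K<..K}" let ?E = "\<Sum>\<^sub>\<infinity>b. (cdiff s b)\<^sup>2"
  define row where "row y = (\<Sum>k\<in>?J. (cdiff s ((k, y), True))\<^sup>2)" for y
  define col where "col x = (\<Sum>k\<in>?J. (cdiff s ((x, k), False))\<^sup>2)" for x
  have E0: "0 \<le> ?E" by (simp add: infsum_nonneg)
  have col0: "0 \<le> col x" for x unfolding col_def by (rule sum_nonneg) simp
  have pt: "(s (x, y))\<^sup>2 \<le> 4 * of_int K * row y + 4 * of_int K * col (- \<bar>x\<bar>)" if "x \<in> ?I" "y \<in> ?I" for x y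
  proof -
    have b: "-K \<le> - \<bar>x\<bar>" "- \<bar>x\<bar> \<le> K" "-K \<le> x" "x \<le> K" "-K \<le> 0" "0 \<le> K" "-K \<le> y" "y \<le> K" using that K by auto
    have 1: "(s (x, y) - s (- \<bar>x\<bar>, y))\<^sup>2 \<le> of_int (K - (- K)) * row y"
      using path_estimate[OF b(1-4), of "\<lambda>k. s (k, y)"]
      by (simp add: row_def cdiff_def power2_commute)
    have 2: "(s (- \<bar>x\<bar>, y) - s (- \<bar>x\<bar>, 0))\<^sup>2 \<le> of_int (K - (- K)) * col (- \<bar>x\<bar>)"
      using path_estimate[OF b(5-8), of "\<lambda>k. s (- \<bar>x\<bar>, k)"]
      by (simp add: col_def cdiff_def)
    have "s (- \<bar>x\<bar>, 0) = 0" by (rule s0) (simp add: cracked_def)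
    then have "(s (x, y))\<^sup>2 \<le> 2 * (s (x, y) - s (- \<bar>x\<bar>, y))\<^sup>2 + 2 * (s (- \<bar>x\<bar>, y) - s (- \<bar>x\<bar>, 0))\<^sup>2"
      using sum_squares_bound[of "s (x, y) - s (- \<bar>x\<bar>, y)" "s (- \<bar>x\<bar>, y)"]
      by (simp add: power2_eq_square algebra_simps)
    with 1 2 show ?thesis by simp
  qed
  have R: "(\<Sum>y\<in>?I. row y) \<le> ?E"
    unfolding row_def by (subst sum.swap) (rule bond_rectangle_le[OF sm], auto)
  have C: "(\<Sum>x\<in>?I. col x) \<le> ?E"
    unfolding col_def by (rule bond_rectangle_le[OF sm], auto)
  \<comment> \<open>Each column to the left of the tip is used for both x and -x.\<close>
  have C2: "(\<Sum>x\<in>?I. col (- \<bar>x\<bar>)) \<le> 2 * ?E"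
  proof -
    have "(\<Sum>x\<in>?I. col (- \<bar>x\<bar>)) \<le> (\<Sum>x\<in>?I. col x + col (- x))"
      by (rule sum_mono) (auto simp: abs_if col0)
    also have "\<dots> = (\<Sum>x\<in>?I. col x) + (\<Sum>x\<in>?I. col (- x))" by (rule sum.distrib)
    also have "(\<Sum>x\<in>?I. col (- x)) = (\<Sum>x\<in>?I. col x)"
      by (rule sum.reindex_bij_witness[where i=uminus and j=uminus]) auto
    finally show ?thesis using C by simp
  qed
  have cI: "real (card ?I) = 2 * of_int K + 1" using K by simp
  have "(\<Sum>x\<in>?I. \<Sum>y\<in>?I. (s (x, y))\<^sup>2) \<le> (\<Sum>x\<in>?I. \<Sum>y\<in>?I. 4 * of_int K * row y + 4 * of_int K * col (- \<bar>x\<bar>))"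
    by (intro sum_mono pt)
  also have "\<dots> = (2 * of_int K + 1) * (4 * of_int K) * (\<Sum>y\<in>?I. row y) + (2 * of_int K + 1) * (4 * of_int K) * (\<Sum>x\<in>?I. col (- \<bar>x\<bar>))"
    unfolding sum.distrib sum_constant cI[symmetric] sum_distrib_left[symmetric] by (simp add: sum_distrib_left[symmetric] algebra_simps)
  also have "\<dots> \<le> (2 * of_int K + 1) * (4 * of_int K) * ?E + (2 * of_int K + 1) * (4 * of_int K) * (2 * ?E)"
    using R C2 K by (intro add_mono mult_left_mono) auto
  also have "\<dots> = (12 * of_int K * (2 * of_int K + 1)) * ?E" by (simp add: algebra_simps)
  also have "\<dots> \<le> (12 * of_int K * (3 * of_int K)) * ?E"
    using K E0 by (intro mult_right_mono mult_left_mono) auto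
  finally show ?thesis by (simp add: power2_eq_square algebra_simps)
qed

section \<open>The weighted energy identity\<close>

text \<open>The first bound is the identity (sa - sb)(wa^2 sa - wb^2 sb) = D^2 - (wa - wb)^2 sa sb; the
  second is Young's inequality with parameter d; the third compares the weighted gradient with the
  gradient of the weighted function.\<close>

lemma weighted_edge:
  fixes wa wb sa sb q g d :: real
  assumes w: "0 \<le> wa" "0 \<le> wb" and d: "0 < d" and g: "0 \<le> g"
    and q: "wa \<noteq> 0 \<or> wb \<noteq> 0 \<Longrightarrow> \<bar>q\<bar> \<le> g + d * \<bar>sa - sb\<bar>"
  defines "D \<equiv> wa * sa - wb * sb" and "Y \<equiv> (wa - wb)\<^sup>2 * (sa\<^sup>2 + sb\<^sup>2) / 2" and "m \<equiv> (wa + wb) / 2"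
  shows "D\<^sup>2 - Y \<le> (sa - sb) * (wa\<^sup>2 * sa - wb\<^sup>2 * sb)" (is ?A)
    and "\<bar>q * (wa\<^sup>2 * sa - wb\<^sup>2 * sb)\<bar> \<le> d * (3 * D\<^sup>2 + 12 * Y) + (m * g)\<^sup>2 / (2 * d)" (is ?B)
    and "m\<^sup>2 * (sa - sb)\<^sup>2 \<le> 2 * D\<^sup>2 + 2 * Y" (is ?C)
proof -
  have "(sa - sb) * (wa\<^sup>2 * sa - wb\<^sup>2 * sb) = D\<^sup>2 - (wa - wb)\<^sup>2 * (sa * sb)"
    by (simp add: D_def power2_eq_square algebra_simps)
  moreover have "(wa - wb)\<^sup>2 * (sa * sb) \<le> (wa - wb)\<^sup>2 * ((sa\<^sup>2 + sb\<^sup>2) / 2)"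
    using sum_squares_bound[of sa sb] by (intro mult_left_mono) auto
  ultimately show ?A by (simp add: Y_def)
  define z where "z = \<bar>wa - wb\<bar> * ((\<bar>sa\<bar> + \<bar>sb\<bar>) / 2)"
  have z0: "0 \<le> z" by (simp add: z_def)
  have m0: "0 \<le> m" using w by (simp add: m_def)
  have zY: "z\<^sup>2 \<le> Y"
  proof -
    have "((\<bar>sa\<bar> + \<bar>sb\<bar>) / 2)\<^sup>2 \<le> (sa\<^sup>2 + sb\<^sup>2) / 2"
      using sum_squares_bound[of "\<bar>sa\<bar>" "\<bar>sb\<bar>"] by (simp add: power_divide power2_sum)
    then have "(wa - wb)\<^sup>2 * ((\<bar>sa\<bar> + \<bar>sb\<bar>) / 2)\<^sup>2 \<le> (wa - wb)\<^sup>2 * ((sa\<^sup>2 + sb\<^sup>2) / 2)" by (rule mult_left_mono) simp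
    moreover have "z\<^sup>2 = (wa - wb)\<^sup>2 * ((\<bar>sa\<bar> + \<bar>sb\<bar>) / 2)\<^sup>2" by (simp only: z_def power_mult_distrib power2_abs)
    ultimately show ?thesis unfolding Y_def by (simp only: times_divide_eq_right)
  qed
  have md: "m * \<bar>sa - sb\<bar> \<le> \<bar>D\<bar> + z"
  proof -
    have e: "m * (sa - sb) = D - (wa - wb) * ((sa + sb) / 2)" by (simp add: m_def D_def field_simps)
    have "\<bar>(wa - wb) * ((sa + sb) / 2)\<bar> \<le> z" unfolding z_def abs_mult by (intro mult_left_mono) auto
    then have "\<bar>m * (sa - sb)\<bar> \<le> \<bar>D\<bar> + z" unfolding e by linarith
    then show ?thesis using m0 by (simp add: abs_mult)
  qed
  have T: "\<bar>wa\<^sup>2 * sa - wb\<^sup>2 * sb\<bar> \<le> m * (\<bar>D\<bar> + 2 * z)"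
  proof -
    have e: "wa\<^sup>2 * sa - wb\<^sup>2 * sb = m * D + (wa - wb) * ((wa * sa + wb * sb) / 2)"
      by (simp add: m_def D_def power2_eq_square field_simps)
    have "\<bar>wa * sa + wb * sb\<bar> \<le> wa * \<bar>sa\<bar> + wb * \<bar>sb\<bar>"
      using w abs_triangle_ineq[of "wa * sa" "wb * sb"] by (simp add: abs_mult)
    also have "\<dots> \<le> (wa + wb) * (\<bar>sa\<bar> + \<bar>sb\<bar>)" using w by (simp add: algebra_simps)
    finally have "\<bar>wa * sa + wb * sb\<bar> / 2 \<le> m * (\<bar>sa\<bar> + \<bar>sb\<bar>)" by (simp add: m_def)
    then have "\<bar>wa - wb\<bar> * (\<bar>wa * sa + wb * sb\<bar> / 2) \<le> \<bar>wa - wb\<bar> * (m * (\<bar>sa\<bar> + \<bar>sb\<bar>))"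
      by (rule mult_left_mono) simp
    also have "\<dots> = m * (2 * z)" by (simp add: z_def)
    finally have "\<bar>(wa - wb) * ((wa * sa + wb * sb) / 2)\<bar> \<le> m * (2 * z)" by (simp add: abs_mult)
    moreover have "\<bar>m * D\<bar> = m * \<bar>D\<bar>" using m0 by (simp add: abs_mult)
    ultimately show ?thesis unfolding e distrib_left by linarith
  qed
  define P where "P = \<bar>D\<bar> + 2 * z"
  have P0: "0 \<le> P" using z0 by (simp add: P_def)
  have P2: "P\<^sup>2 \<le> 2 * D\<^sup>2 + 8 * Y"
    using sum_squares_bound[of "\<bar>D\<bar>" "2 * z"] zY by (simp add: P_def power2_sum power_mult_distrib)
  show ?B
  proof (cases "m = 0")
    case True
    then have "\<bar>wa\<^sup>2 * sa - wb\<^sup>2 * sb\<bar> \<le> 0" using T by simp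
    then have "wa\<^sup>2 * sa - wb\<^sup>2 * sb = 0" by simp
    moreover have "0 \<le> Y" using zY zero_le_power2[of z] by linarith
    ultimately show ?thesis using d True by simp
  next
    case False
    then have q': "\<bar>q\<bar> \<le> g + d * \<bar>sa - sb\<bar>" using q by (auto simp: m_def)
    have "\<bar>q * (wa\<^sup>2 * sa - wb\<^sup>2 * sb)\<bar> \<le> \<bar>q\<bar> * (m * P)"
      unfolding abs_mult P_def by (rule mult_left_mono[OF T]) simp
    also have "\<dots> = (m * \<bar>q\<bar>) * P" by simp
    also have "\<dots> \<le> (m * g + d * P) * P"
    proof (rule mult_right_mono[OF _ P0])
      have "m * \<bar>q\<bar> \<le> m * (g + d * \<bar>sa - sb\<bar>)" by (rule mult_left_mono[OF q' m0])
      also have "\<dots> = m * g + d * (m * \<bar>sa - sb\<bar>)" by (simp add: algebra_simps)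
      also have "\<dots> \<le> m * g + d * P" using md d z0 by (intro add_left_mono mult_left_mono) (auto simp: P_def)
      finally show "m * \<bar>q\<bar> \<le> m * g + d * P" .
    qed
    also have "\<dots> = (m * g) * P + d * P\<^sup>2" by (simp add: power2_eq_square algebra_simps)
    also have "(m * g) * P \<le> (m * g)\<^sup>2 / (2 * d) + d / 2 * P\<^sup>2"
    proof -
      have "0 \<le> (m * g - d * P)\<^sup>2 / (2 * d)" using d by simp
      also have "\<dots> = (m * g)\<^sup>2 / (2 * d) + d / 2 * P\<^sup>2 - (m * g) * P"
        using d by (simp add: power2_eq_square field_simps)
      finally show ?thesis by simp
    qed
    finally have "\<bar>q * (wa\<^sup>2 * sa - wb\<^sup>2 * sb)\<bar> \<le> (m * g)\<^sup>2 / (2 * d) + (3 / 2) * (d * P\<^sup>2)" by simp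
    moreover have "d * P\<^sup>2 \<le> d * (2 * D\<^sup>2 + 8 * Y)" using P2 d by (intro mult_left_mono) auto
    ultimately show ?thesis by (simp add: algebra_simps)
  qed
  have "(m * \<bar>sa - sb\<bar>)\<^sup>2 \<le> (\<bar>D\<bar> + z)\<^sup>2" using md m0 by (intro power_mono) auto
  also have "\<dots> \<le> 2 * D\<^sup>2 + 2 * z\<^sup>2" using sum_squares_bound[of "\<bar>D\<bar>" z] by (simp add: power2_sum)
  finally show ?C using zY by (simp add: power_mult_distrib)
qed

text \<open>The price for moving the weight inside the difference.\<close>

definition transition :: "(site \<Rightarrow> real) \<Rightarrow> (site \<Rightarrow> real) \<Rightarrow> bond \<Rightarrow> real" where
  "transition w s b = (w (fst b) - w (dual_end b))\<^sup>2 * ((s (fst b))\<^sup>2 + (s (dual_end b))\<^sup>2) / 2"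

lemma transition_sum:
  assumes "finitely_supported w"
  shows "transition w s summable_on UNIV"
    and "(\<Sum>\<^sub>\<infinity>b. transition w s b) = (\<Sum>\<^sub>\<infinity>l. (s l)\<^sup>2 * ((\<Sum>\<rho>\<in>dirs. (w l - w (l + \<rho>))\<^sup>2) / 2))"
proof -
  let ?f = "\<lambda>x y. (w x - w y)\<^sup>2 * (s x)\<^sup>2 / 2"
  let ?W = "{l. w l \<noteq> 0}"
  let ?S = "?W \<union> {l. l + (1,0) \<in> ?W} \<union> {l. l + (0,1) \<in> ?W} \<union> {l. l + (-1,0) \<in> ?W} \<union> {l. l + (0,-1) \<in> ?W}"
  have W: "finite ?W" using assms by (simp add: finitely_supported_def)
  have S: "finite ?S" by (intro finite_UnI W finite_shift_img[OF W])
  have f0: "?f x (x + \<rho>) = 0" if "x \<notin> ?S" "\<rho> \<in> dirs" for x \<rho> using that by (auto simp: dirs_def)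
  have eq: "transition w s b = ?f (fst b) (dual_end b) + ?f (dual_end b) (fst b)" for b
    by (simp add: transition_def power2_commute[of "w (dual_end b)"] algebra_simps add_divide_distrib)
  show "transition w s summable_on UNIV"
    using edge_sum(1)[of _ ?f, OF S f0] by (simp add: eq[abs_def])
  show "(\<Sum>\<^sub>\<infinity>b. transition w s b) = (\<Sum>\<^sub>\<infinity>l. (s l)\<^sup>2 * ((\<Sum>\<rho>\<in>dirs. (w l - w (l + \<rho>))\<^sup>2) / 2))"
  proof -
    have "(\<Sum>\<^sub>\<infinity>b. transition w s b) = (\<Sum>\<^sub>\<infinity>b. ?f (fst b) (dual_end b) + ?f (dual_end b) (fst b))" by (simp only: eq)
    also have "\<dots> = (\<Sum>\<^sub>\<infinity>l. \<Sum>\<rho>\<in>dirs. ?f l (l + \<rho>))" by (rule edge_sum(2)[of _ ?f, OF S f0])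
    finally show ?thesis by (simp add: sum_distrib_left sum_divide_distrib mult.commute)
  qed
qed

text \<open>Testing with w^2 s: the Dirichlet energy X of w s is controlled by the transition energy Y and
  the source. The factor 1 + 12 d can be made as close to 1 as desired, which matters because Y
  will be compared with X with a ratio below but possibly close to 1.\<close>

lemma weighted_energy:
  assumes w: "finitely_supported w" "\<And>l. 0 \<le> w l" and d: "0 < d" and g: "\<And>b. 0 \<le> g b"
    and q: "\<And>b. w (fst b) \<noteq> 0 \<or> w (dual_end b) \<noteq> 0 \<Longrightarrow> \<bar>q b\<bar> \<le> g b + d * \<bar>cdiff s b\<bar>"
    and weak: "(\<Sum>\<^sub>\<infinity>b. q b * cdiff (\<lambda>l. (w l)\<^sup>2 * s l) b) = (\<Sum>\<^sub>\<infinity>b. cdiff s b * cdiff (\<lambda>l. (w l)\<^sup>2 * s l) b)"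
  defines "X \<equiv> \<Sum>\<^sub>\<infinity>b. (cdiff (\<lambda>l. w l * s l) b)\<^sup>2" and "Y \<equiv> \<Sum>\<^sub>\<infinity>b. transition w s b"
    and "m \<equiv> \<lambda>b. (w (fst b) + w (dual_end b)) / 2"
  shows "(1 - 3 * d) * X \<le> (1 + 12 * d) * Y + (\<Sum>\<^sub>\<infinity>b. (m b * g b)\<^sup>2) / (2 * d)"
    and "(\<lambda>b. (m b)\<^sup>2 * (cdiff s b)\<^sup>2) summable_on UNIV"
    and "(\<Sum>\<^sub>\<infinity>b. (m b)\<^sup>2 * (cdiff s b)\<^sup>2) \<le> 2 * X + 2 * Y"
proof -
  let ?\<tau> = "\<lambda>l. (w l)\<^sup>2 * s l" let ?\<sigma> = "\<lambda>l. w l * s l"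
  let ?W = "{l. w l \<noteq> 0}"
  have W: "finite ?W" using w(1) by (simp add: finitely_supported_def)
  note N = finite_bond_neighbourhood[OF W]
  have fs: "finitely_supported ?\<sigma>" unfolding finitely_supported_def by (rule finite_subset[OF _ W]) auto
  have outside: "w (fst b) = 0" "w (dual_end b) = 0" if "b \<notin> {b. fst b \<in> ?W \<or> dual_end b \<in> ?W}" for b using that by auto
  have cd: "cdiff t b = (if snd b then - 1 else 1) * (t (fst b) - t (dual_end b))" for t b
    by (auto simp: cdiff_def dual_end_def)
  have sX: "(\<lambda>b. (cdiff ?\<sigma> b)\<^sup>2) summable_on UNIV" by (rule cdiff_sq_summable[OF fs])
  have sY: "transition w s summable_on UNIV" by (rule transition_sum(1)[OF w(1)])
  have cd0: "cdiff ?\<tau> b = 0" "m b = 0" if "b \<notin> {b. fst b \<in> ?W \<or> dual_end b \<in> ?W}" for b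
    using outside[OF that] by (simp_all add: cd m_def)
  have sq: "(\<lambda>b. q b * cdiff ?\<tau> b) summable_on UNIV"
    by (rule summable_finite_support[OF N]) (drule cd0(1), simp only: mult_zero_right)
  have ss: "(\<lambda>b. cdiff s b * cdiff ?\<tau> b) summable_on UNIV"
    by (rule summable_finite_support[OF N]) (drule cd0(1), simp only: mult_zero_right)
  have sg: "(\<lambda>b. (m b * g b)\<^sup>2) summable_on UNIV"
    by (rule summable_finite_support[OF N]) (drule cd0(2), simp only: mult_zero_left power_zero_numeral)
  show sm: "(\<lambda>b. (m b)\<^sup>2 * (cdiff s b)\<^sup>2) summable_on UNIV"
    by (rule summable_finite_support[OF N]) (drule cd0(2), simp only: mult_zero_left power_zero_numeral)
  have E: "(cdiff ?\<sigma> b)\<^sup>2 - transition w s b \<le> cdiff s b * cdiff ?\<tau> b"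
    "q b * cdiff ?\<tau> b \<le> d * (3 * (cdiff ?\<sigma> b)\<^sup>2 + 12 * transition w s b) + (m b * g b)\<^sup>2 / (2 * d)"
    "(m b)\<^sup>2 * (cdiff s b)\<^sup>2 \<le> 2 * (cdiff ?\<sigma> b)\<^sup>2 + 2 * transition w s b" for b
  proof -
    have q': "\<bar>q b\<bar> \<le> g b + d * \<bar>s (fst b) - s (dual_end b)\<bar>" if "w (fst b) \<noteq> 0 \<or> w (dual_end b) \<noteq> 0"
      using q[OF that] by (auto simp: cd abs_minus_commute split: if_splits)
    note we = weighted_edge[OF w(2)[of "fst b"] w(2)[of "dual_end b"] d g[of b] q']
    have cs: "cdiff s b * cdiff ?\<tau> b = (s (fst b) - s (dual_end b)) * (?\<tau> (fst b) - ?\<tau> (dual_end b))" by (auto simp: cd)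
    have qc: "q b * cdiff ?\<tau> b \<le> \<bar>q b * (?\<tau> (fst b) - ?\<tau> (dual_end b))\<bar>"
    proof -
      have "\<bar>q b * cdiff ?\<tau> b\<bar> = \<bar>q b * (?\<tau> (fst b) - ?\<tau> (dual_end b))\<bar>" unfolding cd abs_mult by simp
      then show ?thesis using abs_ge_self[of "q b * cdiff ?\<tau> b"] by linarith
    qed
    show "(cdiff ?\<sigma> b)\<^sup>2 - transition w s b \<le> cdiff s b * cdiff ?\<tau> b"
      using we(1) unfolding cs cdiff_sq transition_def .
    show "q b * cdiff ?\<tau> b \<le> d * (3 * (cdiff ?\<sigma> b)\<^sup>2 + 12 * transition w s b) + (m b * g b)\<^sup>2 / (2 * d)"
      using order_trans[OF qc we(2)] unfolding cdiff_sq transition_def m_def .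
    show "(m b)\<^sup>2 * (cdiff s b)\<^sup>2 \<le> 2 * (cdiff ?\<sigma> b)\<^sup>2 + 2 * transition w s b"
      using we(3) unfolding cdiff_sq transition_def m_def .
  qed
  have "X - Y = (\<Sum>\<^sub>\<infinity>b. (cdiff ?\<sigma> b)\<^sup>2 - transition w s b)"
    unfolding X_def Y_def by (rule infsum_diff_real[OF sX sY, symmetric])
  also have "\<dots> \<le> (\<Sum>\<^sub>\<infinity>b. q b * cdiff ?\<tau> b)"
    unfolding weak by (rule infsum_mono[OF summable_on_diff_real[OF sX sY] ss E(1)])
  also have "\<dots> \<le> (\<Sum>\<^sub>\<infinity>b. (3 * d) * (cdiff ?\<sigma> b)\<^sup>2 + (12 * d) * transition w s b + (1 / (2 * d)) * (m b * g b)\<^sup>2)"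
  proof (rule infsum_mono[OF sq])
    show "(\<lambda>b. (3 * d) * (cdiff ?\<sigma> b)\<^sup>2 + (12 * d) * transition w s b + (1 / (2 * d)) * (m b * g b)\<^sup>2) summable_on UNIV"
      by (intro summable_on_add summable_on_cmult_right sX sY sg)
    show "q b * cdiff ?\<tau> b \<le> (3 * d) * (cdiff ?\<sigma> b)\<^sup>2 + (12 * d) * transition w s b + (1 / (2 * d)) * (m b * g b)\<^sup>2" for b
      using E(2)[of b] by (simp add: algebra_simps)
  qed
  also have "\<dots> = (3 * d) * X + (12 * d) * Y + (1 / (2 * d)) * (\<Sum>\<^sub>\<infinity>b. (m b * g b)\<^sup>2)"
  proof -
    note a = summable_on_cmult_right[OF sX, of "3 * d"] and b = summable_on_cmult_right[OF sY, of "12 * d"]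
      and c = summable_on_cmult_right[OF sg, of "1 / (2 * d)"]
    show ?thesis unfolding infsum_add[OF summable_on_add[OF a b] c] infsum_add[OF a b] infsum_cmult_right' X_def Y_def ..
  qed
  finally show "(1 - 3 * d) * X \<le> (1 + 12 * d) * Y + (\<Sum>\<^sub>\<infinity>b. (m b * g b)\<^sup>2) / (2 * d)"
    by (simp add: algebra_simps)
  have "(\<Sum>\<^sub>\<infinity>b. (m b)\<^sup>2 * (cdiff s b)\<^sup>2) \<le> (\<Sum>\<^sub>\<infinity>b. 2 * (cdiff ?\<sigma> b)\<^sup>2 + 2 * transition w s b)"
    by (rule infsum_mono[OF sm summable_on_add[OF summable_on_cmult_right[OF sX] summable_on_cmult_right[OF sY]] E(3)])
  also have "\<dots> = 2 * X + 2 * Y"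
    unfolding infsum_add[OF summable_on_cmult_right[OF sX, of 2] summable_on_cmult_right[OF sY, of 2]] infsum_cmult_right' X_def Y_def ..
  finally show "(\<Sum>\<^sub>\<infinity>b. (m b)\<^sup>2 * (cdiff s b)\<^sup>2) \<le> 2 * X + 2 * Y" .
qed

section \<open>Decay of stream functions\<close>

definition ssize :: "site \<Rightarrow> real" where
  "ssize l = 1 + \<bar>of_int (fst l)\<bar> + \<bar>of_int (snd l)\<bar>"

lemma ssize_ge1: "1 \<le> ssize l" by (simp add: ssize_def)

lemma norm_dual_pos_le: "norm (dual_pos l) \<le> ssize l - 1"
  using cmod_le[of "dual_pos l"] by (simp add: ssize_def dual_pos_def)

lemma ssize_le: "ssize l \<le> 1 + 2 * norm (dual_pos l)"
  using abs_Re_le_cmod[of "dual_pos l"] abs_Im_le_cmod[of "dual_pos l"] by (simp add: ssize_def dual_pos_def)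

lemma finite_box: "finite {l :: site. \<bar>fst l\<bar> \<le> K \<and> \<bar>snd l\<bar> \<le> K}"
  by (rule finite_subset[of _ "{-K..K} \<times> {-K..K}"]) auto

lemma finite_norm_ball: "finite {l. norm (dual_pos l) \<le> K}"
proof (rule finite_subset[OF _ finite_box])
  show "{l. norm (dual_pos l) \<le> K} \<subseteq> {l. \<bar>fst l\<bar> \<le> \<lceil>K\<rceil> \<and> \<bar>snd l\<bar> \<le> \<lceil>K\<rceil>}"
  proof safe
    fix a b assume n: "norm (dual_pos (a, b)) \<le> K"
    have "\<bar>real_of_int a\<bar> \<le> K" "\<bar>real_of_int b\<bar> \<le> K"
      using n abs_Re_le_cmod[of "dual_pos (a,b)"] abs_Im_le_cmod[of "dual_pos (a,b)"] by (auto simp: dual_pos_def)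
    then show "\<bar>fst (a, b)\<bar> \<le> \<lceil>K\<rceil>" "\<bar>snd (a, b)\<bar> \<le> \<lceil>K\<rceil>" by (simp_all; linarith)+
  qed
qed

lemma infsum_indicator:
  fixes h :: "'i \<Rightarrow> real"
  assumes "finite A"
  shows "(\<lambda>i. if i \<in> A then h i else 0) summable_on UNIV"
    and "(\<Sum>\<^sub>\<infinity>i. if i \<in> A then h i else 0) = sum h A"
proof -
  show "(\<lambda>i. if i \<in> A then h i else 0) summable_on UNIV"
    by (rule summable_finite_support[OF assms]) auto
  have "(\<Sum>\<^sub>\<infinity>i. if i \<in> A then h i else 0) = infsum h A"
    by (rule infsum_cong_neutral) auto
  then show "(\<Sum>\<^sub>\<infinity>i. if i \<in> A then h i else 0) = sum h A" using assms by simp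
qed

definition cutoff :: "real \<Rightarrow> site \<Rightarrow> real" where
  "cutoff M l = max 0 (min 1 (2 - norm (dual_pos l) / M))"

text \<open>The tent, removed near the tip, where the Hardy inequality is not available, and cut off between
  the radii M and 2M, so that test functions are finitely supported.\<close>

definition cut_weight :: "real \<Rightarrow> real \<Rightarrow> real \<Rightarrow> real \<Rightarrow> site \<Rightarrow> real" where
  "cut_weight \<alpha> N R M l = (if R \<le> norm (dual_pos l) then tent \<alpha> N l * cutoff M l else 0)"

lemma cutoff_range: "0 \<le> cutoff M l" "cutoff M l \<le> 1" by (auto simp: cutoff_def)

lemma cutoff_one: "0 < M \<Longrightarrow> norm (dual_pos l) \<le> M \<Longrightarrow> cutoff M l = 1"
  by (simp add: cutoff_def field_simps)

lemma cutoff_zero: "0 < M \<Longrightarrow> 2 * M \<le> norm (dual_pos l) \<Longrightarrow> cutoff M l = 0"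
  by (simp add: cutoff_def field_simps)

lemma cutoff_step: assumes "0 < M" "\<rho> \<in> dirs" shows "\<bar>cutoff M l - cutoff M (l + \<rho>)\<bar> \<le> 1 / M"
proof -
  have "\<bar>norm (dual_pos l) / M - norm (dual_pos (l + \<rho>)) / M\<bar> \<le> 1 / M"
    using dual_pos_dist[OF assms(2), of l] assms(1)
    by (simp add: diff_divide_distrib[symmetric] abs_minus_commute divide_right_mono)
  then show ?thesis unfolding cutoff_def by linarith
qed

lemma tent_pos: "0 < tent \<alpha> N l" by (simp add: tent_def)

lemma tent_le: assumes "0 \<le> \<alpha>" "dual_pos l \<noteq> 0" shows "tent \<alpha> N l \<le> norm (dual_pos l) powr \<alpha>"
  using assms by (simp add: tent_def powr_def mult_left_mono mult.commute)

lemma tent_inner: assumes "1 \<le> norm (dual_pos l)" "norm (dual_pos l) \<le> N" shows "tent \<alpha> N l = norm (dual_pos l) powr \<alpha>"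
proof -
  have "ln (norm (dual_pos l)) \<le> ln N" using assms by (subst ln_le_cancel_iff) auto
  then have "min (ln (norm (dual_pos l))) (2 * ln N - ln (norm (dual_pos l))) = ln (norm (dual_pos l))" by simp
  then show ?thesis using assms by (auto simp: tent_def powr_def)
qed

lemma cut_weight_nonneg: "0 \<le> cut_weight \<alpha> N R M l"
  using tent_pos[of \<alpha> N l] cutoff_range[of M l] by (simp add: cut_weight_def)

lemma cut_weight_le: assumes "0 \<le> \<alpha>" "0 < R" shows "cut_weight \<alpha> N R M l \<le> norm (dual_pos l) powr \<alpha>"
proof (cases "R \<le> norm (dual_pos l)")
  case True
  then have "dual_pos l \<noteq> 0" using assms by auto
  then have "tent \<alpha> N l * cutoff M l \<le> norm (dual_pos l) powr \<alpha> * 1"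
    by (intro mult_mono tent_le cutoff_range assms) auto
  then show ?thesis using True by (simp add: cut_weight_def)
qed (simp add: cut_weight_def)

lemma cut_weight_finite: assumes "0 < M" shows "finitely_supported (cut_weight \<alpha> N R M)"
  unfolding finitely_supported_def
proof (rule finite_subset[OF _ finite_norm_ball[of "2 * M"]])
  show "{l. cut_weight \<alpha> N R M l \<noteq> 0} \<subseteq> {l. norm (dual_pos l) \<le> 2 * M}"
  proof safe
    fix l assume "cut_weight \<alpha> N R M l \<noteq> 0"
    then have "cutoff M l \<noteq> 0" by (auto simp: cut_weight_def split: if_splits)
    then show "norm (dual_pos l) \<le> 2 * M" using cutoff_zero[OF assms, of l] by linarith
  qed
qed

lemma sum_dirs_le:
  assumes "\<And>\<rho>. \<rho> \<in> dirs \<Longrightarrow> \<bar>f \<rho>\<bar> \<le> B"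
  shows "(\<Sum>\<rho>\<in>dirs. (f \<rho> :: real)\<^sup>2) / 2 \<le> 2 * B\<^sup>2"
proof -
  have "(f \<rho>)\<^sup>2 \<le> B\<^sup>2" if "\<rho> \<in> dirs" for \<rho>
    using power_mono[OF assms[OF that], of 2] by simp
  from this[of "(1,0)"] this[of "(0,1)"] this[of "(-1,0)"] this[of "(0,-1)"]
  show ?thesis by (simp add: sum_dirs dirs_def)
qed

text \<open>Where neither truncation acts, the gradient of the weight is that of the tent.\<close>

lemma cut_weight_middle:
  assumes R: "2 < R" "50 / d \<le> R" and d: "0 < d" and l: "R + 1 \<le> norm (dual_pos l)" "norm (dual_pos l) \<le> M - 1" and \<alpha>: "0 \<le> \<alpha>" "\<alpha> \<le> 1/2"
  shows "(\<Sum>\<rho>\<in>dirs. (cut_weight \<alpha> N R M l - cut_weight \<alpha> N R M (l + \<rho>))\<^sup>2) / 2 \<le> (\<alpha>\<^sup>2 + d) / (norm (dual_pos l))\<^sup>2 * (cut_weight \<alpha> N R M l)\<^sup>2"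
proof -
  have w: "cut_weight \<alpha> N R M l' = tent \<alpha> N l'" if "R \<le> norm (dual_pos l')" "norm (dual_pos l') \<le> M" for l'
    using that cutoff_one[of M l'] R by (simp add: cut_weight_def)
  have w1: "cut_weight \<alpha> N R M l = tent \<alpha> N l" using w l by simp
  have w2: "cut_weight \<alpha> N R M (l + \<rho>) = tent \<alpha> N (l + \<rho>)" if "\<rho> \<in> dirs" for \<rho>
    by (rule w) (use dual_pos_dist[OF that, of l] l in linarith)+
  have "(\<Sum>\<rho>\<in>dirs. (cut_weight \<alpha> N R M l - cut_weight \<alpha> N R M (l + \<rho>))\<^sup>2) / 2 = (\<Sum>\<rho>\<in>dirs. (tent \<alpha> N l - tent \<alpha> N (l + \<rho>))\<^sup>2) / 2"
    by (simp add: w1 w2)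
  also have "\<dots> \<le> (\<alpha>\<^sup>2 + 50 / norm (dual_pos l)) / (norm (dual_pos l))\<^sup>2 * (tent \<alpha> N l)\<^sup>2"
    by (rule tent_gradient[OF _ \<alpha>]) (use R l in simp)
  also have "\<dots> \<le> (\<alpha>\<^sup>2 + d) / (norm (dual_pos l))\<^sup>2 * (tent \<alpha> N l)\<^sup>2"
  proof -
    have p: "0 < norm (dual_pos l)" using R l by linarith
    have "50 / d \<le> norm (dual_pos l)" using R l by linarith
    then have "50 / norm (dual_pos l) \<le> d" using d p by (simp add: divide_le_eq mult.commute)
    then show ?thesis by (intro mult_right_mono divide_right_mono) auto
  qed
  finally show ?thesis by (simp add: w1)
qed

text \<open>Around the inner truncation only a bound independent of M and N is needed.\<close>

lemma cut_weight_near: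
  assumes R: "2 < R" and l: "norm (dual_pos l) \<le> R + 1" and \<alpha>: "0 \<le> \<alpha>"
  shows "(\<Sum>\<rho>\<in>dirs. (cut_weight \<alpha> N R M l - cut_weight \<alpha> N R M (l + \<rho>))\<^sup>2) / 2 \<le> 2 * ((R + 2) powr \<alpha>)\<^sup>2"
proof (rule sum_dirs_le)
  fix \<rho> assume "\<rho> \<in> dirs"
  have b: "cut_weight \<alpha> N R M l' \<le> (R + 2) powr \<alpha>" if "norm (dual_pos l') \<le> R + 2" for l'
    using cut_weight_le[OF \<alpha>, of R N M l'] powr_mono2[OF \<alpha> _ that] R by simp
  have "cut_weight \<alpha> N R M l \<le> (R + 2) powr \<alpha>" "cut_weight \<alpha> N R M (l + \<rho>) \<le> (R + 2) powr \<alpha>"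
    using b[of l] b[of "l + \<rho>"] l dual_pos_dist[OF \<open>\<rho> \<in> dirs\<close>, of l] by auto
  then show "\<bar>cut_weight \<alpha> N R M l - cut_weight \<alpha> N R M (l + \<rho>)\<bar> \<le> (R + 2) powr \<alpha>"
    using cut_weight_nonneg[of \<alpha> N R M l] cut_weight_nonneg[of \<alpha> N R M "l + \<rho>"] by linarith
qed

text \<open>T bounds the tent at radius M/2 and beyond; it tends to zero as M grows with N fixed.\<close>

lemma cut_weight_far:
  fixes N :: real
  assumes R: "2 < R" and l: "M - 1 \<le> norm (dual_pos l)" and M: "2 * R + 8 \<le> M" and \<alpha>: "0 \<le> \<alpha>" "\<alpha> \<le> 1/2"
  defines "T \<equiv> exp (\<alpha> * (2 * ln N - ln (M / 2)))"
  shows "(\<Sum>\<rho>\<in>dirs. (cut_weight \<alpha> N R M l - cut_weight \<alpha> N R M (l + \<rho>))\<^sup>2) / 2 \<le> 50 * T\<^sup>2 / M\<^sup>2"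
proof -
  have M0: "0 < M" using R M by simp
  let ?r = "norm (dual_pos l)"
  have r: "M / 2 \<le> ?r" "R + 1 \<le> ?r" "2 < ?r" using l M R by auto
  have "ln (M / 2) \<le> ln ?r" using r M0 by (subst ln_le_cancel_iff) auto
  then have t: "tent \<alpha> N l \<le> T" unfolding tent_def T_def using \<alpha> by (auto intro!: mult_left_mono)
  have "(\<Sum>\<rho>\<in>dirs. (cut_weight \<alpha> N R M l - cut_weight \<alpha> N R M (l + \<rho>))\<^sup>2) / 2 \<le> 2 * (5 * T / M)\<^sup>2"
  proof (rule sum_dirs_le)
    fix \<rho> assume \<rho>: "\<rho> \<in> dirs"
    obtain z where z: "norm z = 1" "dual_pos (l + \<rho>) = dual_pos l + z" using dual_pos_shift[OF \<rho>] by blast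
    have "R \<le> norm (dual_pos (l + \<rho>))" using dual_pos_dist[OF \<rho>, of l] r by linarith
    then have "cut_weight \<alpha> N R M l - cut_weight \<alpha> N R M (l + \<rho>)
       = (tent \<alpha> N l - tent \<alpha> N (l + \<rho>)) * cutoff M (l + \<rho>) + tent \<alpha> N l * (cutoff M l - cutoff M (l + \<rho>))"
      using r by (simp add: cut_weight_def algebra_simps)
    moreover have "\<bar>(tent \<alpha> N l - tent \<alpha> N (l + \<rho>)) * cutoff M (l + \<rho>)\<bar> \<le> T * (4 / M)"
    proof -
      have "\<bar>(tent \<alpha> N l - tent \<alpha> N (l + \<rho>)) * cutoff M (l + \<rho>)\<bar> \<le> \<bar>tent \<alpha> N (l + \<rho>) - tent \<alpha> N l\<bar> * 1"
        unfolding abs_mult using cutoff_range[of M "l + \<rho>"] by (intro mult_mono) auto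
      also have "\<dots> \<le> tent \<alpha> N l * (2 / ?r)" using tent_step(2)[OF r(3) z \<alpha>] by simp
      also have "\<dots> \<le> T * (2 / (M / 2))"
      proof (rule mult_mono[OF t])
        show "2 / ?r \<le> 2 / (M / 2)" by (rule divide_left_mono[OF r(1)]) (use r M0 in \<open>auto intro!: mult_pos_pos\<close>)
      qed (auto simp: T_def)
      finally show ?thesis by simp
    qed
    moreover have "\<bar>tent \<alpha> N l * (cutoff M l - cutoff M (l + \<rho>))\<bar> \<le> T * (1 / M)"
      unfolding abs_mult using t cutoff_step[OF M0 \<rho>, of l] tent_pos[of \<alpha> N l] by (intro mult_mono) (auto simp: T_def)
    ultimately have "\<bar>cut_weight \<alpha> N R M l - cut_weight \<alpha> N R M (l + \<rho>)\<bar> \<le> T * (4 / M) + T * (1 / M)" by linarith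
    then show "\<bar>cut_weight \<alpha> N R M l - cut_weight \<alpha> N R M (l + \<rho>)\<bar> \<le> 5 * T / M" by (simp add: field_simps)
  qed
  then show ?thesis by (simp add: power_divide power_mult_distrib)
qed

lemma cut_weight_outside:
  assumes "0 < M" "2 * M + 1 \<le> norm (dual_pos l)"
  shows "(\<Sum>\<rho>\<in>dirs. (cut_weight \<alpha> N R M l - cut_weight \<alpha> N R M (l + \<rho>))\<^sup>2) / 2 = 0"
proof -
  have "cut_weight \<alpha> N R M l' = 0" if "2 * M \<le> norm (dual_pos l')" for l'
    using cutoff_zero[OF assms(1) that] by (simp add: cut_weight_def)
  moreover have "2 * M \<le> norm (dual_pos (l + \<rho>))" if "\<rho> \<in> dirs" for \<rho>
    using dual_pos_dist[OF that, of l] assms by linarith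
  ultimately show ?thesis using assms by (simp add: sum_dirs dirs_def)
qed

text \<open>The box with half side length at most 3M contains the ball, whence 324 = 36 * 3^2.\<close>

lemma ball_square_sum:
  assumes s0: "\<And>l. l \<in> cracked \<Longrightarrow> s l = 0" and sm: "(\<lambda>b. (cdiff s b)\<^sup>2) summable_on UNIV" and M: "2 \<le> M"
  shows "sum (\<lambda>l. (s l)\<^sup>2) {l. norm (dual_pos l) \<le> 2 * M + 1} \<le> 324 * M\<^sup>2 * (\<Sum>\<^sub>\<infinity>b. (cdiff s b)\<^sup>2)"
proof -
  let ?K = "\<lceil>2 * M + 1\<rceil>" let ?E = "\<Sum>\<^sub>\<infinity>b. (cdiff s b)\<^sup>2"
  have K: "1 \<le> ?K" "0 \<le> real_of_int ?K" "real_of_int ?K \<le> 3 * M" using M by linarith+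
  have "{l. norm (dual_pos l) \<le> 2 * M + 1} \<subseteq> {-?K..?K} \<times> {-?K..?K}"
  proof
    fix l assume "l \<in> {l. norm (dual_pos l) \<le> 2 * M + 1}"
    then have "\<bar>real_of_int (fst l)\<bar> \<le> 2 * M + 1" "\<bar>real_of_int (snd l)\<bar> \<le> 2 * M + 1"
      using abs_Re_le_cmod[of "dual_pos l"] abs_Im_le_cmod[of "dual_pos l"] by (auto simp: dual_pos_def)
    then have "\<bar>fst l\<bar> \<le> ?K" "\<bar>snd l\<bar> \<le> ?K" by linarith+
    then show "l \<in> {-?K..?K} \<times> {-?K..?K}" by (cases l) auto
  qed
  then have "sum (\<lambda>l. (s l)\<^sup>2) {l. norm (dual_pos l) \<le> 2 * M + 1} \<le> sum (\<lambda>l. (s l)\<^sup>2) ({-?K..?K} \<times> {-?K..?K})"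
    by (intro sum_mono2) auto
  also have "\<dots> = (\<Sum>x\<in>{-?K..?K}. \<Sum>y\<in>{-?K..?K}. (s (x, y))\<^sup>2)" by (simp add: sum.cartesian_product)
  also have "\<dots> \<le> 36 * (real_of_int ?K)\<^sup>2 * ?E" by (rule box_estimate[OF s0 sm K(1)])
  also have "\<dots> \<le> 36 * (3 * M)\<^sup>2 * ?E"
    using K by (intro mult_right_mono mult_left_mono power_mono infsum_nonneg) auto
  finally show ?thesis by (simp add: power_mult_distrib)
qed

text \<open>Take k half way between \<alpha> and 1/2; the strict inequality holds at d = 0 and persists for
  small d.\<close>

lemma weight_parameters:
  fixes \<alpha> :: real assumes "0 \<le> \<alpha>" "\<alpha> < 1/2"
  obtains k d where "0 < k" "k < 1/2" "0 < d" "0 < k\<^sup>2 - d" "(1 + 12 * d) * (\<alpha>\<^sup>2 + d) < (1 - 3 * d) * (k\<^sup>2 - d)"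
proof -
  define k where "k = (\<alpha> + 1/2) / 2"
  have k: "0 < k" "k < 1/2" "\<alpha> < k" using assms by (auto simp: k_def)
  have lt: "\<alpha>\<^sup>2 < k\<^sup>2" using k assms by (intro power_strict_mono) auto
  have k4: "k\<^sup>2 \<le> 1/4" using power_mono[of k "1/2" 2] k by (simp add: power2_eq_square)
  define d where "d = (k\<^sup>2 - \<alpha>\<^sup>2) / 16"
  have d: "0 < d" "16 * d = k\<^sup>2 - \<alpha>\<^sup>2" using lt by (auto simp: d_def)
  have d64: "d \<le> 1/64" using k4 d zero_le_power2[of \<alpha>] by linarith
  have "d * \<alpha>\<^sup>2 \<le> d * (1/4)" "d * k\<^sup>2 \<le> d * (1/4)" "d * d \<le> d * (1/64)" using d d64 lt k4 by (intro mult_left_mono; linarith)+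
  moreover have "(1 - 3 * d) * (k\<^sup>2 - d) - (1 + 12 * d) * (\<alpha>\<^sup>2 + d)
      = (k\<^sup>2 - \<alpha>\<^sup>2) - 2 * d - 9 * (d * d) - 3 * (d * k\<^sup>2) - 12 * (d * \<alpha>\<^sup>2)"
    by (simp add: algebra_simps)
  ultimately have "(1 - 3 * d) * (k\<^sup>2 - d) - (1 + 12 * d) * (\<alpha>\<^sup>2 + d) \<ge> (k\<^sup>2 - \<alpha>\<^sup>2) - 7 * d" using d(1) by linarith
  then show ?thesis using that[of k d] k d lt zero_le_power2[of \<alpha>] by linarith
qed

text \<open>In the middle region the transition energy is below (\<alpha>^2 + d) times the Hardy integral.
  Near the tip it is a constant. Far out the gradient of the weight contributes T^2/M^2, while the
  sum of s^2 over the ball of radius 2M grows at most like M^2; as T tends to zero, M can be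
  chosen so that this part is at most 1.\<close>

lemma transition_bound:
  assumes s0: "\<And>l. l \<in> cracked \<Longrightarrow> s l = 0" and sm: "(\<lambda>b. (cdiff s b)\<^sup>2) summable_on UNIV"
    and \<alpha>: "0 < \<alpha>" "\<alpha> \<le> 1/2" and R: "2 < R" "50 / d \<le> R" and d: "0 < d"
  obtains M where "N \<le> M" "0 < M"
    "(\<Sum>\<^sub>\<infinity>b. transition (cut_weight \<alpha> N R M) s b)
       \<le> (\<alpha>\<^sup>2 + d) * (\<Sum>\<^sub>\<infinity>l. (cut_weight \<alpha> N R M l * s l)\<^sup>2 / (norm (dual_pos l))\<^sup>2)
         + 2 * ((R + 2) powr \<alpha>)\<^sup>2 * sum (\<lambda>l. (s l)\<^sup>2) {l. norm (dual_pos l) \<le> R + 1} + 1"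
proof -
  define E where "E = (\<Sum>\<^sub>\<infinity>b. (cdiff s b)\<^sup>2)"
  have E0: "0 \<le> E" by (simp add: E_def infsum_nonneg)
  \<comment> \<open>16200 = 50 * 324 combines the bound for the far gradient with the growth of the sum of
    s^2.\<close>
  define H where "H = 16200 * E + 1"
  have H: "1 \<le> H" using E0 by (simp add: H_def)
  \<comment> \<open>Chosen so large that the tent has fallen to at most H^(-1/2) at radius M/2.\<close>
  define M where "M = max (max N (2 * R + 8)) (2 * exp (2 * ln N + ln H / (2 * \<alpha>)))"
  have M: "N \<le> M" "2 * R + 8 \<le> M" "2 * exp (2 * ln N + ln H / (2 * \<alpha>)) \<le> M" by (auto simp: M_def)
  have M0: "0 < M" "2 \<le> M" using M R by auto
  define T where "T = exp (\<alpha> * (2 * ln N - ln (M / 2)))"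
  have TH: "T\<^sup>2 * H \<le> 1"
  proof -
    have "exp (2 * ln N + ln H / (2 * \<alpha>)) \<le> M / 2" using M by simp
    then have "2 * ln N + ln H / (2 * \<alpha>) \<le> ln (M / 2)" using M0 by (simp add: ln_ge_iff)
    then have "\<alpha> * (2 * ln N - ln (M / 2)) \<le> \<alpha> * (- (ln H / (2 * \<alpha>)))" using \<alpha> by (intro mult_left_mono) auto
    also have "\<dots> = - (ln H / 2)" using \<alpha> by simp
    finally have "2 * (\<alpha> * (2 * ln N - ln (M / 2))) \<le> - ln H" by simp
    then have "exp (2 * (\<alpha> * (2 * ln N - ln (M / 2)))) \<le> exp (- ln H)" by simp
    also have "\<dots> = 1 / H" using H by (simp add: exp_minus divide_inverse)
    finally have "T\<^sup>2 \<le> 1 / H" by (simp add: T_def power2_eq_square exp_add[symmetric])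
    then show ?thesis using H by (simp add: field_simps)
  qed
  let ?w = "cut_weight \<alpha> N R M"
  let ?v = "\<lambda>l. (\<Sum>\<rho>\<in>dirs. (?w l - ?w (l + \<rho>))\<^sup>2) / 2"
  let ?B = "2 * ((R + 2) powr \<alpha>)\<^sup>2" let ?F = "50 * T\<^sup>2 / M\<^sup>2"
  let ?near = "{l. norm (dual_pos l) \<le> R + 1}" let ?all = "{l. norm (dual_pos l) \<le> 2 * M + 1}"
  let ?h1 = "\<lambda>l. (\<alpha>\<^sup>2 + d) * ((?w l * s l)\<^sup>2 / (norm (dual_pos l))\<^sup>2)"
  let ?h2 = "\<lambda>l. if l \<in> ?near then ?B * (s l)\<^sup>2 else 0"
  let ?h3 = "\<lambda>l. if l \<in> ?all then ?F * (s l)\<^sup>2 else 0"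
  have wf: "finitely_supported ?w" by (rule cut_weight_finite[OF M0(1)])
  have W: "finite {l. ?w l \<noteq> 0}" using wf by (simp add: finitely_supported_def)
  have pt: "(s l)\<^sup>2 * ?v l \<le> ?h1 l + ?h2 l + ?h3 l" for l
  proof -
    have h: "0 \<le> ?h1 l" "0 \<le> ?h2 l" "0 \<le> ?h3 l" using d by auto
    consider (near) "norm (dual_pos l) \<le> R + 1" | (mid) "R + 1 \<le> norm (dual_pos l)" "norm (dual_pos l) \<le> M - 1"
      | (far) "M - 1 \<le> norm (dual_pos l)" "norm (dual_pos l) \<le> 2 * M + 1" | (out) "2 * M + 1 \<le> norm (dual_pos l)" by linarith
    then show ?thesis
    proof cases
      case near
      have "(s l)\<^sup>2 * ?v l \<le> (s l)\<^sup>2 * ?B" by (rule mult_left_mono[OF cut_weight_near[OF R(1) near]]) (use \<alpha> in auto)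
      then have "(s l)\<^sup>2 * ?v l \<le> ?h2 l" using near by (simp add: mult.commute)
      then show ?thesis using h by linarith
    next
      case mid
      have "(s l)\<^sup>2 * ?v l \<le> (s l)\<^sup>2 * ((\<alpha>\<^sup>2 + d) / (norm (dual_pos l))\<^sup>2 * (?w l)\<^sup>2)"
        by (rule mult_left_mono[OF cut_weight_middle[OF R d mid]]) (use \<alpha> in auto)
      then have "(s l)\<^sup>2 * ?v l \<le> ?h1 l" by (simp add: power_mult_distrib mult_ac)
      then show ?thesis using h by linarith
    next
      case far
      have "(s l)\<^sup>2 * ?v l \<le> (s l)\<^sup>2 * ?F" unfolding T_def by (rule mult_left_mono[OF cut_weight_far[OF R(1) far(1) M(2)]]) (use \<alpha> in auto)
      then have "(s l)\<^sup>2 * ?v l \<le> ?h3 l" using far by (simp add: mult.commute)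
      then show ?thesis using h by linarith
    next
      case out
      have "?v l = 0" by (rule cut_weight_outside[OF M0(1) out])
      then show ?thesis using h by simp
    qed
  qed
  have s1: "?h1 summable_on UNIV" by (rule summable_finite_support[OF W]) auto
  have s2: "?h2 summable_on UNIV" by (rule infsum_indicator(1)[OF finite_norm_ball])
  have s3: "?h3 summable_on UNIV" by (rule infsum_indicator(1)[OF finite_norm_ball])
  have sv: "(\<lambda>l. (s l)\<^sup>2 * ?v l) summable_on UNIV"
  proof (rule summable_finite_support[OF finite_norm_ball[of "2 * M + 1"]])
    fix l assume "l \<notin> {l. norm (dual_pos l) \<le> 2 * M + 1}"
    then have "?v l = 0" by (intro cut_weight_outside[OF M0(1)]) auto
    then show "(s l)\<^sup>2 * ?v l = 0" by simp
  qed
  have "(\<Sum>\<^sub>\<infinity>b. transition ?w s b) \<le> (\<Sum>\<^sub>\<infinity>l. ?h1 l + ?h2 l + ?h3 l)"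
    unfolding transition_sum(2)[OF wf] by (rule infsum_mono[OF sv summable_on_add[OF summable_on_add[OF s1 s2] s3] pt])
  also have "\<dots> = (\<Sum>\<^sub>\<infinity>l. ?h1 l) + (\<Sum>\<^sub>\<infinity>l. ?h2 l) + (\<Sum>\<^sub>\<infinity>l. ?h3 l)"
    unfolding infsum_add[OF summable_on_add[OF s1 s2] s3] infsum_add[OF s1 s2] ..
  also have "(\<Sum>\<^sub>\<infinity>l. ?h1 l) = (\<alpha>\<^sup>2 + d) * (\<Sum>\<^sub>\<infinity>l. (?w l * s l)\<^sup>2 / (norm (dual_pos l))\<^sup>2)"
    by (rule infsum_cmult_right')
  also have "(\<Sum>\<^sub>\<infinity>l. ?h2 l) = ?B * sum (\<lambda>l. (s l)\<^sup>2) ?near"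
    unfolding infsum_indicator(2)[OF finite_norm_ball] by (simp add: sum_distrib_left)
  also have "(\<Sum>\<^sub>\<infinity>l. ?h3 l) \<le> 1"
  proof -
    have "(\<Sum>\<^sub>\<infinity>l. ?h3 l) = ?F * sum (\<lambda>l. (s l)\<^sup>2) ?all"
      unfolding infsum_indicator(2)[OF finite_norm_ball] by (simp add: sum_distrib_left)
    also have "\<dots> \<le> ?F * (324 * M\<^sup>2 * E)"
      unfolding E_def by (rule mult_left_mono[OF ball_square_sum[OF s0 sm M0(2)]]) auto
    also have "\<dots> = T\<^sup>2 * (16200 * E)" using M0 by simp
    also have "\<dots> \<le> T\<^sup>2 * H" by (rule mult_left_mono) (auto simp: H_def)
    finally show ?thesis using TH by linarith
  qed
  finally show ?thesis by (intro that[of M] M(1) M0(1)) simp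
qed

text \<open>The Hardy inequality turns the transition energy into at most a fraction c < 1 of the energy
  itself plus a constant, and the absorbed estimate has constants independent of the radius N up
  to which the weight is the pure power. Letting N tend to infinity gives the claim.\<close>

theorem stream_decay:
  fixes s :: "site \<Rightarrow> real" and q g :: "bond \<Rightarrow> real"
  assumes s0: "\<And>l. l \<in> cracked \<Longrightarrow> s l = 0" and sm: "l2 (cdiff s)"
    and weak: "\<And>\<tau>. finitely_supported \<tau> \<Longrightarrow> (\<And>l. l \<in> cracked \<Longrightarrow> \<tau> l = 0) \<Longrightarrow>
         (\<Sum>\<^sub>\<infinity>b. q b * cdiff \<tau> b) = (\<Sum>\<^sub>\<infinity>b. cdiff s b * cdiff \<tau> b)"
    and \<alpha>: "0 < \<alpha>" "\<alpha> < 1/2"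
    and g: "\<And>b. 0 \<le> g b" "l2 (\<lambda>b. ssize (fst b) powr \<alpha> * g b)"
    and q: "\<And>d. 0 < d \<Longrightarrow> \<exists>R. \<forall>b. R \<le> norm (dual_pos (fst b)) \<longrightarrow> \<bar>q b\<bar> \<le> g b + d * \<bar>cdiff s b\<bar>"
  shows "l2 (\<lambda>b. ssize (fst b) powr \<alpha> * cdiff s b)"
proof -
  have sm': "(\<lambda>b. (cdiff s b)\<^sup>2) summable_on UNIV" using sm by (simp add: l2_def)
  obtain k d where k: "0 < k" "k < 1/2" and d: "0 < d" "0 < k\<^sup>2 - d" "(1 + 12 * d) * (\<alpha>\<^sup>2 + d) < (1 - 3 * d) * (k\<^sup>2 - d)"
    using weight_parameters[of \<alpha>] \<alpha> by auto
  obtain R1 where R1: "\<And>b. R1 \<le> norm (dual_pos (fst b)) \<Longrightarrow> \<bar>q b\<bar> \<le> g b + d * \<bar>cdiff s b\<bar>" using q[OF d(1)] by blast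
  obtain R2 where R2: "2 < R2"
    "\<And>\<sigma>. finitely_supported \<sigma> \<Longrightarrow> (\<And>l. \<sigma> l \<noteq> 0 \<Longrightarrow> R2 \<le> norm (dual_pos l) \<and> l \<notin> cracked) \<Longrightarrow>
       (k\<^sup>2 - d) * (\<Sum>\<^sub>\<infinity>l. (\<sigma> l)\<^sup>2 / (norm (dual_pos l))\<^sup>2) \<le> (\<Sum>\<^sub>\<infinity>b. (cdiff \<sigma> b)\<^sup>2)"
    using crack_hardy[OF k d(1)] by blast
  define R where "R = max (max (R1 + 1) R2) (max 3 (50 / d))"
  have R: "R1 + 1 \<le> R" "R2 \<le> R" "2 < R" "50 / d \<le> R" by (auto simp: R_def)
  define K0 where "K0 = 2 * ((R + 2) powr \<alpha>)\<^sup>2 * sum (\<lambda>l. (s l)\<^sup>2) {l. norm (dual_pos l) \<le> R + 1} + 1"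
  define G where "G = (\<Sum>\<^sub>\<infinity>b. (ssize (fst b) powr \<alpha> * g b)\<^sup>2)"
  define c where "c = (\<alpha>\<^sup>2 + d) / (k\<^sup>2 - d)"
  \<comment> \<open>What is left of the energy after both absorptions.\<close>
  define \<eta> where "\<eta> = (1 - 3 * d) - (1 + 12 * d) * c"
  have c0: "0 \<le> c" using d by (simp add: c_def)
  have \<eta>: "0 < \<eta>"
  proof -
    have "(1 + 12 * d) * c = ((1 + 12 * d) * (\<alpha>\<^sup>2 + d)) / (k\<^sup>2 - d)" by (simp add: c_def)
    also have "\<dots> < 1 - 3 * d" using d by (simp add: pos_divide_less_eq)
    finally show ?thesis by (simp add: \<eta>_def)
  qed
  have K0: "0 \<le> K0" by (auto simp: K0_def intro!: add_nonneg_nonneg mult_nonneg_nonneg sum_nonneg)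
  have G0: "0 \<le> G" by (simp add: G_def infsum_nonneg)
  define K1 where "K1 = ((1 + 12 * d) * K0 + G / (2 * d)) / \<eta>"
  define K2 where "K2 = 2 * K1 + 2 * (c * K1 + K0)"
  have main: "(\<Sum>b\<in>F. if R \<le> norm (dual_pos (fst b)) then (norm (dual_pos (fst b)) powr \<alpha>)\<^sup>2 * (cdiff s b)\<^sup>2 else 0) \<le> 4 * K2"
    if F: "finite F" for F
  proof -
    \<comment> \<open>The weight has to be the pure power on all of F; the resulting bound does not depend on
      N.\<close>
    define N where "N = Max (insert 1 ((\<lambda>b. norm (dual_pos (fst b))) ` F))"
    have N: "norm (dual_pos (fst b)) \<le> N" if "b \<in> F" for b unfolding N_def using F that by (intro Max_ge) auto
    obtain M where M: "N \<le> M" "0 < M" and Y: "(\<Sum>\<^sub>\<infinity>b. transition (cut_weight \<alpha> N R M) s b)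
       \<le> (\<alpha>\<^sup>2 + d) * (\<Sum>\<^sub>\<infinity>l. (cut_weight \<alpha> N R M l * s l)\<^sup>2 / (norm (dual_pos l))\<^sup>2) + K0"
      using transition_bound[OF s0 sm' \<alpha>(1) _ R(3,4) d(1), of N] \<alpha>(2) unfolding K0_def by (auto simp: add.assoc)
    let ?w = "cut_weight \<alpha> N R M"
    have wf: "finitely_supported ?w" by (rule cut_weight_finite[OF M(2)])
    have W: "finite {l. ?w l \<noteq> 0}" using wf by (simp add: finitely_supported_def)
    have wR: "R \<le> norm (dual_pos l)" if "?w l \<noteq> 0" for l using that by (simp add: cut_weight_def split: if_splits)
    define X where "X = (\<Sum>\<^sub>\<infinity>b. (cdiff (\<lambda>l. ?w l * s l) b)\<^sup>2)"
    define YY where "YY = (\<Sum>\<^sub>\<infinity>b. transition ?w s b)"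
    let ?m = "\<lambda>b. (?w (fst b) + ?w (dual_end b)) / 2"
    have fs\<sigma>: "finitely_supported (\<lambda>l. ?w l * s l)" "finitely_supported (\<lambda>l. (?w l)\<^sup>2 * s l)"
      unfolding finitely_supported_def by (rule finite_subset[OF _ W], auto)+
    have wk: "(\<Sum>\<^sub>\<infinity>b. q b * cdiff (\<lambda>l. (?w l)\<^sup>2 * s l) b) = (\<Sum>\<^sub>\<infinity>b. cdiff s b * cdiff (\<lambda>l. (?w l)\<^sup>2 * s l) b)"
      by (rule weak[OF fs\<sigma>(2)]) (simp add: s0)
    have qb: "\<bar>q b\<bar> \<le> g b + d * \<bar>cdiff s b\<bar>" if "?w (fst b) \<noteq> 0 \<or> ?w (dual_end b) \<noteq> 0" for b
    proof (rule R1)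
      obtain \<rho> where "\<rho> \<in> dirs" "dual_end b = fst b + \<rho>" using dual_end_dir by blast
      then have "\<bar>norm (dual_pos (dual_end b)) - norm (dual_pos (fst b))\<bar> \<le> 1" using dual_pos_dist by metis
      then show "R1 \<le> norm (dual_pos (fst b))" using that wR[of "fst b"] wR[of "dual_end b"] R(1) by linarith
    qed
    have we: "(1 - 3 * d) * X \<le> (1 + 12 * d) * YY + (\<Sum>\<^sub>\<infinity>b. (?m b * g b)\<^sup>2) / (2 * d)"
        "(\<lambda>b. (?m b)\<^sup>2 * (cdiff s b)\<^sup>2) summable_on UNIV"
        "(\<Sum>\<^sub>\<infinity>b. (?m b)\<^sup>2 * (cdiff s b)\<^sup>2) \<le> 2 * X + 2 * YY"
      unfolding X_def YY_def by - (rule weighted_energy(1)[OF wf cut_weight_nonneg d(1) g(1) qb wk], assumption, rule weighted_energy(2)[OF wf cut_weight_nonneg d(1) g(1) qb wk], assumption, rule weighted_energy(3)[OF wf cut_weight_nonneg d(1) g(1) qb wk], assumption)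
    have "(k\<^sup>2 - d) * (\<Sum>\<^sub>\<infinity>l. (?w l * s l)\<^sup>2 / (norm (dual_pos l))\<^sup>2) \<le> X"
      unfolding X_def
    proof (rule R2(2)[OF fs\<sigma>(1)])
      fix l assume n: "?w l * s l \<noteq> 0"
      then have "?w l \<noteq> 0" "s l \<noteq> 0" by auto
      then show "R2 \<le> norm (dual_pos l) \<and> l \<notin> cracked" using wR[of l] s0[of l] R(2) by auto
    qed
    then have "(\<Sum>\<^sub>\<infinity>l. (?w l * s l)\<^sup>2 / (norm (dual_pos l))\<^sup>2) \<le> X / (k\<^sup>2 - d)"
      using d(2) by (simp add: pos_le_divide_eq mult.commute)
    then have "(\<alpha>\<^sup>2 + d) * (\<Sum>\<^sub>\<infinity>l. (?w l * s l)\<^sup>2 / (norm (dual_pos l))\<^sup>2) \<le> (\<alpha>\<^sup>2 + d) * (X / (k\<^sup>2 - d))"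
      using d(1) by (intro mult_left_mono) auto
    then have YX: "YY \<le> c * X + K0" using Y by (simp add: YY_def c_def)
    have mg: "(\<Sum>\<^sub>\<infinity>b. (?m b * g b)\<^sup>2) \<le> G"
      unfolding G_def
    proof (rule infsum_mono)
      show "(\<lambda>b. (?m b * g b)\<^sup>2) summable_on UNIV"
        by (rule summable_finite_support[OF finite_bond_neighbourhood[OF W]]) auto
      show "(\<lambda>b. (ssize (fst b) powr \<alpha> * g b)\<^sup>2) summable_on UNIV" using g(2) by (simp add: l2_def)
      fix b
      obtain \<rho> where "\<rho> \<in> dirs" "dual_end b = fst b + \<rho>" using dual_end_dir by blast
      then have "\<bar>norm (dual_pos (dual_end b)) - norm (dual_pos (fst b))\<bar> \<le> 1" using dual_pos_dist by metis
      then have nn: "norm (dual_pos (dual_end b)) \<le> ssize (fst b)" "norm (dual_pos (fst b)) \<le> ssize (fst b)"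
        using norm_dual_pos_le[of "fst b"] by linarith+
      have "?w l \<le> ssize (fst b) powr \<alpha>" if "norm (dual_pos l) \<le> ssize (fst b)" for l
        using cut_weight_le[of \<alpha> R N M l] powr_mono2[OF _ _ that, of \<alpha>] \<alpha> R by simp
      then have "?w (fst b) \<le> ssize (fst b) powr \<alpha>" "?w (dual_end b) \<le> ssize (fst b) powr \<alpha>" using nn by auto
      then have "?m b \<le> ssize (fst b) powr \<alpha>" by simp
      then show "(?m b * g b)\<^sup>2 \<le> (ssize (fst b) powr \<alpha> * g b)\<^sup>2"
        using g(1)[of b] cut_weight_nonneg[of \<alpha> N R M] by (intro power_mono mult_right_mono) auto
    qed
    have "(1 - 3 * d) * X \<le> (1 + 12 * d) * (c * X + K0) + G / (2 * d)"
    proof -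
      have "(1 + 12 * d) * YY \<le> (1 + 12 * d) * (c * X + K0)" using YX d(1) by (intro mult_left_mono) auto
      moreover have "(\<Sum>\<^sub>\<infinity>b. (?m b * g b)\<^sup>2) / (2 * d) \<le> G / (2 * d)" using mg d(1) by (intro divide_right_mono) auto
      ultimately show ?thesis using we(1) by linarith
    qed
    then have "\<eta> * X \<le> (1 + 12 * d) * K0 + G / (2 * d)" by (simp add: \<eta>_def algebra_simps)
    then have X: "X \<le> K1" unfolding K1_def using \<eta> by (simp add: pos_le_divide_eq mult.commute)
    then have "c * X \<le> c * K1" using c0 by (rule mult_left_mono)
    then have "YY \<le> c * K1 + K0" using YX by (meson add_right_mono order_trans)
    then have "2 * X + 2 * YY \<le> K2" unfolding K2_def using X by (intro add_mono mult_left_mono) auto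
    then have fin: "(\<Sum>\<^sub>\<infinity>b. (?m b)\<^sup>2 * (cdiff s b)\<^sup>2) \<le> K2" by (rule order_trans[OF we(3)])
    have "(\<Sum>b\<in>F. if R \<le> norm (dual_pos (fst b)) then (norm (dual_pos (fst b)) powr \<alpha>)\<^sup>2 * (cdiff s b)\<^sup>2 else 0)
       \<le> (\<Sum>b\<in>F. 4 * ((?m b)\<^sup>2 * (cdiff s b)\<^sup>2))"
    proof (rule sum_mono)
      fix b assume b: "b \<in> F"
      show "(if R \<le> norm (dual_pos (fst b)) then (norm (dual_pos (fst b)) powr \<alpha>)\<^sup>2 * (cdiff s b)\<^sup>2 else 0) \<le> 4 * ((?m b)\<^sup>2 * (cdiff s b)\<^sup>2)"
      proof (cases "R \<le> norm (dual_pos (fst b))")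
        case True
        have "?w (fst b) = norm (dual_pos (fst b)) powr \<alpha>"
          using True tent_inner[of "fst b" N \<alpha>] cutoff_one[OF M(2), of "fst b"] N[OF b] M(1) R by (simp add: cut_weight_def)
        then have "norm (dual_pos (fst b)) powr \<alpha> \<le> 2 * ?m b" using cut_weight_nonneg[of \<alpha> N R M "dual_end b"] by simp
        then have "(norm (dual_pos (fst b)) powr \<alpha>)\<^sup>2 \<le> (2 * ?m b)\<^sup>2" by (intro power_mono) auto
        then have "(norm (dual_pos (fst b)) powr \<alpha>)\<^sup>2 * (cdiff s b)\<^sup>2 \<le> (2 * ?m b)\<^sup>2 * (cdiff s b)\<^sup>2" by (rule mult_right_mono) simp
        also have "(2 * ?m b)\<^sup>2 * (cdiff s b)\<^sup>2 = 4 * ((?m b)\<^sup>2 * (cdiff s b)\<^sup>2)" by (simp only: power_mult_distrib) simp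
        finally show ?thesis using True by simp
      qed simp
    qed
    also have "\<dots> = 4 * (\<Sum>b\<in>F. (?m b)\<^sup>2 * (cdiff s b)\<^sup>2)" by (rule sum_distrib_left[symmetric])
    also have "(\<Sum>b\<in>F. (?m b)\<^sup>2 * (cdiff s b)\<^sup>2) \<le> (\<Sum>\<^sub>\<infinity>b. (?m b)\<^sup>2 * (cdiff s b)\<^sup>2)"
      by (rule finite_sum_le_infsum[OF we(2) F]) auto
    finally show ?thesis using fin by linarith
  qed
  let ?f = "\<lambda>b. if R \<le> norm (dual_pos (fst b)) then (norm (dual_pos (fst b)) powr \<alpha>)\<^sup>2 * (cdiff s b)\<^sup>2 else 0"
  have f: "?f summable_on UNIV" by (rule infsum_bounded_finite(1)[OF _ main]) auto
  let ?A = "{l. norm (dual_pos l) \<le> R} \<times> (UNIV :: bool set)"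
  have A: "finite ?A" using finite_norm_ball by auto
  let ?n = "\<lambda>b. if b \<in> ?A then (ssize (fst b) powr \<alpha> * cdiff s b)\<^sup>2 else 0"
  have n: "?n summable_on UNIV" by (rule infsum_indicator(1)[OF A])
  show ?thesis unfolding l2_def
  proof (rule summable_by_bound)
    show "(\<lambda>b. 9 * ?f b + ?n b) summable_on UNIV" by (intro summable_on_add summable_on_cmult_right f n)
    fix b
    show "\<bar>(ssize (fst b) powr \<alpha> * cdiff s b)\<^sup>2\<bar> \<le> 9 * ?f b + ?n b"
    proof (cases "R \<le> norm (dual_pos (fst b))")
      case False
      then have "b \<in> ?A" by (cases b) auto
      then show ?thesis using False by simp
    next
      case True
      let ?r = "norm (dual_pos (fst b))"
      have "ssize (fst b) \<le> 3 * ?r" using ssize_le[of "fst b"] True R by linarith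
      then have "ssize (fst b) powr \<alpha> \<le> (3 * ?r) powr \<alpha>" using \<alpha> ssize_ge1[of "fst b"] by (intro powr_mono2) auto
      also have "\<dots> = 3 powr \<alpha> * ?r powr \<alpha>" by (simp add: powr_mult)
      also have "\<dots> \<le> 3 * ?r powr \<alpha>" using powr_mono[of \<alpha> 1 3] \<alpha> by (intro mult_right_mono) auto
      finally have "(ssize (fst b) powr \<alpha>)\<^sup>2 \<le> (3 * ?r powr \<alpha>)\<^sup>2" by (intro power_mono) auto
      then have "(ssize (fst b) powr \<alpha>)\<^sup>2 * (cdiff s b)\<^sup>2 \<le> 9 * (?r powr \<alpha>)\<^sup>2 * (cdiff s b)\<^sup>2"
        by (intro mult_right_mono) (auto simp: power_mult_distrib)
      moreover have "0 \<le> ?n b" by simp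
      ultimately show ?thesis using True by (simp add: power_mult_distrib)
    qed
  qed
qed

section \<open>Lattice sums\<close>

lemma summable_int_powr:
  assumes "1 < (p :: real)"
  shows "(\<lambda>k :: int. (1 + \<bar>of_int k\<bar>) powr (- p)) summable_on UNIV"
proof -
  let ?f = "\<lambda>k :: int. (1 + \<bar>of_int k\<bar> :: real) powr (- p)"
  have "summable (\<lambda>n. real (n + 1) powr (- p))"
    using assms by (subst summable_iff_shift) (simp add: summable_real_powr_iff)
  then have "summable (\<lambda>n. ?f (int n))" by (simp add: add.commute)
  then have n: "(\<lambda>n. ?f (int n)) summable_on UNIV" by (intro summable_nonneg_imp_summable_on) auto
  have 1: "?f summable_on range int" using n by (subst summable_on_reindex) (auto simp: inj_on_def o_def)
  have 2: "?f summable_on range (\<lambda>n. - int n)" using n by (subst summable_on_reindex) (auto simp: inj_on_def o_def)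
  have "(UNIV :: int set) = range int \<union> range (\<lambda>n. - int n)"
  proof -
    have "k \<in> range int \<union> range (\<lambda>n. - int n)" for k :: int
      by (cases k rule: int_cases2) auto
    then show ?thesis by auto
  qed
  then show ?thesis using summable_on_union[OF 1 2] by simp
qed

text \<open>The size dominates both 1 + |x| and 1 + |y|, so the lattice sum is bounded by a product of two
  one-dimensional sums with exponent p/2 > 1.\<close>

lemma summable_ssize:
  assumes "2 < (p :: real)"
  shows "(\<lambda>b :: bond. ssize (fst b) powr (- p)) summable_on UNIV"
proof -
  let ?f = "\<lambda>k :: int. (1 + \<bar>of_int k\<bar> :: real) powr (- (p / 2))"
  have f: "?f summable_on UNIV" by (rule summable_int_powr) (use assms in simp)
  have "sum (\<lambda>l. ssize l powr (- p)) F \<le> (infsum ?f UNIV)\<^sup>2" if F: "finite F" for F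
  proof -
    have "sum (\<lambda>l. ssize l powr (- p)) F \<le> (\<Sum>l\<in>fst ` F \<times> snd ` F. ?f (fst l) * ?f (snd l))"
    proof (rule order_trans[OF sum_mono sum_mono2])
      fix l
      have s: "1 + \<bar>of_int (fst l)\<bar> \<le> ssize l" "1 + \<bar>of_int (snd l)\<bar> \<le> ssize l" "0 < ssize l" by (auto simp: ssize_def)
      have "ssize l powr (- p) = ssize l powr (- (p/2)) * ssize l powr (- (p/2))" by (simp add: powr_add[symmetric])
      also have "\<dots> \<le> ?f (fst l) * ?f (snd l)"
        using s assms by (intro mult_mono powr_mono2') auto
      finally show "ssize l powr (- p) \<le> ?f (fst l) * ?f (snd l)" .
    qed (use F subset_fst_snd[of F] in auto)
    also have "\<dots> = sum ?f (fst ` F) * sum ?f (snd ` F)"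
      by (simp add: sum_product sum.cartesian_product case_prod_beta)
    also have "\<dots> \<le> infsum ?f UNIV * infsum ?f UNIV"
      using F f by (intro mult_mono finite_sum_le_infsum sum_nonneg infsum_nonneg) auto
    finally show ?thesis by (simp add: power2_eq_square)
  qed
  from infsum_bounded_finite(1)[OF _ this] have "(\<lambda>l :: site. ssize l powr (- p)) summable_on UNIV" by simp
  then show ?thesis by (simp add: summable_bond_iff)
qed

section \<open>Consistency of the predictor\<close>

text \<open>The harmonic conjugate of the predictor, sampled on the dual lattice. Its rotated gradient is an
  exactly divergence-free approximation of the predictor's strain.\<close>

definition conjugate :: "real \<Rightarrow> site \<Rightarrow> real" where
  "conjugate \<epsilon> l = - \<epsilon> * Re (csqrt (dual_pos l))"

lemma omega2_eq: "omega2 z = Im (csqrt z)"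
proof (cases "z = 0")
  case False
  have "csqrt z = exp (Ln z / 2)" by (rule csqrt_exp_Ln[OF False])
  then have "Im (csqrt z) = exp (ln (cmod z) / 2) * sin (Arg z / 2)"
    using False by (simp add: Im_exp Arg_eq_Im_Ln)
  moreover have "exp (ln (cmod z) / 2) = sqrt (cmod z)"
    using False by (simp add: powr_half_sqrt[symmetric] powr_def)
  ultimately show ?thesis by (simp add: omega2_def)
qed (simp add: omega2_def)

lemma csqrt_sum_ge:
  assumes "0 \<le> Re (csqrt z * cnj (csqrt z'))"
  shows "norm (csqrt z) \<le> norm (csqrt z + csqrt z')"
proof -
  have "(norm (csqrt z + csqrt z'))\<^sup>2 = (norm (csqrt z))\<^sup>2 + (norm (csqrt z'))\<^sup>2 + 2 * Re (csqrt z * cnj (csqrt z'))"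
    unfolding cmod_power2 by (simp add: power2_eq_square algebra_simps)
  then have "(norm (csqrt z))\<^sup>2 \<le> (norm (csqrt z + csqrt z'))\<^sup>2" using assms by simp
  then show ?thesis by (rule power2_le_imp_le) simp
qed

text \<open>From (b - a)(a + b) = b^2 - a^2 the increment of the square root is (z' - z)/(a + b). The
  hypothesis that the two roots enclose at most a right angle excludes cancellation in a + b.\<close>

lemma csqrt_expansion:
  assumes z: "z \<noteq> 0" and c: "0 \<le> Re (csqrt z * cnj (csqrt z'))" and h: "norm (z' - z) \<le> 1"
  shows "norm (csqrt z' - csqrt z) \<le> 1 / norm (csqrt z)"
    and "norm (csqrt z' - csqrt z - (z' - z) / (2 * csqrt z)) \<le> 1 / (2 * norm (csqrt z) ^ 3)"
proof -
  let ?a = "csqrt z" and ?b = "csqrt z'"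
  have a: "0 < norm ?a" using z by simp
  have s: "norm ?a \<le> norm (?a + ?b)" by (rule csqrt_sum_ge[OF c])
  then have s0: "0 < norm (?a + ?b)" using a by linarith
  then have sne: "?a + ?b \<noteq> 0" by auto
  have "(?b - ?a) * (?a + ?b) = ?b\<^sup>2 - ?a\<^sup>2" by (simp add: power2_eq_square algebra_simps)
  then have "(?b - ?a) * (?a + ?b) = z' - z" by simp
  then have e: "?b - ?a = (z' - z) / (?a + ?b)" using sne by (simp add: eq_divide_eq)
  have "norm (?b - ?a) \<le> 1 / norm (?a + ?b)" unfolding e norm_divide using h by (intro divide_right_mono) auto
  also have "\<dots> \<le> 1 / norm ?a" using s a s0 by (intro divide_left_mono) auto
  finally show 1: "norm (?b - ?a) \<le> 1 / norm ?a" .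
  have ane: "?a \<noteq> 0" using a by auto
  have "?b - ?a - (z' - z) / (2 * ?a) = (z' - z) * ((?a - ?b) / (2 * ?a * (?a + ?b)))"
    unfolding e using sne ane by (simp add: field_simps)
  then have "norm (?b - ?a - (z' - z) / (2 * ?a)) = norm (z' - z) * (norm (?a - ?b) / (2 * norm ?a * norm (?a + ?b)))"
    by (simp add: norm_mult norm_divide)
  also have "\<dots> \<le> 1 * ((1 / norm ?a) / (2 * norm ?a * norm ?a))"
    using h 1 s a by (intro mult_mono frac_le) (auto simp: norm_minus_commute)
  also have "\<dots> = 1 / (2 * norm ?a ^ 3)" by (simp add: power3_eq_cube)
  finally show "norm (?b - ?a - (z' - z) / (2 * ?a)) \<le> 1 / (2 * norm ?a ^ 3)" .
qed

lemma csqrt_upper: "0 \<le> Im z \<Longrightarrow> 0 \<le> Im (csqrt z)"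
  by (auto simp: sgn_if complex_Re_le_cmod)

lemma csqrt_Re_nonneg: "0 \<le> Re (csqrt z)"
  using csqrt_principal[of z] by auto

lemma csqrt_aligned_upper:
  assumes "0 \<le> Im z" "0 \<le> Im z'" shows "0 \<le> Re (csqrt z * cnj (csqrt z'))"
  using csqrt_upper[OF assms(1)] csqrt_upper[OF assms(2)] csqrt_Re_nonneg[of z] csqrt_Re_nonneg[of z']
  by (simp del: csqrt.sel)

lemma csqrt_right: assumes "0 \<le> Re z" shows "\<bar>Im (csqrt z)\<bar> \<le> Re (csqrt z)"
proof -
  have "(Re (csqrt z))\<^sup>2 - (Im (csqrt z))\<^sup>2 = Re z"
    using arg_cong[OF power2_csqrt[of z], of Re] by (simp only: Re_power2)
  then have "(Im (csqrt z))\<^sup>2 \<le> (Re (csqrt z))\<^sup>2" using assms by linarith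
  then have "\<bar>Im (csqrt z)\<bar> \<le> \<bar>Re (csqrt z)\<bar>" by (simp only: abs_le_square_iff)
  then show ?thesis using csqrt_Re_nonneg[of z] by simp
qed

lemma csqrt_aligned_right:
  assumes "0 \<le> Re z" "0 \<le> Re z'" shows "0 \<le> Re (csqrt z * cnj (csqrt z'))"
proof -
  have "\<bar>Im (csqrt z)\<bar> * \<bar>Im (csqrt z')\<bar> \<le> Re (csqrt z) * Re (csqrt z')"
    using csqrt_right[OF assms(1)] csqrt_right[OF assms(2)] csqrt_Re_nonneg[of z] by (intro mult_mono) (auto simp del: csqrt.sel)
  then have "\<bar>Im (csqrt z) * Im (csqrt z')\<bar> \<le> Re (csqrt z) * Re (csqrt z')" by (simp only: abs_mult)
  then have "0 \<le> Re (csqrt z) * Re (csqrt z') + Im (csqrt z) * Im (csqrt z')" by linarith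
  then show ?thesis by (simp del: csqrt.sel)
qed

text \<open>By the Cauchy-Riemann equations the linear parts of the increments of the imaginary part along a
  bond and of the real part along the crossing dual edge agree; only the second-order remainders
  survive.\<close>

lemma csqrt_bond:
  assumes z: "z \<noteq> 0" and al: "\<forall>w\<in>{A, P, Q}. 0 \<le> Re (csqrt z * cnj (csqrt w)) \<and> norm (w - z) \<le> 1"
  shows "\<bar>Im (csqrt A) - Im (csqrt z)\<bar> \<le> 1 / norm (csqrt z)"
    and "A - z = 1 \<Longrightarrow> P - Q = \<i> \<Longrightarrow> \<bar>(Im (csqrt A) - Im (csqrt z)) + (Re (csqrt P) - Re (csqrt Q))\<bar> \<le> 2 / norm (csqrt z) ^ 3"
    and "A - z = \<i> \<Longrightarrow> P - Q = 1 \<Longrightarrow> \<bar>(Im (csqrt A) - Im (csqrt z)) - (Re (csqrt P) - Re (csqrt Q))\<bar> \<le> 2 / norm (csqrt z) ^ 3"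
proof -
  define e where "e w = csqrt w - csqrt z - (w - z) / (2 * csqrt z)" for w
  have E: "norm (e w) \<le> 1 / (2 * norm (csqrt z) ^ 3)" if "w \<in> {A, P, Q}" for w
    unfolding e_def using csqrt_expansion(2)[OF z] bspec[OF al that] by blast
  have 0: "0 \<le> 1 / norm (csqrt z) ^ 3" by simp
  have eI: "\<bar>Im (e A)\<bar> + \<bar>Re (e P)\<bar> + \<bar>Re (e Q)\<bar> \<le> 2 / norm (csqrt z) ^ 3"
    using E[of A] E[of P] E[of Q] abs_Im_le_cmod[of "e A"] abs_Re_le_cmod[of "e P"] abs_Re_le_cmod[of "e Q"] 0
    by simp
  have "\<bar>Im (csqrt A - csqrt z)\<bar> \<le> 1 / norm (csqrt z)"
    using csqrt_expansion(1)[OF z, of A] bspec[OF al, of A] abs_Im_le_cmod[of "csqrt A - csqrt z"] by auto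
  then show "\<bar>Im (csqrt A) - Im (csqrt z)\<bar> \<le> 1 / norm (csqrt z)" by (simp del: csqrt.sel)
  have PQ: "csqrt P - csqrt Q = (P - Q) / (2 * csqrt z) + (e P - e Q)"
    by (simp add: e_def diff_divide_distrib)
  have Az: "csqrt A - csqrt z = (A - z) / (2 * csqrt z) + e A" by (simp add: e_def)
  {
    assume h: "A - z = 1" "P - Q = \<i>"
    have "Re (\<i> / (2 * csqrt z)) = - Im (1 / (2 * csqrt z))"
    proof -
      have "\<i> / (2 * csqrt z) = \<i> * (1 / (2 * csqrt z))" by simp
      then show ?thesis by (metis Re_i_times)
    qed
    then have "Im (csqrt A - csqrt z) + Re (csqrt P - csqrt Q) = Im (e A) + (Re (e P) - Re (e Q))"
      unfolding Az PQ h by (simp del: csqrt.sel)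
    then have "(Im (csqrt A) - Im (csqrt z)) + (Re (csqrt P) - Re (csqrt Q)) = Im (e A) + (Re (e P) - Re (e Q))"
      by (simp del: csqrt.sel)
    then show "\<bar>(Im (csqrt A) - Im (csqrt z)) + (Re (csqrt P) - Re (csqrt Q))\<bar> \<le> 2 / norm (csqrt z) ^ 3"
      using eI by linarith
  next
    assume h: "A - z = \<i>" "P - Q = 1"
    have "Im (\<i> / (2 * csqrt z)) = Re (1 / (2 * csqrt z))"
    proof -
      have "\<i> / (2 * csqrt z) = \<i> * (1 / (2 * csqrt z))" by simp
      then show ?thesis by (metis Im_i_times)
    qed
    then have "Im (csqrt A - csqrt z) - Re (csqrt P - csqrt Q) = Im (e A) - (Re (e P) - Re (e Q))"
      unfolding Az PQ h by (simp del: csqrt.sel)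
    then have "(Im (csqrt A) - Im (csqrt z)) - (Re (csqrt P) - Re (csqrt Q)) = Im (e A) - (Re (e P) - Re (e Q))"
      by (simp del: csqrt.sel)
    then show "\<bar>(Im (csqrt A) - Im (csqrt z)) - (Re (csqrt P) - Re (csqrt Q))\<bar> \<le> 2 / norm (csqrt z) ^ 3"
      using eI by linarith
  }
qed

lemma ssize_pos: "ssize l \<le> 5 * norm (pos l)"
proof -
  have c: "\<bar>real_of_int k\<bar> / 2 \<le> \<bar>real_of_int k - 1/2\<bar> \<and> 1/2 \<le> \<bar>real_of_int k - 1/2\<bar>" for k
  proof -
    have "k \<le> 0 \<or> 1 \<le> k" by linarith
    then have "real_of_int k \<le> 0 \<or> 1 \<le> real_of_int k" by auto
    then show ?thesis by (auto simp: abs_if)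
  qed
  have 1: "\<bar>Re (pos l)\<bar> + \<bar>Im (pos l)\<bar> \<le> sqrt 2 * norm (pos l)" by (rule complex_abs_le_norm)
  have 2: "sqrt 2 * norm (pos l) \<le> (3/2) * norm (pos l)"
    by (intro mult_right_mono real_le_lsqrt) (auto simp: power2_eq_square)
  have 3: "2 * ssize l \<le> 6 * (\<bar>Re (pos l)\<bar> + \<bar>Im (pos l)\<bar>)"
    using c[of "fst l"] c[of "snd l"] by (simp add: pos_def ssize_def; linarith)
  show ?thesis using 1 2 3 norm_ge_zero[of "pos l"] by argo
qed

lemma pos_nz: "pos l \<noteq> 0"
  using ssize_pos[of l] ssize_ge1[of l] by auto

text \<open>The two bounds are kept together because they go through the same case distinction on the
  position of the bond relative to the crack.\<close>

definition predictor_estimate :: "real \<Rightarrow> bond \<Rightarrow> bool" where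
  "predictor_estimate \<epsilon> b \<longleftrightarrow> \<bar>bdiff (predictor \<epsilon>) b\<bar> \<le> \<epsilon> * (3 * ssize (fst b) powr (- 1/2)) \<and>
     \<bar>bdiff (predictor \<epsilon>) b - cdiff (conjugate \<epsilon>) b\<bar> \<le> \<epsilon> * (24 * ssize (fst b) powr (- 3/2))"

lemma csqrt_pos_bounds:
  "1 / norm (csqrt (pos l)) \<le> 3 * ssize l powr (- 1/2)"
  "2 / norm (csqrt (pos l)) ^ 3 \<le> 24 * ssize l powr (- 3/2)"
proof -
  let ?S = "ssize l"
  have S: "0 < ?S" using ssize_ge1[of l] by simp
  have n: "norm (csqrt (pos l)) = sqrt (norm (pos l))" by (rule norm_csqrt)
  have "sqrt ?S \<le> sqrt (5 * norm (pos l))" by (intro real_sqrt_le_mono ssize_pos)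
  also have "\<dots> \<le> (9/4) * sqrt (norm (pos l))"
    unfolding real_sqrt_mult by (intro mult_right_mono real_le_lsqrt) (auto simp: power2_eq_square)
  finally have s: "(4/9) * sqrt ?S \<le> norm (csqrt (pos l))" unfolding n by simp
  have p: "0 < (4/9) * sqrt ?S" using S by simp
  have "1 / norm (csqrt (pos l)) \<le> 1 / ((4/9) * sqrt ?S)" by (rule divide_left_mono[OF s]) (use p s in \<open>auto intro!: mult_pos_pos\<close>)
  also have "\<dots> \<le> 3 * (1 / sqrt ?S)" using S by (simp add: field_simps)
  also have "1 / sqrt ?S = ?S powr (- 1/2)" using S by (simp add: powr_minus_divide powr_half_sqrt)
  finally show "1 / norm (csqrt (pos l)) \<le> 3 * ?S powr (- 1/2)" .
  have "((4/9) * sqrt ?S) ^ 3 \<le> norm (csqrt (pos l)) ^ 3" using s p by (intro power_mono) auto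
  then have "2 / norm (csqrt (pos l)) ^ 3 \<le> 2 / ((4/9) * sqrt ?S) ^ 3"
    by (rule divide_left_mono) (use p s in \<open>auto intro!: mult_pos_pos zero_less_power\<close>)
  also have "\<dots> \<le> 24 * (1 / sqrt ?S ^ 3)" using S by (simp add: power_mult_distrib field_simps)
  also have "1 / sqrt ?S ^ 3 = ?S powr (- 3/2)"
  proof -
    have "sqrt ?S ^ 3 = (?S powr (1/2)) powr (real 3)" using S by (simp add: powr_half_sqrt powr_realpow)
    also have "\<dots> = ?S powr (3/2)" by (simp add: powr_powr)
    finally show ?thesis using S by (simp add: powr_minus_divide)
  qed
  finally show "2 / norm (csqrt (pos l)) ^ 3 \<le> 24 * ?S powr (- 3/2)" .
qed

text \<open>The square root is expanded around the base point of the bond; the other three points lie within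
  distance 1 of it, so alignment is the only condition.\<close>

lemma predictor_estimate_aligned:
  assumes \<epsilon>: "0 \<le> \<epsilon>" and nc: "i \<Longrightarrow> l \<notin> cracked"
    and al: "\<And>w. w \<in> {pos (l + (if i then (0,1) else (1,0))), dual_pos l, dual_pos (l - (if i then (1,0) else (0,1)))} \<Longrightarrow>
        0 \<le> Re (csqrt (pos l) * cnj (csqrt w))"
  shows "predictor_estimate \<epsilon> (l, i)"
proof -
  let ?A = "pos (l + (if i then (0,1) else (1,0)))" and ?Q = "dual_pos (l - (if i then (1,0) else (0,1)))"
  have hd: "dual_pos l - pos l = Complex (1/2) (1/2)" by (simp add: dual_pos_def pos_def complex_eq_iff)
  have hq: "?Q - pos l = (if i then Complex (-1/2) (1/2) else Complex (1/2) (-1/2))"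
    by (simp add: dual_pos_def pos_def complex_eq_iff)
  have hA: "?A - pos l = (if i then \<i> else 1)" by (simp add: pos_def complex_eq_iff)
  have PQ: "dual_pos l - ?Q = (if i then 1 else \<i>)" by (simp add: dual_pos_def complex_eq_iff)
  have half: "norm (Complex a b) \<le> 1" if "\<bar>a\<bar> = 1/2" "\<bar>b\<bar> = 1/2" for a b
    using cmod_le[of "Complex a b"] that by simp
  have n: "norm (w - pos l) \<le> 1" if w: "w \<in> {?A, dual_pos l, ?Q}" for w
  proof -
    consider "w = ?A" | "w = dual_pos l" | "w = ?Q" using w by blast
    then show ?thesis
    proof cases
      case 1 then show ?thesis unfolding 1 hA by simp
    next
      case 2 then show ?thesis unfolding 2 hd by (intro half) auto
    next
      case 3 then show ?thesis unfolding 3 hq by (auto intro!: half)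
    qed
  qed
  have al': "\<forall>w\<in>{?A, dual_pos l, ?Q}. 0 \<le> Re (csqrt (pos l) * cnj (csqrt w)) \<and> norm (w - pos l) \<le> 1"
    using al n by blast
  note cb = csqrt_bond[OF pos_nz al']
  \<comment> \<open>At the base point the bond is not severed, so its difference is that of the square root.\<close>
  have b: "bdiff (predictor \<epsilon>) (l, i) = \<epsilon> * (Im (csqrt ?A) - Im (csqrt (pos l)))"
    using nc by (simp add: bdiff_def predictor_def omega2_eq right_diff_distrib del: csqrt.sel)
  have c1: "\<bar>\<epsilon> * x\<bar> \<le> \<epsilon> * y" if "\<bar>x\<bar> \<le> y" for x y using that \<epsilon> by (simp add: abs_mult mult_left_mono)
  have 1: "\<bar>bdiff (predictor \<epsilon>) (l, i)\<bar> \<le> \<epsilon> * (3 * ssize l powr (- 1/2))"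
    unfolding b by (rule c1, rule order_trans[OF cb(1) csqrt_pos_bounds(1)])
  have 2: "\<bar>bdiff (predictor \<epsilon>) (l, i) - cdiff (conjugate \<epsilon>) (l, i)\<bar> \<le> \<epsilon> * (24 * ssize l powr (- 3/2))"
  proof (cases i)
    case True
    have "bdiff (predictor \<epsilon>) (l, i) - cdiff (conjugate \<epsilon>) (l, i)
       = \<epsilon> * ((Im (csqrt ?A) - Im (csqrt (pos l))) - (Re (csqrt (dual_pos l)) - Re (csqrt ?Q)))"
      unfolding b using True by (simp add: cdiff_def conjugate_def algebra_simps del: csqrt.sel)
    moreover have "\<bar>(Im (csqrt ?A) - Im (csqrt (pos l))) - (Re (csqrt (dual_pos l)) - Re (csqrt ?Q))\<bar> \<le> 24 * ssize l powr (- 3/2)"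
      using cb(3) hA PQ True csqrt_pos_bounds(2)[of l] by (simp del: csqrt.sel)
    ultimately show ?thesis using c1 by presburger
  next
    case False
    have "bdiff (predictor \<epsilon>) (l, i) - cdiff (conjugate \<epsilon>) (l, i)
       = \<epsilon> * ((Im (csqrt ?A) - Im (csqrt (pos l))) + (Re (csqrt (dual_pos l)) - Re (csqrt ?Q)))"
      unfolding b using False by (simp add: cdiff_def conjugate_def algebra_simps del: csqrt.sel)
    moreover have "\<bar>(Im (csqrt ?A) - Im (csqrt (pos l))) + (Re (csqrt (dual_pos l)) - Re (csqrt ?Q))\<bar> \<le> 24 * ssize l powr (- 3/2)"
      using cb(2) hA PQ False csqrt_pos_bounds(2)[of l] by (simp del: csqrt.sel)
    ultimately show ?thesis using c1 by presburger
  qed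
  from 1 2 show ?thesis by (simp add: predictor_estimate_def)
qed

lemma predictor_estimate_upper: assumes "0 \<le> \<epsilon>" "1 \<le> snd l" shows "predictor_estimate \<epsilon> (l, i)"
proof (rule predictor_estimate_aligned[OF assms(1)])
  have s: "1 \<le> real_of_int (snd l)" using assms(2) by linarith
  show "l \<notin> cracked" using assms(2) by (auto simp: cracked_def)
  show "0 \<le> Re (csqrt (pos l) * cnj (csqrt w))"
    if "w \<in> {pos (l + (if i then (0,1) else (1,0))), dual_pos l, dual_pos (l - (if i then (1,0) else (0,1)))}" for w
    using that s by (intro csqrt_aligned_upper) (auto simp: pos_def dual_pos_def)
qed

lemma predictor_estimate_ahead: assumes "0 \<le> \<epsilon>" "snd l = 0" "l \<notin> cracked" shows "predictor_estimate \<epsilon> (l, True)"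
proof (rule predictor_estimate_aligned[OF assms(1)])
  have "1 \<le> fst l" using assms by (auto simp: cracked_def)
  then have s: "1 \<le> real_of_int (fst l)" by linarith
  show "l \<notin> cracked" by fact
  show "0 \<le> Re (csqrt (pos l) * cnj (csqrt w))"
    if "w \<in> {pos (l + (if True then (0,1) else (1,0))), dual_pos l, dual_pos (l - (if True then (1,0) else (0,1)))}" for w
    using that s by (intro csqrt_aligned_right) (auto simp: pos_def dual_pos_def)
qed

lemma Re_csqrt_cnj: "Re (csqrt (cnj z)) = Re (csqrt z)" by simp

lemma Im_csqrt_cnj: "Im z \<noteq> 0 \<Longrightarrow> Im (csqrt (cnj z)) = - Im (csqrt z)"
  by (simp add: sgn_if)

lemma predictor_reflect: "predictor \<epsilon> (x, 1 - y) = - predictor \<epsilon> (x, y)"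
proof -
  have "pos (x, 1 - y) = cnj (pos (x, y))" by (simp add: pos_def complex_eq_iff)
  moreover have "y \<le> 0 \<or> 1 \<le> y" by linarith
  then have "real_of_int y \<le> 0 \<or> 1 \<le> real_of_int y" by auto
  then have "Im (pos (x, y)) \<noteq> 0" by (auto simp: pos_def)
  ultimately show ?thesis unfolding predictor_def omega2_eq using Im_csqrt_cnj by simp
qed

lemma conjugate_reflect: "conjugate \<epsilon> (x, - y) = conjugate \<epsilon> (x, y)"
proof -
  have "dual_pos (x, - y) = cnj (dual_pos (x, y))" by (simp add: dual_pos_def complex_eq_iff)
  then show ?thesis unfolding conjugate_def by (simp only: Re_csqrt_cnj)
qed

lemma conjugate_cracked: "l \<in> cracked \<Longrightarrow> conjugate \<epsilon> l = 0"
  by (auto simp: conjugate_def cracked_def dual_pos_def cmod_def)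

text \<open>For bonds above the crack line all points lie in the closed upper half plane, and for the
  upright bonds on the line ahead of the tip in the right half plane; there any two roots are
  aligned. Bonds below are reflections of bonds above, and for severed bonds both quantities
  vanish.\<close>

theorem predictor_consistent: assumes \<epsilon>: "0 \<le> \<epsilon>" shows "predictor_estimate \<epsilon> b"
proof -
  obtain x y i where b: "b = ((x, y), i)" by (metis surj_pair)
  show ?thesis
  proof (cases "1 \<le> y")
    case True then show ?thesis unfolding b by (intro predictor_estimate_upper[OF \<epsilon>]) auto
  next
    case y: False
    show ?thesis
    proof (cases i)
      case False
      then have b': "b = ((x, y), False)" using b by simp
      have u: "predictor_estimate \<epsilon> ((x, 1 - y), False)" by (rule predictor_estimate_upper[OF \<epsilon>]) (use y in simp)
      have "bdiff (predictor \<epsilon>) ((x, 1 - y), False) = - bdiff (predictor \<epsilon>) ((x, y), False)"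
        by (simp add: bdiff_def predictor_reflect)
      moreover have "cdiff (conjugate \<epsilon>) ((x, 1 - y), False) = - cdiff (conjugate \<epsilon>) ((x, y), False)"
        using conjugate_reflect[of \<epsilon> x "y - 1"] by (simp add: cdiff_def conjugate_reflect)
      moreover have "ssize (x, 1 - y) powr (- q) \<le> ssize (x, y) powr (- q)" if "0 \<le> q" for q
        using y ssize_ge1[of "(x, y)"] that by (intro powr_mono2') (auto simp: ssize_def)
      from this[of "1/2"] this[of "3/2"]
      have "\<epsilon> * (3 * ssize (x, 1 - y) powr (- 1/2)) \<le> \<epsilon> * (3 * ssize (x, y) powr (- 1/2))"
        "\<epsilon> * (24 * ssize (x, 1 - y) powr (- 3/2)) \<le> \<epsilon> * (24 * ssize (x, y) powr (- 3/2))"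
        using \<epsilon> by (auto intro!: mult_left_mono)
      ultimately show ?thesis using u unfolding predictor_estimate_def b' by (auto simp: abs_minus_commute)
    next
      case i: True
      then have b': "b = ((x, y), True)" using b by simp
      consider "y \<le> -1" | "y = 0" "(x, y) \<in> cracked" | "y = 0" "(x, y) \<notin> cracked" using y by linarith
      then show ?thesis
      proof cases
        case 1
        have u: "predictor_estimate \<epsilon> ((x, - y), True)" by (rule predictor_estimate_upper[OF \<epsilon>]) (use 1 in simp)
        have "(x, - y) \<notin> cracked" "(x, y) \<notin> cracked" using 1 by (auto simp: cracked_def)
        then have "bdiff (predictor \<epsilon>) ((x, - y), True) = bdiff (predictor \<epsilon>) ((x, y), True)"
          using predictor_reflect[of \<epsilon> x y] predictor_reflect[of \<epsilon> x "y + 1"] by (simp add: bdiff_def add.commute)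
        moreover have "cdiff (conjugate \<epsilon>) ((x, - y), True) = cdiff (conjugate \<epsilon>) ((x, y), True)"
          by (simp add: cdiff_def conjugate_reflect)
        moreover have "ssize (x, - y) = ssize (x, y)" by (simp add: ssize_def)
        ultimately show ?thesis using u unfolding predictor_estimate_def b' by simp
      next
        case 2
        have "(x - 1, y) \<in> cracked" using 2 by (auto simp: cracked_def)
        then show ?thesis using 2 \<epsilon> conjugate_cracked by (simp add: predictor_estimate_def b' bdiff_def cdiff_def)
      next
        case 3 then show ?thesis unfolding b' by (intro predictor_estimate_ahead[OF \<epsilon>]) auto
      qed
    qed
  qed
qed

section \<open>Stream functions\<close>

text \<open>Discrete integration over the whole line, started at 0.\<close>

lemma int_antidifference: "\<exists>S :: int \<Rightarrow> real. S 0 = 0 \<and> (\<forall>k. S k - S (k - 1) = f k)"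
proof -
  define S where "S k = (if 0 \<le> k then \<Sum>j\<in>{0<..k}. f j else - (\<Sum>j\<in>{k<..0}. f j))" for k
  have "S k - S (k - 1) = f k" for k
  proof -
    consider "1 \<le> k" | "k = 0" | "k < 0" by linarith
    then show ?thesis
    proof cases
      case 1
      then have "{0<..k} = insert k {0<..k-1}" by auto
      then show ?thesis using 1 by (simp add: S_def)
    next
      case 2
      have "{-1<..0::int} = {0}" by auto
      then show ?thesis using 2 by (simp add: S_def)
    next
      case 3
      then have "{k-1<..0} = insert k {k<..0}" by auto
      then show ?thesis using 3 by (simp add: S_def)
    qed
  qed
  moreover have "S 0 = 0" by (simp add: S_def)
  ultimately show ?thesis by blast
qed

lemma int_constant:
  fixes e :: "int \<Rightarrow> real"
  assumes "\<And>k. e k = e (k - 1)" shows "e k = e 0"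
proof (induction k rule: int_induct[where k=0])
  case (step1 i) then show ?case using assms[of "i + 1"] by simp
next
  case (step2 i) then show ?case using assms[of i] by simp
qed simp

text \<open>Integrate the flux along the row through the tip and then along every column.
  Divergence-freeness makes the result independent of the row, and the absence of flux through the
  severed bonds makes it constant, hence zero, along the crack.\<close>

theorem stream_function_exists:
  assumes div: "\<And>l. divg p l = 0" and slit: "\<And>l. l \<in> cracked \<Longrightarrow> p (l, True) = 0"
  obtains s where "cdiff s = p" "\<And>l. l \<in> cracked \<Longrightarrow> s l = 0"
proof -
  obtain S where S: "S 0 = 0" "\<And>k. S k - S (k - 1) = - p ((k, 0), True)"
    using int_antidifference[of "\<lambda>k. - p ((k, 0), True)"] by blast
  have "\<exists>T. \<forall>x. T x 0 = 0 \<and> (\<forall>k. T x k - T x (k - 1) = p ((x, k), False))"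
    by (rule choice) (intro allI int_antidifference)
  then obtain T where T: "\<And>x. T x 0 = 0" "\<And>x k. T x k - T x (k - 1) = p ((x, k), False)" by blast
  define s where "s l = S (fst l) + T (fst l) (snd l)" for l
  have F: "cdiff s ((x, y), False) = p ((x, y), False)" for x y
    using T(2)[of x y] by (simp add: cdiff_def s_def)
  have TT: "cdiff s ((x, y), True) = p ((x, y), True)" for x y
  proof -
    \<comment> \<open>The defect of the horizontal dual edges does not depend on the row, because p has no
      divergence.\<close>
    define e where "e y = s (x - 1, y) - s (x, y) - p ((x, y), True)" for y
    have "e y = e (y - 1)" for y
      using T(2)[of x y] T(2)[of "x - 1" y] div[of "(x, y)"] by (simp add: e_def s_def divg_def)
    then have "e y = e 0" by (rule int_constant)
    also have "e 0 = 0" using S(2)[of x] T(1) by (simp add: e_def s_def)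
    finally show ?thesis by (simp add: e_def cdiff_def)
  qed
  have "cdiff s b = p b" for b
  proof -
    obtain x y i where "b = ((x, y), i)" by (metis surj_pair)
    then show ?thesis using F TT by (cases i) auto
  qed
  moreover have "s l = 0" if "l \<in> cracked" for l
  proof -
    have "S k = 0" if "k \<le> 0" for k using that
    proof (induction k rule: int_le_induct)
      case (step i)
      then show ?case using S(2)[of i] slit[of "(i, 0)"] by (simp add: cracked_def)
    qed (rule S(1))
    then show ?thesis using that T(1) by (simp add: s_def cracked_def)
  qed
  ultimately show ?thesis using that[of s] by blast
qed

text \<open>Around every dual vertex off the crack the four bond differences of u add up to zero. The
  severed bonds are crossed by dual edges with both ends on the crack, where \<tau> vanishes, so
  setting their difference to zero has no effect.\<close>

theorem gradients_are_curl_free: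
  assumes \<tau>: "finitely_supported \<tau>" and c: "\<And>l. l \<in> cracked \<Longrightarrow> \<tau> l = 0"
  shows "(\<Sum>\<^sub>\<infinity>b. bdiff u b * cdiff \<tau> b) = 0"
proof -
  let ?X = "\<lambda>l. u (l + (1,0)) - u l" and ?Y = "\<lambda>l. u (l + (0,1)) - u l"
  have S: "finite {l. \<tau> l \<noteq> 0}" using \<tau> by (simp add: finitely_supported_def)
  note fin = cdiff_finite[OF \<tau>]
  have sm: "(\<lambda>b. bdiff u b * cdiff \<tau> b) summable_on UNIV" by (rule summable_finite_support[OF fin]) auto
  have pt: "bdiff u (l, True) * cdiff \<tau> (l, True) = ?Y l * (\<tau> (l - (1,0)) - \<tau> l)" for l
  proof (cases "l \<in> cracked")
    case True
    then have "l - (1,0) \<in> cracked" by (auto simp: cracked_def)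
    then show ?thesis using True c by (simp add: bdiff_def)
  qed (simp add: bdiff_def cdiff_def)
  have t: "(\<lambda>l. h l * \<tau> (l - a)) summable_on UNIV" for h a
    by (rule summable_finite_support[OF finite_shift_img'[OF S, of a]]) auto
  have sh: "(\<Sum>\<^sub>\<infinity>l. h l * \<tau> (l - a)) = (\<Sum>\<^sub>\<infinity>l. h (l + a) * \<tau> l)" for h :: "site \<Rightarrow> real" and a
    using infsum_shift[of "\<lambda>l. h (l + a) * \<tau> l" a] by simp
  have t0: "(\<lambda>l. h l * \<tau> l) summable_on UNIV" for h using t[of h 0] by simp
  have "(\<Sum>\<^sub>\<infinity>b. bdiff u b * cdiff \<tau> b)
     = (\<Sum>\<^sub>\<infinity>l. ((?X l - ?Y l) * \<tau> l - ?X l * \<tau> (l - (0,1))) + ?Y l * \<tau> (l - (1,0)))"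
    unfolding infsum_bond[OF sm] pt by (intro infsum_cong) (simp add: bdiff_def cdiff_def algebra_simps)
  also have "\<dots> = ((\<Sum>\<^sub>\<infinity>l. (?X l - ?Y l) * \<tau> l) - (\<Sum>\<^sub>\<infinity>l. ?X l * \<tau> (l - (0,1)))) + (\<Sum>\<^sub>\<infinity>l. ?Y l * \<tau> (l - (1,0)))"
    using infsum_add[OF summable_on_diff_real[OF t0 t] t, of "\<lambda>l. ?X l - ?Y l" ?X "(0,1)" ?Y "(1,0)"]
      infsum_diff_real[OF t0 t, of "\<lambda>l. ?X l - ?Y l" ?X "(0,1)"] by simp
  also have "\<dots> = ((\<Sum>\<^sub>\<infinity>l. (?X l - ?Y l) * \<tau> l) - (\<Sum>\<^sub>\<infinity>l. ?X (l + (0,1)) * \<tau> l)) + (\<Sum>\<^sub>\<infinity>l. ?Y (l + (1,0)) * \<tau> l)"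
    unfolding sh[of ?X] sh[of ?Y] ..
  also have "\<dots> = (\<Sum>\<^sub>\<infinity>l. ((?X l - ?Y l) * \<tau> l - ?X (l + (0,1)) * \<tau> l) + ?Y (l + (1,0)) * \<tau> l)"
    using infsum_add[OF summable_on_diff_real[OF t0 t0] t0, of "\<lambda>l. ?X l - ?Y l" "\<lambda>l. ?X (l + (0,1))" "\<lambda>l. ?Y (l + (1,0))"]
      infsum_diff_real[OF t0 t0, of "\<lambda>l. ?X l - ?Y l" "\<lambda>l. ?X (l + (0,1))"] by simp
  also have "\<dots> = (\<Sum>\<^sub>\<infinity>l::site. 0)"
    by (intro infsum_cong) (simp add: algebra_simps)
  finally show ?thesis by simp
qed

section \<open>Truncation\<close>

text \<open>The distance from the tip in the maximum norm, plus 1/2. Its balls are boxes symmetric under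
  reflection at the crack line.\<close>

definition rad :: "site \<Rightarrow> int" where
  "rad l = max (max (fst l) (1 - fst l)) (max (snd l) (1 - snd l))"

definition tail_density :: "int \<Rightarrow> (site \<Rightarrow> real) \<Rightarrow> bond \<Rightarrow> real" where
  "tail_density n u b = (if n \<le> rad (fst b) then (bdiff u b)\<^sup>2 else 0)"

definition tail :: "int \<Rightarrow> (site \<Rightarrow> real) \<Rightarrow> real" where
  "tail n u = (\<Sum>\<^sub>\<infinity>b. tail_density n u b)"

lemma tail_density_summable: "l2 (bdiff u) \<Longrightarrow> tail_density n u summable_on UNIV"
  unfolding l2_def by (erule summable_by_bound) (auto simp: tail_density_def)

lemma tail_nonneg: "0 \<le> tail n u"
  by (auto simp: tail_def tail_density_def intro!: infsum_nonneg)

text \<open>Any two points of the rectangle are joined by a horizontal and a vertical segment inside it,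
  none of whose bonds is severed.\<close>

lemma rectangle_poincare:
  assumes u: "l2 (bdiff u)" and side: "B - A < m" "D - C < m" "A \<le> B" "C \<le> D"
    and out: "\<And>l. l \<in> {A..B} \<times> {C..D} \<Longrightarrow> n \<le> rad l"
    and slit: "\<And>x y. A \<le> x \<Longrightarrow> x \<le> B \<Longrightarrow> C \<le> y \<Longrightarrow> y < D \<Longrightarrow> (x, y) \<notin> cracked"
  defines "Q \<equiv> {A..B} \<times> {C..D}"
  shows "(\<Sum>l\<in>Q. \<Sum>l'\<in>Q. (u l - u l')\<^sup>2) \<le> 4 * of_int m ^ 4 * tail n u"
proof -
  define row where "row y = (\<Sum>k\<in>{A..<B}. tail_density n u ((k, y), False))" for y
  define col where "col x = (\<Sum>k\<in>{C..<D}. tail_density n u ((x, k), True))" for x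
  have m: "0 < m" using side by linarith
  have rowc: "0 \<le> row y" "0 \<le> col x" for x y by (auto simp: row_def col_def tail_density_def intro!: sum_nonneg)
  have r: "(u (x, y) - u (x', y))\<^sup>2 \<le> of_int m * row y" if "x \<in> {A..B}" "x' \<in> {A..B}" "y \<in> {C..D}" for x x' y
  proof -
    have "(u (x, y) - u (x', y))\<^sup>2 \<le> of_int (B - A) * (\<Sum>k\<in>{A<..B}. (u (k, y) - u (k - 1, y))\<^sup>2)"
      using path_estimate[of A x' B x "\<lambda>k. u (k, y)"] that by simp
    also have "(\<Sum>k\<in>{A<..B}. (u (k, y) - u (k - 1, y))\<^sup>2) = row y"
      unfolding row_def
    proof (rule sum.reindex_bij_witness[where i="\<lambda>k. k + 1" and j="\<lambda>k. k - 1"])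
      fix k assume "k \<in> {A<..B}"
      then have "n \<le> rad (k - 1, y)" using that by (intro out) auto
      then show "tail_density n u ((k - 1, y), False) = (u (k, y) - u (k - 1, y))\<^sup>2"
        by (simp add: tail_density_def bdiff_def)
    qed auto
    also have "of_int (B - A) * row y \<le> of_int m * row y" using side rowc by (intro mult_right_mono) auto
    finally show ?thesis .
  qed
  have c: "(u (x, y) - u (x, y'))\<^sup>2 \<le> of_int m * col x" if "x \<in> {A..B}" "y \<in> {C..D}" "y' \<in> {C..D}" for x y y'
  proof -
    have "(u (x, y) - u (x, y'))\<^sup>2 \<le> of_int (D - C) * (\<Sum>k\<in>{C<..D}. (u (x, k) - u (x, k - 1))\<^sup>2)"
      using path_estimate[of C y' D y "\<lambda>k. u (x, k)"] that by simp
    also have "(\<Sum>k\<in>{C<..D}. (u (x, k) - u (x, k - 1))\<^sup>2) = col x"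
      unfolding col_def
    proof (rule sum.reindex_bij_witness[where i="\<lambda>k. k + 1" and j="\<lambda>k. k - 1"])
      fix k assume k: "k \<in> {C<..D}"
      have "n \<le> rad (x, k - 1)" using that k by (intro out) auto
      moreover have "(x, k - 1) \<notin> cracked" using that k by (intro slit) auto
      ultimately show "tail_density n u ((x, k - 1), True) = (u (x, k) - u (x, k - 1))\<^sup>2"
        by (simp add: tail_density_def bdiff_def)
    qed auto
    also have "of_int (D - C) * col x \<le> of_int m * col x" using side rowc by (intro mult_right_mono) auto
    finally show ?thesis .
  qed
  have pt: "(u l - u l')\<^sup>2 \<le> 2 * of_int m * row (snd l) + 2 * of_int m * col (fst l')" if "l \<in> Q" "l' \<in> Q" for l l'
  proof -
    obtain x y x' y' where l: "l = (x, y)" "l' = (x', y')" by (metis surj_pair)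
    have "(u (x, y) - u (x', y'))\<^sup>2 \<le> 2 * (u (x, y) - u (x', y))\<^sup>2 + 2 * (u (x', y) - u (x', y'))\<^sup>2"
      using sum_squares_bound[of "u (x, y) - u (x', y)" "u (x', y) - u (x', y')"]
      by (simp add: power2_eq_square algebra_simps)
    then show ?thesis using r[of x x' y] c[of x' y y'] that l unfolding Q_def by auto
  qed
  have T: "tail_density n u summable_on UNIV" by (rule tail_density_summable[OF u])
  have T0: "0 \<le> tail_density n u b" for b by (simp add: tail_density_def)
  have R: "(\<Sum>y\<in>{C..D}. row y) \<le> tail n u"
    unfolding row_def tail_def by (subst sum.swap) (rule bond_rectangle_le[OF T T0], auto)
  have Co: "(\<Sum>x\<in>{A..B}. col x) \<le> tail n u"
    unfolding col_def tail_def by (rule bond_rectangle_le[OF T T0], auto)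
  have cA: "real (card {A..B}) \<le> of_int m" "real (card {C..D}) \<le> of_int m" using side by auto
  have cQ: "real (card Q) \<le> of_int m * of_int m"
    unfolding Q_def card_cartesian_product of_nat_mult using cA m by (intro mult_mono) auto
  have sR: "(\<Sum>l\<in>Q. row (snd l)) \<le> of_int m * tail n u"
  proof -
    have "(\<Sum>l\<in>Q. row (snd l)) = (\<Sum>x\<in>{A..B}. \<Sum>y\<in>{C..D}. row y)"
      unfolding Q_def by (subst sum.cartesian_product) (simp add: case_prod_beta)
    also have "\<dots> = real (card {A..B}) * (\<Sum>y\<in>{C..D}. row y)" by simp
    also have "\<dots> \<le> of_int m * tail n u" using cA R m rowc by (intro mult_mono sum_nonneg) auto
    finally show ?thesis .
  qed
  have sC: "(\<Sum>l\<in>Q. col (fst l)) \<le> of_int m * tail n u"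
  proof -
    have "(\<Sum>l\<in>Q. col (fst l)) = (\<Sum>x\<in>{A..B}. \<Sum>y\<in>{C..D}. col x)"
      unfolding Q_def by (subst sum.cartesian_product) (simp add: case_prod_beta)
    also have "\<dots> = real (card {C..D}) * (\<Sum>x\<in>{A..B}. col x)" by (simp add: sum_distrib_left)
    also have "\<dots> \<le> of_int m * tail n u" using cA Co m rowc by (intro mult_mono sum_nonneg) auto
    finally show ?thesis .
  qed
  have "(\<Sum>l\<in>Q. \<Sum>l'\<in>Q. (u l - u l')\<^sup>2) \<le> (\<Sum>l\<in>Q. \<Sum>l'\<in>Q. 2 * of_int m * row (snd l) + 2 * of_int m * col (fst l'))"
    by (intro sum_mono pt)
  also have "\<dots> = real (card Q) * (2 * of_int m) * (\<Sum>l\<in>Q. row (snd l)) + real (card Q) * (2 * of_int m) * (\<Sum>l\<in>Q. col (fst l))"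
    by (simp add: sum.distrib sum_distrib_left sum_distrib_right mult_ac)
  also have "\<dots> \<le> (of_int m * of_int m) * (2 * of_int m) * (of_int m * tail n u) + (of_int m * of_int m) * (2 * of_int m) * (of_int m * tail n u)"
    using cQ sR sC m rowc tail_nonneg[of n u] by (intro add_mono mult_mono sum_nonneg mult_nonneg_nonneg) auto
  also have "\<dots> = 4 * of_int m ^ 4 * tail n u" by (simp add: eval_nat_numeral)
  finally show ?thesis .
qed

text \<open>Closeness to c in mean square passes from A to B through the overlap D: compare every point of B
  with all points of D.\<close>

lemma chain_step:
  fixes u :: "'i \<Rightarrow> real"
  assumes fin: "finite A" "finite B" and D: "D \<subseteq> A" "D \<subseteq> B" and N: "0 < N" "N \<le> real (card D)" "real (card B) \<le> 4 * N"
    and pB: "(\<Sum>p\<in>B. \<Sum>q\<in>B. (u p - u q)\<^sup>2) \<le> 1024 * N\<^sup>2 * T"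
    and sA: "(\<Sum>q\<in>A. (u q - c)\<^sup>2) \<le> K * N * T" and T: "0 \<le> T"
  shows "(\<Sum>p\<in>B. (u p - c)\<^sup>2) \<le> (2048 + 8 * K) * N * T"
proof -
  have "N * (\<Sum>p\<in>B. (u p - c)\<^sup>2) \<le> real (card D) * (\<Sum>p\<in>B. (u p - c)\<^sup>2)"
    using N by (intro mult_right_mono sum_nonneg) auto
  also have "\<dots> = (\<Sum>p\<in>B. \<Sum>q\<in>D. (u p - c)\<^sup>2)" by (simp add: sum_distrib_left)
  also have "\<dots> \<le> (\<Sum>p\<in>B. \<Sum>q\<in>D. 2 * (u p - u q)\<^sup>2 + 2 * (u q - c)\<^sup>2)"
  proof (intro sum_mono)
    show "(u p - c)\<^sup>2 \<le> 2 * (u p - u q)\<^sup>2 + 2 * (u q - c)\<^sup>2" for p q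
      using sum_squares_bound[of "u p - u q" "u q - c"] by (simp add: power2_eq_square algebra_simps)
  qed
  also have "\<dots> = 2 * (\<Sum>p\<in>B. \<Sum>q\<in>D. (u p - u q)\<^sup>2) + 2 * (real (card B) * (\<Sum>q\<in>D. (u q - c)\<^sup>2))"
    by (simp add: sum.distrib sum_distrib_left mult_ac)
  also have "\<dots> \<le> 2 * (1024 * N\<^sup>2 * T) + 2 * ((4 * N) * (K * N * T))"
  proof (intro add_mono mult_left_mono)
    have "(\<Sum>p\<in>B. \<Sum>q\<in>D. (u p - u q)\<^sup>2) \<le> (\<Sum>p\<in>B. \<Sum>q\<in>B. (u p - u q)\<^sup>2)"
      by (intro sum_mono sum_mono2 fin D) auto
    then show "(\<Sum>p\<in>B. \<Sum>q\<in>D. (u p - u q)\<^sup>2) \<le> 1024 * N\<^sup>2 * T" using pB by linarith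
    have "(\<Sum>q\<in>D. (u q - c)\<^sup>2) \<le> (\<Sum>q\<in>A. (u q - c)\<^sup>2)" by (intro sum_mono2 fin D) auto
    then have "(\<Sum>q\<in>D. (u q - c)\<^sup>2) \<le> K * N * T" using sA by linarith
    then show "real (card B) * (\<Sum>q\<in>D. (u q - c)\<^sup>2) \<le> (4 * N) * (K * N * T)"
      using N by (intro mult_mono sum_nonneg) auto
  qed auto
  also have "\<dots> = N * ((2048 + 8 * K) * N * T)" by (simp add: power2_eq_square algebra_simps)
  finally show ?thesis using N by simp
qed

lemma averaging:
  fixes u :: "'i \<Rightarrow> real"
  assumes A: "finite A" "A \<noteq> {}" and p: "(\<Sum>p\<in>A. \<Sum>q\<in>A. (u p - u q)\<^sup>2) \<le> real (card A) * K"
  obtains c where "(\<Sum>q\<in>A. (u q - c)\<^sup>2) \<le> K"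
proof (rule ccontr)
  assume no: "\<not> thesis"
  have "K < (\<Sum>q\<in>A. (u p - u q)\<^sup>2)" for p
  proof (rule ccontr)
    assume "\<not> ?thesis"
    then have "(\<Sum>q\<in>A. (u q - u p)\<^sup>2) \<le> K" by (simp add: power2_commute)
    then show False using no that by blast
  qed
  then have "(\<Sum>p\<in>A. K) < (\<Sum>p\<in>A. \<Sum>q\<in>A. (u p - u q)\<^sup>2)" by (intro sum_strict_mono A)
  then show False using p by simp
qed

text \<open>The slit annulus is covered by five overlapping rectangles that do not cross the crack: one to
  the right of the tip, one above and one below, and two at the left, on either side of the crack.
  A constant close to u on the right rectangle stays close above and below, and from there to the
  left.\<close>

lemma annulus_poincare:
  assumes u: "l2 (bdiff u)" and n: "1 \<le> n"
  obtains c where "(\<Sum>l\<in>{l. n < rad l \<and> rad l \<le> 2 * n}. (u l - c)\<^sup>2) \<le> 80000 * (of_int n)\<^sup>2 * tail n u"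
proof -
  let ?N = "(of_int n :: real)\<^sup>2" let ?T = "tail n u"
  have N0: "0 < ?N" using n by simp
  have T0: "0 \<le> ?T" by (rule tail_nonneg)
  let ?R = "{n+1..2*n} \<times> {1-2*n..2*n}" let ?U = "{1-2*n..2*n} \<times> {n+1..2*n}"
  let ?V = "{1-2*n..-n} \<times> {1..2*n}" let ?D = "{1-2*n..2*n} \<times> {1-2*n..-n}" let ?W = "{1-2*n..-n} \<times> {1-2*n..0}"
  have P: "(\<Sum>l\<in>Q. \<Sum>l'\<in>Q. (u l - u l')\<^sup>2) \<le> 1024 * ?N\<^sup>2 * ?T"
    if "(\<Sum>l\<in>Q. \<Sum>l'\<in>Q. (u l - u l')\<^sup>2) \<le> 4 * of_int (4 * n) ^ 4 * ?T" for Q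
    using that by (simp add: power_mult_distrib power_mult[symmetric])
  \<comment> \<open>All sides are shorter than 4n, and 1024 = 4 * 4^4.\<close>
  have pR: "(\<Sum>l\<in>?R. \<Sum>l'\<in>?R. (u l - u l')\<^sup>2) \<le> 1024 * ?N\<^sup>2 * ?T"
    by (rule P, rule rectangle_poincare[OF u]) (use n in \<open>auto simp: rad_def cracked_def\<close>)
  have pU: "(\<Sum>l\<in>?U. \<Sum>l'\<in>?U. (u l - u l')\<^sup>2) \<le> 1024 * ?N\<^sup>2 * ?T"
    by (rule P, rule rectangle_poincare[OF u]) (use n in \<open>auto simp: rad_def cracked_def\<close>)
  have pV: "(\<Sum>l\<in>?V. \<Sum>l'\<in>?V. (u l - u l')\<^sup>2) \<le> 1024 * ?N\<^sup>2 * ?T"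
    by (rule P, rule rectangle_poincare[OF u]) (use n in \<open>auto simp: rad_def cracked_def\<close>)
  have pD: "(\<Sum>l\<in>?D. \<Sum>l'\<in>?D. (u l - u l')\<^sup>2) \<le> 1024 * ?N\<^sup>2 * ?T"
    by (rule P, rule rectangle_poincare[OF u]) (use n in \<open>auto simp: rad_def cracked_def\<close>)
  have pW: "(\<Sum>l\<in>?W. \<Sum>l'\<in>?W. (u l - u l')\<^sup>2) \<le> 1024 * ?N\<^sup>2 * ?T"
    by (rule P, rule rectangle_poincare[OF u]) (use n in \<open>auto simp: rad_def cracked_def\<close>)
  have cR: "real (card ?R) = 4 * ?N" using n by (simp add: card_cartesian_product power2_eq_square)
  have cB: "real (card ?U) \<le> 4 * ?N" "real (card ?V) \<le> 4 * ?N" "real (card ?D) \<le> 4 * ?N" "real (card ?W) \<le> 4 * ?N"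
    using n by (auto simp: card_cartesian_product power2_eq_square)
  obtain c where c: "(\<Sum>q\<in>?R. (u q - c)\<^sup>2) \<le> 256 * ?N * ?T"
  proof (rule averaging[of ?R u "256 * ?N * ?T"])
    show "(\<Sum>p\<in>?R. \<Sum>q\<in>?R. (u p - u q)\<^sup>2) \<le> real (card ?R) * (256 * ?N * ?T)"
    proof -
      have "real (card ?R) * (256 * ?N * ?T) = 1024 * ?N\<^sup>2 * ?T" unfolding cR by (simp add: power2_eq_square)
      then show ?thesis using pR by (simp only:)
    qed
  qed (use n in auto)
  have sub: "finite ({a..b} \<times> {c..d})" for a b c d :: int by auto
  have cI: "?N \<le> real (card ({n+1..2*n} \<times> {n+1..2*n}))" "?N \<le> real (card ({1-2*n..-n} \<times> {n+1..2*n}))"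
     "?N \<le> real (card ({n+1..2*n} \<times> {1-2*n..-n}))" "?N \<le> real (card ({1-2*n..-n} \<times> {1-2*n..-n}))"
    using n by (auto simp: card_cartesian_product power2_eq_square)
  have sU: "(\<Sum>q\<in>?U. (u q - c)\<^sup>2) \<le> (2048 + 8 * 256) * ?N * ?T"
    by (rule chain_step[OF sub sub _ _ N0 cI(1) cB(1) pU c T0]) (use n in auto)
  have sD: "(\<Sum>q\<in>?D. (u q - c)\<^sup>2) \<le> (2048 + 8 * 256) * ?N * ?T"
    by (rule chain_step[OF sub sub _ _ N0 cI(3) cB(3) pD c T0]) (use n in auto)
  have sV: "(\<Sum>q\<in>?V. (u q - c)\<^sup>2) \<le> (2048 + 8 * (2048 + 8 * 256)) * ?N * ?T"
    by (rule chain_step[OF sub sub _ _ N0 cI(2) cB(2) pV sU T0]) (use n in auto)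
  have sW: "(\<Sum>q\<in>?W. (u q - c)\<^sup>2) \<le> (2048 + 8 * (2048 + 8 * 256)) * ?N * ?T"
    by (rule chain_step[OF sub sub _ _ N0 cI(4) cB(4) pW sD T0]) (use n in auto)
  let ?f = "\<lambda>l. (u l - c)\<^sup>2"
  have un: "sum ?f (X \<union> Y) \<le> sum ?f X + sum ?f Y" if "finite X" "finite Y" for X Y
  proof -
    have "0 \<le> sum ?f (X \<inter> Y)" by (rule sum_nonneg) simp
    then show ?thesis using sum.union_inter[OF that, of ?f] by linarith
  qed
  have "{l. n < rad l \<and> rad l \<le> 2 * n} \<subseteq> ?R \<union> (?U \<union> (?D \<union> (?V \<union> ?W)))"
  proof
    fix l assume "l \<in> {l. n < rad l \<and> rad l \<le> 2 * n}"
    then have l: "n < rad l" "rad l \<le> 2 * n" by auto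
    then have b: "fst l \<le> 2 * n" "1 - 2 * n \<le> fst l" "snd l \<le> 2 * n" "1 - 2 * n \<le> snd l" by (auto simp: rad_def)
    have "n < fst l \<or> n < 1 - fst l \<or> n < snd l \<or> n < 1 - snd l" using l(1) unfolding rad_def by linarith
    then show "l \<in> ?R \<union> (?U \<union> (?D \<union> (?V \<union> ?W)))" using b by (cases l) auto
  qed
  then have "sum ?f {l. n < rad l \<and> rad l \<le> 2 * n} \<le> sum ?f (?R \<union> (?U \<union> (?D \<union> (?V \<union> ?W))))"
    by (intro sum_mono2) auto
  also have "\<dots> \<le> sum ?f ?R + (sum ?f ?U + (sum ?f ?D + (sum ?f ?V + sum ?f ?W)))"
    by (intro order_trans[OF un] add_left_mono) auto
  also have "\<dots> \<le> 80000 * ?N * ?T"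
  proof -
    have "0 \<le> ?N * ?T" using N0 T0 by simp
    moreover have "x1 + (x2 + (x3 + (x4 + x5))) \<le> 80000 * q"
      if "0 \<le> q" "x1 \<le> 256 * q" "x2 \<le> (2048 + 8 * 256) * q" "x3 \<le> (2048 + 8 * 256) * q"
        "x4 \<le> (2048 + 8 * (2048 + 8 * 256)) * q" "x5 \<le> (2048 + 8 * (2048 + 8 * 256)) * q"
      for x1 x2 x3 x4 x5 q :: real using that by simp
    ultimately show ?thesis using c sU sD sV sW unfolding mult.assoc by blast
  qed
  finally show ?thesis by (rule that)
qed

definition bond_end :: "bond \<Rightarrow> site" where
  "bond_end b = fst b + (if snd b then (0,1) else (1,0))"

lemma rad_bond_end: "\<bar>rad (bond_end b) - rad (fst b)\<bar> \<le> 1"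
  by (cases b; cases "fst b"; cases "snd b") (simp_all add: rad_def bond_end_def max_def abs_if)

lemma finite_rad: "finite {l. rad l \<le> n}"
  by (rule finite_subset[of _ "{1-n..n} \<times> {1-n..n}"]) (auto simp: rad_def)

lemma infsum_bond_ends:
  fixes h :: "site \<Rightarrow> real"
  assumes "h summable_on UNIV"
  shows "((\<lambda>b. h (fst b) + h (bond_end b)) has_sum 4 * (\<Sum>\<^sub>\<infinity>l. h l)) UNIV"
proof -
  let ?H = "\<Sum>\<^sub>\<infinity>l. h l"
  have a: "(h has_sum ?H) UNIV" using assms by simp
  have b: "((\<lambda>l. h (l + c)) has_sum ?H) UNIV" for c
    using has_sum_shift[of h "- c" ?H] a by simp
  have "((\<lambda>b. h (fst b) + h (bond_end b)) has_sum ((?H + ?H) + (?H + ?H))) UNIV"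
    by (rule has_sum_bond; simp only: bond_end_def fst_conv snd_conv if_True if_False; rule has_sum_add[OF a b])
  then show ?thesis by simp
qed

text \<open>Multiplying u - c by a cutoff that falls linearly from 1 to 0 on an annulus produces, besides
  the gradient outside the radius n, the term (u - c)^2/n^2 on the annulus, which the Poincare
  inequality turns into gradient energy again. The constants add up to 640002 = 2 + 8 * 80000.\<close>

theorem truncation:
  assumes u: "l2 (bdiff u)" and n: "1 \<le> n"
  obtains v where "\<And>l. 2 * n \<le> rad l \<Longrightarrow> v l = 0" "l2 (bdiff (\<lambda>l. v l - u l))"
    "(l2norm (bdiff (\<lambda>l. v l - u l)))\<^sup>2 \<le> 640002 * tail n u"
proof -
  let ?Ann = "{l. n < rad l \<and> rad l \<le> 2 * n}"
  obtain c where c: "(\<Sum>l\<in>?Ann. (u l - c)\<^sup>2) \<le> 80000 * (of_int n)\<^sup>2 * tail n u"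
    by (rule annulus_poincare[OF u n])
  define \<theta> where "\<theta> l = max 0 (min 1 (of_int (rad l) / of_int n - 1 :: real))" for l
  define v where "v l = (1 - \<theta> l) * (u l - c)" for l
  define ann where "ann l = (if l \<in> ?Ann then (u l - c)\<^sup>2 else 0)" for l
  have n0: "0 < real_of_int n" using n by simp
  have \<theta>0: "\<theta> l = 0" if "rad l \<le> n" for l
  proof -
    have "real_of_int (rad l) \<le> real_of_int n" using that by linarith
    then have "real_of_int (rad l) / real_of_int n \<le> 1" using n0 by (simp add: divide_le_eq)
    then show ?thesis by (simp add: \<theta>_def)
  qed
  have \<theta>1: "\<theta> l = 1" if "2 * n \<le> rad l" for l
  proof -
    have "2 * real_of_int n \<le> real_of_int (rad l)" using that by linarith
    then have "2 \<le> real_of_int (rad l) / real_of_int n" using n0 by (simp add: le_divide_eq)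
    then show ?thesis by (simp add: \<theta>_def)
  qed
  have \<theta>r: "0 \<le> \<theta> l" "\<theta> l \<le> 1" for l by (auto simp: \<theta>_def)
  have \<theta>s: "\<bar>\<theta> (bond_end b) - \<theta> (fst b)\<bar> \<le> 1 / of_int n" for b
  proof -
    have "\<bar>real_of_int (rad (bond_end b)) - real_of_int (rad (fst b))\<bar> \<le> 1" using rad_bond_end[of b] by linarith
    then have "\<bar>of_int (rad (bond_end b)) / of_int n - of_int (rad (fst b)) / of_int n\<bar> \<le> 1 / real_of_int n"
      using n0 by (simp add: diff_divide_distrib[symmetric] divide_right_mono)
    then show ?thesis unfolding \<theta>_def by linarith
  qed
  have ann0: "0 \<le> ann l" for l by (simp add: ann_def)
  have fA: "finite ?Ann" by (rule finite_subset[OF _ finite_rad[of "2 * n"]]) auto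
  have s_ann: "ann summable_on UNIV" and i_ann: "(\<Sum>\<^sub>\<infinity>l. ann l) = (\<Sum>l\<in>?Ann. (u l - c)\<^sup>2)"
    unfolding ann_def by (rule infsum_indicator[OF fA])+
  have pt: "(bdiff (\<lambda>l. v l - u l) b)\<^sup>2 \<le> 2 * tail_density n u b + 2 / (of_int n)\<^sup>2 * (ann (fst b) + ann (bond_end b))" for b
  proof (cases "snd b \<and> fst b \<in> cracked")
    case True
    then have "bdiff (\<lambda>l. v l - u l) b = 0" by (simp add: bdiff_def)
    moreover have "0 \<le> tail_density n u b" by (simp add: tail_density_def)
    ultimately show ?thesis using ann0[of "fst b"] ann0[of "bond_end b"] by simp
  next
    case False
    let ?l = "fst b" and ?k = "bond_end b"
    have bd: "bdiff w b = w ?k - w ?l" for w using False by (auto simp: bdiff_def bond_end_def)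
    define du where "du = u ?k - u ?l"
    \<comment> \<open>The product rule with the factor u - c taken at either end, so that it can be taken at
      an end in the annulus.\<close>
    have e1: "bdiff (\<lambda>l. v l - u l) b = - (\<theta> ?k * du + (\<theta> ?k - \<theta> ?l) * (u ?l - c))"
      unfolding bd v_def du_def by (simp add: algebra_simps)
    have e2: "bdiff (\<lambda>l. v l - u l) b = - (\<theta> ?l * du + (\<theta> ?k - \<theta> ?l) * (u ?k - c))"
      unfolding bd v_def du_def by (simp add: algebra_simps)
    have sq: "(- (t * du + e * w))\<^sup>2 \<le> 2 * du\<^sup>2 + 2 / (of_int n)\<^sup>2 * w\<^sup>2"
      if t: "0 \<le> t" "t \<le> 1" and e: "\<bar>e\<bar> \<le> 1 / of_int n" for t e w
    proof -
      have "(- (t * du + e * w))\<^sup>2 = (t * du)\<^sup>2 + (e * w)\<^sup>2 + 2 * (t * du) * (e * w)" by (simp only: power2_minus power2_sum)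
      then have "(- (t * du + e * w))\<^sup>2 \<le> 2 * (t * du)\<^sup>2 + 2 * (e * w)\<^sup>2"
        using sum_squares_bound[of "t * du" "e * w"] by linarith
      moreover have "(t * du)\<^sup>2 \<le> 1 * du\<^sup>2" unfolding power_mult_distrib using t by (intro mult_right_mono) (auto simp: power_le_one)
      moreover have "(e * w)\<^sup>2 \<le> (1 / of_int n)\<^sup>2 * w\<^sup>2" unfolding power_mult_distrib
        using power_mono[OF e abs_ge_zero, of 2] by (intro mult_right_mono) (simp_all only: power2_abs zero_le_power2)
      ultimately show ?thesis by (simp add: power_divide)
    qed
    have nn: "0 \<le> 2 / (real_of_int n)\<^sup>2" by simp
    show ?thesis
    proof (cases "rad ?l \<le> n \<and> rad ?k \<le> n")
      case True
      then have "bdiff (\<lambda>l. v l - u l) b = 0" using \<theta>0 by (simp add: e1)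
      moreover have "0 \<le> tail_density n u b" by (simp add: tail_density_def)
      ultimately show ?thesis using ann0[of ?l] ann0[of ?k] by simp
    next
      case far: False
      then have "n \<le> rad ?l" using rad_bond_end[of b] by linarith
      then have td: "tail_density n u b = du\<^sup>2" by (simp add: tail_density_def bd du_def)
      consider "?l \<in> ?Ann" | "?k \<in> ?Ann" | "2 * n < rad ?l" "2 * n < rad ?k"
        using far rad_bond_end[of b] n by force
      then show ?thesis
      proof cases
        case 1
        have "(bdiff (\<lambda>l. v l - u l) b)\<^sup>2 \<le> 2 * du\<^sup>2 + 2 / (of_int n)\<^sup>2 * (u ?l - c)\<^sup>2"
          unfolding e1 by (rule sq[OF \<theta>r \<theta>s])
        also have "(u ?l - c)\<^sup>2 = ann ?l" using 1 by (simp add: ann_def)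
        finally show ?thesis unfolding td distrib_left using mult_nonneg_nonneg[OF nn ann0[of ?k]] by linarith
      next
        case 2
        have "(bdiff (\<lambda>l. v l - u l) b)\<^sup>2 \<le> 2 * du\<^sup>2 + 2 / (of_int n)\<^sup>2 * (u ?k - c)\<^sup>2"
          unfolding e2 by (rule sq[OF \<theta>r \<theta>s])
        also have "(u ?k - c)\<^sup>2 = ann ?k" using 2 by (simp add: ann_def)
        finally show ?thesis unfolding td distrib_left using mult_nonneg_nonneg[OF nn ann0[of ?l]] by linarith
      next
        case 3
        then have "bdiff (\<lambda>l. v l - u l) b = - du" using \<theta>1 by (simp add: e1)
        then show ?thesis unfolding td using ann0[of ?l] ann0[of ?k] by simp
      qed
    qed
  qed
  have hs: "((\<lambda>b. ann (fst b) + ann (bond_end b)) has_sum 4 * (\<Sum>\<^sub>\<infinity>l. ann l)) UNIV" by (rule infsum_bond_ends[OF s_ann])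
  have st: "tail_density n u summable_on UNIV" by (rule tail_density_summable[OF u])
  have sr: "(\<lambda>b. 2 * tail_density n u b + 2 / (of_int n)\<^sup>2 * (ann (fst b) + ann (bond_end b))) summable_on UNIV"
    by (rule summable_on_add[OF summable_on_cmult_right[OF st] summable_on_cmult_right[OF has_sum_imp_summable[OF hs]]])
  have l: "l2 (bdiff (\<lambda>l. v l - u l))"
    unfolding l2_def by (rule summable_by_bound[OF sr]) (use pt in simp)
  have "(l2norm (bdiff (\<lambda>l. v l - u l)))\<^sup>2 \<le> (\<Sum>\<^sub>\<infinity>b. 2 * tail_density n u b + 2 / (of_int n)\<^sup>2 * (ann (fst b) + ann (bond_end b)))"
    unfolding l2norm_sq by (rule infsum_mono[OF l[unfolded l2_def] sr pt])
  also have "\<dots> = 2 * tail n u + 2 / (of_int n)\<^sup>2 * (4 * (\<Sum>\<^sub>\<infinity>l. ann l))"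
    unfolding tail_def
    by (rule infsumI[OF has_sum_add[OF has_sum_cmult_right[OF has_sum_infsum[OF st]] has_sum_cmult_right[OF hs]]])
  also have "\<dots> \<le> 2 * tail n u + 2 / (of_int n)\<^sup>2 * (4 * (80000 * (of_int n)\<^sup>2 * tail n u))"
    unfolding i_ann using c by (intro add_left_mono mult_left_mono) auto
  also have "\<dots> = 640002 * tail n u" using n0 by simp
  finally show ?thesis by (intro that[of v] l) (auto simp: v_def \<theta>1)
qed

lemma tail_to_zero:
  assumes u: "l2 (bdiff u)" and e: "0 < e"
  obtains n where "1 \<le> n" "tail n u < e"
proof -
  let ?f = "\<lambda>b. (bdiff u b)\<^sup>2"
  have f: "?f summable_on UNIV" using u by (simp add: l2_def)
  obtain F where F: "finite F" "dist (sum ?f F) (infsum ?f UNIV) \<le> e / 2"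
    using infsum_finite_approximation[OF f, of "e/2"] e by auto
  define n where "n = Max (insert 1 ((\<lambda>b. rad (fst b) + 1) ` F))"
  have n1: "1 \<le> n" unfolding n_def using F(1) by (intro Max_ge) auto
  have nF: "rad (fst b) < n" if "b \<in> F" for b
  proof -
    have "rad (fst b) + 1 \<le> n" unfolding n_def using F(1) that by (intro Max_ge) auto
    then show ?thesis by simp
  qed
  note ind = infsum_indicator[OF F(1), of ?f]
  have "tail n u \<le> (\<Sum>\<^sub>\<infinity>b. ?f b - (if b \<in> F then ?f b else 0))"
    unfolding tail_def
    by (rule infsum_mono[OF tail_density_summable[OF u] summable_on_diff_real[OF f ind(1)]])
       (use nF in \<open>force simp: tail_density_def\<close>)
  also have "\<dots> = infsum ?f UNIV - sum ?f F" using infsum_diff_real[OF f ind(1)] ind(2) by simp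
  also have "\<dots> \<le> e / 2" using F(2) unfolding dist_real_def by linarith
  finally show ?thesis using that[OF n1] e by simp
qed

lemma ssize_ge_rad: "of_int (rad l) \<le> ssize l"
proof -
  have "rad l \<le> 1 + \<bar>fst l\<bar> + \<bar>snd l\<bar>" by (auto simp: rad_def)
  then have "real_of_int (rad l) \<le> real_of_int (1 + \<bar>fst l\<bar> + \<bar>snd l\<bar>)" by (simp only: of_int_le_iff)
  then show ?thesis by (simp add: ssize_def)
qed

lemma tail_decay:
  assumes g: "l2 (\<lambda>b. ssize (fst b) powr \<alpha> * bdiff u b)" and \<alpha>: "0 < \<alpha>" and n: "1 \<le> n" and u: "l2 (bdiff u)"
  shows "tail n u \<le> (of_int n powr (- \<alpha>))\<^sup>2 * (l2norm (\<lambda>b. ssize (fst b) powr \<alpha> * bdiff u b))\<^sup>2"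
  unfolding tail_def l2norm_sq infsum_cmult_right'[symmetric]
proof (rule infsum_mono[OF tail_density_summable[OF u]])
  show "(\<lambda>b. (of_int n powr (- \<alpha>))\<^sup>2 * (ssize (fst b) powr \<alpha> * bdiff u b)\<^sup>2) summable_on UNIV"
    using g by (intro summable_on_cmult_right) (simp add: l2_def)
  fix b
  show "tail_density n u b \<le> (of_int n powr (- \<alpha>))\<^sup>2 * (ssize (fst b) powr \<alpha> * bdiff u b)\<^sup>2"
  proof (cases "n \<le> rad (fst b)")
    case True
    then have "real_of_int n \<le> ssize (fst b)" using ssize_ge_rad[of "fst b"] by linarith
    then have "of_int n powr \<alpha> \<le> ssize (fst b) powr \<alpha>" using n \<alpha> by (intro powr_mono2) auto
    then have "of_int n powr (- \<alpha>) * of_int n powr \<alpha> \<le> of_int n powr (- \<alpha>) * ssize (fst b) powr \<alpha>"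
      by (intro mult_left_mono) auto
    moreover have "real_of_int n powr (- \<alpha>) * of_int n powr \<alpha> = 1" using n by (simp add: powr_add[symmetric])
    ultimately have "1 \<le> of_int n powr (- \<alpha>) * ssize (fst b) powr \<alpha>" by simp
    then have "1 * (bdiff u b)\<^sup>2 \<le> (of_int n powr (- \<alpha>) * ssize (fst b) powr \<alpha>)\<^sup>2 * (bdiff u b)\<^sup>2"
      by (intro mult_right_mono) (auto simp: one_le_power)
    then show ?thesis using True by (simp add: tail_density_def power_mult_distrib mult_ac)
  qed (simp add: tail_density_def)
qed

section \<open>Energy of the cracked lattice\<close>

lemma summable_ssize_decay:
  assumes "2 < p" shows "(\<lambda>b :: bond. (ssize (fst b) powr (- p / 2))\<^sup>2) summable_on UNIV"
proof -
  have "(ssize l powr (- p / 2))\<^sup>2 = ssize l powr (- p)" for l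
    by (simp add: power2_eq_square powr_add[symmetric])
  then show ?thesis using summable_ssize[OF assms] by simp
qed

lemma cube_le:
  fixes x y :: real shows "\<bar>x + y\<bar> ^ 3 \<le> 4 * (\<bar>x\<bar> ^ 3 + \<bar>y\<bar> ^ 3)"
proof -
  have "\<bar>x + y\<bar> ^ 3 \<le> (\<bar>x\<bar> + \<bar>y\<bar>) ^ 3" by (rule power_mono) auto
  also have "\<dots> \<le> 4 * (\<bar>x\<bar> ^ 3 + \<bar>y\<bar> ^ 3)"
  proof -
    have "4 * (\<bar>x\<bar> ^ 3 + \<bar>y\<bar> ^ 3) - (\<bar>x\<bar> + \<bar>y\<bar>) ^ 3 = 3 * ((\<bar>x\<bar> + \<bar>y\<bar>) * (\<bar>x\<bar> - \<bar>y\<bar>)\<^sup>2)"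
      by (simp only: power3_eq_cube power2_eq_square) (simp add: algebra_simps)
    moreover have "0 \<le> 3 * ((\<bar>x\<bar> + \<bar>y\<bar>) * (\<bar>x\<bar> - \<bar>y\<bar>)\<^sup>2)" by simp
    ultimately show ?thesis by linarith
  qed
  finally show ?thesis .
qed

locale crack_energy = potential +
  fixes \<epsilon> :: real
  assumes eps: "0 \<le> \<epsilon>"
begin

lemma predictor_le: "\<bar>bdiff (predictor \<epsilon>) b\<bar> \<le> 3 * \<epsilon> * ssize (fst b) powr (- 1/2)"
  using predictor_consistent[OF eps, of b] by (simp add: predictor_estimate_def mult_ac)

lemma predictor_bounded: "\<bar>bdiff (predictor \<epsilon>) b\<bar> \<le> 3 * \<epsilon>"
proof -
  have "ssize (fst b) powr (- 1/2) \<le> ssize (fst b) powr 0" using ssize_ge1[of "fst b"] by (intro powr_mono) auto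
  then have "ssize (fst b) powr (- 1/2) \<le> 1" using ssize_ge1[of "fst b"] by simp
  then have "3 * \<epsilon> * ssize (fst b) powr (- 1/2) \<le> 3 * \<epsilon> * 1" using eps by (intro mult_left_mono) auto
  then show ?thesis using predictor_le[of b] by linarith
qed

lemma predictor_cube: "\<bar>bdiff (predictor \<epsilon>) b\<bar> ^ 3 \<le> (3 * \<epsilon>) ^ 3 * ssize (fst b) powr (- 3/2)"
proof -
  have "\<bar>bdiff (predictor \<epsilon>) b\<bar> ^ 3 \<le> (3 * \<epsilon> * ssize (fst b) powr (- 1/2)) ^ 3"
    by (rule power_mono[OF predictor_le]) simp
  also have "\<dots> = (3 * \<epsilon>) ^ 3 * (ssize (fst b) powr (- 1/2)) ^ 3" by (rule power_mult_distrib)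
  also have "(ssize (fst b) powr (- 1/2)) ^ 3 = ssize (fst b) powr (- 3/2)"
    by (simp only: power3_eq_cube powr_add[symmetric]) simp
  finally show ?thesis .
qed

lemma predictor_residual:
  assumes "derivative_bound (3 * \<epsilon>) K"
  shows "\<bar>\<phi>1 (bdiff (predictor \<epsilon>) b) - cdiff (conjugate \<epsilon>) b\<bar> \<le> (24 * \<epsilon> + K * (3 * \<epsilon>) ^ 3) * ssize (fst b) powr (- 3/2)"
proof -
  let ?a = "bdiff (predictor \<epsilon>) b" let ?p = "ssize (fst b) powr (- 3/2)"
  have 1: "\<bar>?a - cdiff (conjugate \<epsilon>) b\<bar> \<le> \<epsilon> * (24 * ?p)" using predictor_consistent[OF eps, of b] by (simp add: predictor_estimate_def)
  have "\<bar>\<phi>1 ?a - ?a\<bar> \<le> K * \<bar>?a\<bar> ^ 3" by (rule force_cubic[OF assms predictor_bounded])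
  also have "\<dots> \<le> K * ((3 * \<epsilon>) ^ 3 * ?p)"
    using K_pos[OF assms] by (intro mult_left_mono predictor_cube) auto
  finally have 2: "\<bar>\<phi>1 ?a - ?a\<bar> \<le> K * ((3 * \<epsilon>) ^ 3 * ?p)" .
  have "\<bar>\<phi>1 ?a - cdiff (conjugate \<epsilon>) b\<bar> \<le> \<epsilon> * (24 * ?p) + K * ((3 * \<epsilon>) ^ 3 * ?p)" using 1 2 by linarith
  then show ?thesis by (simp add: algebra_simps)
qed

sublocale bond_energy \<phi> \<phi>1 \<phi>2 \<phi>3 \<phi>4 "bdiff (predictor \<epsilon>)" "cdiff (conjugate \<epsilon>)" "3 * \<epsilon>"
proof
  show "\<bar>bdiff (predictor \<epsilon>) b\<bar> \<le> 3 * \<epsilon>" for b by (rule predictor_bounded)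
  obtain K where K: "derivative_bound (3 * \<epsilon>) K" using ex_derivative_bound by blast
  have "l2 (\<lambda>b :: bond. ssize (fst b) powr (- 3/2))"
    unfolding l2_def using summable_ssize_decay[of 3] by simp
  then show "l2 (\<lambda>b. \<phi>1 (bdiff (predictor \<epsilon>) b) - cdiff (conjugate \<epsilon>) b)"
    by (rule l2_bound) (use predictor_residual[OF K] in simp)
qed

lemma conjugate_slit: "l \<in> cracked \<Longrightarrow> cdiff (conjugate \<epsilon>) (l, True) = 0"
proof -
  assume l: "l \<in> cracked"
  then have "l - (1,0) \<in> cracked" by (auto simp: cracked_def)
  then show ?thesis using l conjugate_cracked by (simp add: cdiff_def)
qed

text \<open>Every bond is counted from both ends, and the reference flux contributes nothing by summation by
  parts.\<close>

lemma energy_fin_eq: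
  assumes u: "finitely_supported u" shows "energy_fin \<phi> \<epsilon> u = 2 * en (bdiff u)"
proof -
  let ?a = "bdiff (predictor \<epsilon>)" and ?F = "cdiff (conjugate \<epsilon>)"
  let ?h = "\<lambda>b. \<phi> (?a b + bdiff u b) - \<phi> (?a b)"
  note fin = finite_bdiff_support[OF u]
  have h: "?h summable_on UNIV" by (rule summable_finite_support[OF fin]) auto
  have f: "(\<lambda>b. ?F b * bdiff u b) summable_on UNIV" by (rule summable_finite_support[OF fin]) auto
  have ev: "\<phi> (- x - y) = \<phi> (x + y)" "\<phi> (- x) = \<phi> x" for x y using even[of "x + y"] even[of x] by (simp_all add: add.commute)
  have "((\<lambda>m. \<Sum>\<rho>\<in>dirs. \<phi> (grad (predictor \<epsilon>) m \<rho> + grad u m \<rho>) - \<phi> (grad (predictor \<epsilon>) m \<rho>)) has_sum 2 * (\<Sum>\<^sub>\<infinity>b. ?h b)) UNIV"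
    by (rule infsum_star[OF h]) (simp_all add: grad_east grad_north grad_west grad_south ev)
  then have "energy_fin \<phi> \<epsilon> u = 2 * (\<Sum>\<^sub>\<infinity>b. ?h b)"
    unfolding energy_fin_def site_energy_def sum_subtractf[symmetric] by (rule infsumI)
  moreover have "(\<Sum>\<^sub>\<infinity>b. ?F b * bdiff u b) = 0"
    using summation_by_parts[OF u, of ?F] conjugate_slit by (simp add: divg_cdiff)
  moreover have "en (bdiff u) = (\<Sum>\<^sub>\<infinity>b. ?h b) - (\<Sum>\<^sub>\<infinity>b. ?F b * bdiff u b)"
    unfolding en_def by (rule infsum_diff_real[OF h f])
  ultimately show ?thesis by simp
qed

text \<open>Density ensures that the limit defining the energy by continuity is taken along a nontrivial
  filter.\<close>

lemma finite_support_dense: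
  assumes u: "l2 (bdiff u)" and e: "0 < e"
  obtains w where "finitely_supported w" "l2norm (\<lambda>b. bdiff w b - bdiff u b) < e"
proof -
  obtain n where n: "1 \<le> n" "tail n u < e\<^sup>2 / 640002" by (rule tail_to_zero[OF u, of "e\<^sup>2 / 640002"]) (use e in simp)
  obtain v where v: "\<And>l. 2 * n \<le> rad l \<Longrightarrow> v l = 0" and "l2 (bdiff (\<lambda>l. v l - u l))" and
    v2: "(l2norm (bdiff (\<lambda>l. v l - u l)))\<^sup>2 \<le> 640002 * tail n u" by (rule truncation[OF u n(1)]) blast
  have "finite {l. v l \<noteq> 0}"
  proof (rule finite_subset[OF _ finite_rad[of "2 * n"]])
    have "rad l \<le> 2 * n" if "v l \<noteq> 0" for l using v[of l] that by linarith
    then show "{l. v l \<noteq> 0} \<subseteq> {l. rad l \<le> 2 * n}" by blast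
  qed
  moreover have "(l2norm (bdiff (\<lambda>l. v l - u l)))\<^sup>2 < e\<^sup>2" using v2 n(2) by linarith
  then have "l2norm (bdiff (\<lambda>l. v l - u l)) < e" by (rule power2_less_imp_less) (use e in simp)
  ultimately show ?thesis by (intro that[of v]) (simp_all add: finitely_supported_def bdiff_diff)
qed

lemma en_continuous:
  assumes g: "l2 g" obtains C where "0 < C" "\<And>h. l2 h \<Longrightarrow> l2norm h \<le> 1 \<Longrightarrow> \<bar>en (\<lambda>i. g i + h i) - en g\<bar> \<le> C * l2norm h"
proof -
  obtain K where K: "derivative_bound (3 * \<epsilon> + l2norm g + 1) K" using ex_derivative_bound by blast
  have K0: "0 < K" by (rule K_pos[OF K])
  show ?thesis
  proof (rule that[of "l2norm (stress g) + K"])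
    show "0 < l2norm (stress g) + K" using K0 by (simp add: add_nonneg_pos)
    fix h :: "bond \<Rightarrow> real" assume h: "l2 h" "l2norm h \<le> 1"
    have "\<bar>en (\<lambda>i. g i + h i) - en g - (\<Sum>\<^sub>\<infinity>i. stress g i * h i)\<bar> \<le> K * (l2norm h)\<^sup>2"
      by (rule en_taylor1[OF g h(1) K]) (use h in simp)
    moreover have "(l2norm h)\<^sup>2 \<le> l2norm h" using h by (simp add: power2_eq_square mult_left_le)
    then have "K * (l2norm h)\<^sup>2 \<le> K * l2norm h" using K0 by (intro mult_left_mono) auto
    moreover have "\<bar>\<Sum>\<^sub>\<infinity>i. stress g i * h i\<bar> \<le> l2norm (stress g) * l2norm h"
      by (rule l2_inner_le[OF stress_l2[OF g] h(1)])
    ultimately show "\<bar>en (\<lambda>i. g i + h i) - en g\<bar> \<le> (l2norm (stress g) + K) * l2norm h"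
      unfolding distrib_right by linarith
  qed
qed

text \<open>The series is continuous in the l2 norm and agrees with the energy on the dense set of finitely
  supported functions, so it is the extension by continuity.\<close>

theorem energy_eq:
  assumes u: "l2 (bdiff u)" shows "energy \<phi> \<epsilon> u = 2 * en (bdiff u)"
proof (cases "finitely_supported u")
  case True then show ?thesis by (simp add: energy_def energy_fin_eq)
next
  case False
  let ?F = "inf (filtercomap (\<lambda>w. dnorm (\<lambda>m. w m - u m)) (nhds 0)) (principal {w. finitely_supported w})"
  have dn: "dnorm (\<lambda>m. w m - u m) = sqrt 2 * l2norm (\<lambda>b. bdiff w b - bdiff u b)" if "finitely_supported w" for w
    using dnorm_eq[of "\<lambda>m. w m - u m"] l2_diff[OF l2_bdiff_finite[OF that] u] by (simp add: bdiff_diff)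
  have ev: "eventually P ?F \<longleftrightarrow> (\<exists>d>0. \<forall>w. finitely_supported w \<and> \<bar>dnorm (\<lambda>m. w m - u m)\<bar> < d \<longrightarrow> P w)" for P
  proof
    assume "eventually P ?F"
    then obtain Q where Q: "eventually Q (nhds (0::real))" "\<And>w. Q (dnorm (\<lambda>m. w m - u m)) \<Longrightarrow> finitely_supported w \<Longrightarrow> P w"
      by (auto simp: eventually_inf_principal eventually_filtercomap)
    from Q(1) obtain d where "0 < d" "\<And>x :: real. \<bar>x\<bar> < d \<Longrightarrow> Q x" by (auto simp: eventually_nhds_metric dist_real_def)
    then show "\<exists>d>0. \<forall>w. finitely_supported w \<and> \<bar>dnorm (\<lambda>m. w m - u m)\<bar> < d \<longrightarrow> P w" using Q(2) by blast
  next
    assume "\<exists>d>0. \<forall>w. finitely_supported w \<and> \<bar>dnorm (\<lambda>m. w m - u m)\<bar> < d \<longrightarrow> P w"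
    then obtain d where d: "0 < d" "\<And>w. finitely_supported w \<Longrightarrow> \<bar>dnorm (\<lambda>m. w m - u m)\<bar> < d \<Longrightarrow> P w" by blast
    have "eventually (\<lambda>x :: real. \<bar>x\<bar> < d) (nhds 0)"
      using d(1) by (auto simp: eventually_nhds_metric dist_real_def)
    then show "eventually P ?F"
      unfolding eventually_inf_principal eventually_filtercomap using d(2) by blast
  qed
  have nt: "\<not> trivial_limit ?F"
  proof
    assume "trivial_limit ?F"
    then have "eventually (\<lambda>_. False) ?F" by (simp add: trivial_limit_def)
    then obtain d where d: "0 < d" "\<And>w. finitely_supported w \<Longrightarrow> \<not> \<bar>dnorm (\<lambda>m. w m - u m)\<bar> < d"
      unfolding ev by blast
    obtain w where w: "finitely_supported w" "l2norm (\<lambda>b. bdiff w b - bdiff u b) < d / sqrt 2"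
      using finite_support_dense[OF u, of "d / sqrt 2"] d(1) by auto
    have "\<bar>dnorm (\<lambda>m. w m - u m)\<bar> < d"
      unfolding dn[OF w(1)] using w(2) by (simp add: pos_less_divide_eq mult.commute)
    then show False using d(2)[OF w(1)] by blast
  qed
  obtain C where C: "0 < C" "\<And>h. l2 h \<Longrightarrow> l2norm h \<le> 1 \<Longrightarrow> \<bar>en (\<lambda>i. bdiff u i + h i) - en (bdiff u)\<bar> \<le> C * l2norm h"
    using en_continuous[OF u] by blast
  have lim: "(energy_fin \<phi> \<epsilon> \<longlongrightarrow> 2 * en (bdiff u)) ?F"
    unfolding tendsto_iff
  proof (intro allI impI)
    fix e :: real assume e: "0 < e"
    let ?d = "min 1 (e / (2 * C))"
    show "eventually (\<lambda>w. dist (energy_fin \<phi> \<epsilon> w) (2 * en (bdiff u)) < e) ?F"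
      unfolding ev
    proof (intro exI[of _ ?d] conjI allI impI)
      show "0 < ?d" using e C by simp
      fix w assume w: "finitely_supported w \<and> \<bar>dnorm (\<lambda>m. w m - u m)\<bar> < ?d"
      let ?h = "\<lambda>b. bdiff w b - bdiff u b"
      have hl: "l2 ?h" using l2_diff[OF l2_bdiff_finite u] w by blast
      have "l2norm ?h \<le> sqrt 2 * l2norm ?h" using mult_right_mono[of 1 "sqrt 2" "l2norm ?h"] by simp
      then have hn: "l2norm ?h < ?d" using w dn[of w] by simp
      have "\<bar>en (\<lambda>i. bdiff u i + ?h i) - en (bdiff u)\<bar> \<le> C * l2norm ?h" by (rule C(2)[OF hl]) (use hn in simp)
      also have "\<dots> < C * (e / (2 * C))" using hn C(1) by (intro mult_strict_left_mono) auto
      also have "\<dots> = e / 2" using C(1) by simp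
      finally have "\<bar>en (\<lambda>i. bdiff u i + ?h i) - en (bdiff u)\<bar> < e / 2" .
      moreover have "(\<lambda>i. bdiff u i + ?h i) = bdiff w" by auto
      ultimately have "\<bar>en (bdiff w) - en (bdiff u)\<bar> < e / 2" by simp
      moreover have "energy_fin \<phi> \<epsilon> w = 2 * en (bdiff w)" using energy_fin_eq[of w] w by blast
      ultimately show "dist (energy_fin \<phi> \<epsilon> w) (2 * en (bdiff u)) < e"
        unfolding dist_real_def by linarith
    qed
  qed
  show ?thesis using False tendsto_Lim[OF nt lim] by (simp add: energy_def)
qed

lemma second_variation_eq:
  assumes u: "l2 (bdiff u)" and v: "l2 (bdiff v)"
  shows "second_variation (energy \<phi> \<epsilon>) u v = 2 * hess (bdiff u) (bdiff v)"
proof -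
  have "energy \<phi> \<epsilon> (\<lambda>m. u m + t * v m) = 2 * en (\<lambda>b. bdiff u b + t * bdiff v b)" for t
    using energy_eq[of "\<lambda>m. u m + t * v m"] l2_add[OF u l2_cmult[OF v, of t]] by (simp add: bdiff_add bdiff_cmult)
  then show ?thesis unfolding second_variation_def by (simp add: en_second_deriv[OF u v])
qed

text \<open>Admissible variations vanish at the normalisation site, which is achieved by subtracting a
  constant. Strains do not notice it, so all displacements with square summable strain may be used
  as tests.\<close>

lemma critical:
  assumes m: "local_minimiser (energy \<phi> \<epsilon>) H1dot u" and v: "l2 (bdiff v)"
  shows "(\<Sum>\<^sub>\<infinity>b. stress (bdiff u) b * bdiff v b) = 0"
proof -
  have u: "l2 (bdiff u)" "u xhat = 0" using m by (auto simp: local_minimiser_def H1dot_def grad_in_l2_iff)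
  obtain d where d: "0 < d" "\<And>w. w \<in> H1dot \<Longrightarrow> dnorm (\<lambda>m. w m - u m) < d \<Longrightarrow> energy \<phi> \<epsilon> u \<le> energy \<phi> \<epsilon> w"
    using m by (auto simp: local_minimiser_def)
  let ?f = "\<lambda>t. en (\<lambda>b. bdiff u b + t * bdiff v b)"
  let ?c = "sqrt 2 * l2norm (bdiff v) + 1"
  have c0: "0 < ?c" by (simp add: add_nonneg_pos)
  have "(\<Sum>\<^sub>\<infinity>b. stress (\<lambda>b. bdiff u b + 0 * bdiff v b) b * bdiff v b) = 0"
  proof (rule DERIV_local_min[OF en_deriv[OF u(1) v]])
    show "0 < d / ?c" using d(1) c0 by simp
    show "\<forall>t. \<bar>0 - t\<bar> < d / ?c \<longrightarrow> ?f 0 \<le> ?f t"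
    proof (intro allI impI)
      fix t assume t: "\<bar>0 - t\<bar> < d / ?c"
      define w where "w m = u m + t * (v m - v xhat)" for m
      have bw: "bdiff w = (\<lambda>b. bdiff u b + t * bdiff v b)"
        unfolding w_def using bdiff_add[of u "\<lambda>m. t * (v m - v xhat)"] bdiff_cmult[of t "\<lambda>m. v m - v xhat"] by (simp add: bdiff_const)
      have lw: "l2 (bdiff w)" unfolding bw by (intro l2_add u l2_cmult v)
      have wH: "w \<in> H1dot" using lw u(2) by (simp add: H1dot_def grad_in_l2_iff w_def)
      have "bdiff (\<lambda>m. w m - u m) = (\<lambda>b. t * bdiff v b)" by (simp add: bdiff_diff bw)
      then have "dnorm (\<lambda>m. w m - u m) = \<bar>t\<bar> * (sqrt 2 * l2norm (bdiff v))"
        using dnorm_eq[of "\<lambda>m. w m - u m"] l2_cmult[OF v, of t] by (simp add: l2norm_cmult)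
      also have "\<dots> \<le> \<bar>t\<bar> * ?c" by (intro mult_left_mono) auto
      also have "\<dots> < d" using t c0 by (simp add: pos_less_divide_eq)
      finally have "energy \<phi> \<epsilon> u \<le> energy \<phi> \<epsilon> w" by (rule d(2)[OF wH])
      then show "?f 0 \<le> ?f t" using energy_eq[OF u(1)] energy_eq[OF lw] by (simp add: bw)
    qed
  qed
  then show ?thesis by simp
qed

section \<open>Decay of the equilibrium\<close>

lemma stress_slit: "l \<in> cracked \<Longrightarrow> stress (bdiff u) (l, True) = 0"
  using conjugate_slit force_odd[of 0] by (simp add: stress_def bdiff_def)

lemma stress_divergence_free:
  assumes m: "local_minimiser (energy \<phi> \<epsilon>) H1dot u" shows "divg (stress (bdiff u)) l = 0"
proof -
  let ?v = "\<lambda>m. if m = l then 1 else 0 :: real"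
  have fv: "finitely_supported ?v" by (simp add: finitely_supported_def)
  have "(\<Sum>\<^sub>\<infinity>m. ?v m * divg (stress (bdiff u)) m) = (\<Sum>\<^sub>\<infinity>m\<in>{l}. ?v m * divg (stress (bdiff u)) m)"
    by (rule infsum_cong_neutral) auto
  then have "(\<Sum>\<^sub>\<infinity>m. ?v m * divg (stress (bdiff u)) m) = divg (stress (bdiff u)) l" by simp
  moreover have "(\<Sum>\<^sub>\<infinity>b. stress (bdiff u) b * bdiff ?v b) = - (\<Sum>\<^sub>\<infinity>m. ?v m * divg (stress (bdiff u)) m)"
    by (rule summation_by_parts[OF fv]) (rule stress_slit)
  ultimately show ?thesis using critical[OF m l2_bdiff_finite[OF fv]] by simp
qed

text \<open>The stream function s of the stress solves a Poisson equation with source q = p - g, to which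
  the decay theorem applies: the source is O(r^(-3/2)) plus a cubic term in the strain g, and
  since g tends to zero, the latter is eventually small relative to g, hence relative to the
  stress p. Finally the decay of p passes back to g.\<close>

theorem equilibrium_decay:
  assumes m: "local_minimiser (energy \<phi> \<epsilon>) H1dot u" and \<alpha>: "0 < \<alpha>" "\<alpha> < 1/2"
  shows "l2 (\<lambda>b. ssize (fst b) powr \<alpha> * bdiff u b)"
proof -
  have u: "l2 (bdiff u)" using m by (auto simp: local_minimiser_def H1dot_def grad_in_l2_iff)
  let ?a = "bdiff (predictor \<epsilon>)" and ?g = "bdiff u" and ?p = "stress (bdiff u)"
  obtain s where s: "cdiff s = ?p" "\<And>l. l \<in> cracked \<Longrightarrow> s l = 0"
    using stream_function_exists[OF stress_divergence_free[OF m] stress_slit] by blast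
  have sp: "l2 (cdiff s)" unfolding s(1) by (rule stress_l2[OF u])
  define q where "q b = ?p b - ?g b" for b
  obtain K where K: "derivative_bound (3 * \<epsilon> + l2norm ?g) K" using ex_derivative_bound by blast
  have K0: "0 < K" by (rule K_pos[OF K])
  define C where "C = 24 * \<epsilon> + 4 * K * (3 * \<epsilon>) ^ 3"
  have C0: "0 \<le> C" using eps K0 by (simp add: C_def)
  define w where "w b = ssize (fst b) powr (- 3/2)" for b :: bond
  have w0: "0 \<le> w b" for b by (simp add: w_def)
  have qb: "\<bar>q b\<bar> \<le> C * w b + 4 * K * (?g b)\<^sup>2 * \<bar>?g b\<bar>" for b
  proof -
    have 1: "\<bar>?a b - cdiff (conjugate \<epsilon>) b\<bar> \<le> \<epsilon> * (24 * w b)"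
      using predictor_consistent[OF eps, of b] by (simp add: predictor_estimate_def w_def)
    have "\<bar>\<phi>1 (?a b + ?g b) - (?a b + ?g b)\<bar> \<le> K * \<bar>?a b + ?g b\<bar> ^ 3"
      by (rule force_cubic[OF K strain_le[OF u order_refl]])
    also have "\<dots> \<le> K * (4 * (\<bar>?a b\<bar> ^ 3 + \<bar>?g b\<bar> ^ 3))" using K0 by (intro mult_left_mono cube_le) auto
    also have "\<dots> \<le> K * (4 * ((3 * \<epsilon>) ^ 3 * w b + \<bar>?g b\<bar> ^ 3))"
      using K0 predictor_cube[of b] by (intro mult_left_mono add_right_mono) (auto simp: w_def)
    finally have 2: "\<bar>\<phi>1 (?a b + ?g b) - (?a b + ?g b)\<bar> \<le> K * (4 * ((3 * \<epsilon>) ^ 3 * w b + \<bar>?g b\<bar> ^ 3))" .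
    have "q b = (?a b - cdiff (conjugate \<epsilon>) b) + (\<phi>1 (?a b + ?g b) - (?a b + ?g b))" by (simp add: q_def stress_def)
    then have "\<bar>q b\<bar> \<le> \<epsilon> * (24 * w b) + K * (4 * ((3 * \<epsilon>) ^ 3 * w b + \<bar>?g b\<bar> ^ 3))" using 1 2 by linarith
    also have "\<bar>?g b\<bar> ^ 3 = (?g b)\<^sup>2 * \<bar>?g b\<bar>" using power2_abs[of "?g b"] by (simp add: numeral_3_eq_3 numeral_2_eq_2)
    finally show ?thesis by (simp add: C_def algebra_simps)
  qed
  have small: "\<exists>R. \<forall>b. R \<le> norm (dual_pos (fst b)) \<longrightarrow> \<bar>q b\<bar> \<le> 2 * C * w b + d * \<bar>?p b\<bar>" if d: "0 < d" for d
  proof -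
    \<comment> \<open>Replacing g by p - q in the cubic term costs d' |q|, which is absorbed on the left
      because d' is at most 1/2.\<close>
    define d' where "d' = min (1/2) (d/2)"
    have d': "0 < d'" "d' \<le> 1/2" "2 * d' \<le> d" using d by (auto simp: d'_def)
    define t where "t = sqrt (d' / (4 * K))"
    have t: "0 < t" "t\<^sup>2 = d' / (4 * K)" using d' K0 by (auto simp: t_def)
    let ?B = "{b. t \<le> \<bar>?g b\<bar>}"
    have B: "finite ?B" by (rule l2_finite_large[OF u t(1)])
    define R where "R = 1 + Max (insert 0 ((\<lambda>b. norm (dual_pos (fst b))) ` ?B))"
    have RB: "norm (dual_pos (fst b)) < R" if "b \<in> ?B" for b
    proof -
      have "norm (dual_pos (fst b)) \<le> Max (insert 0 ((\<lambda>b. norm (dual_pos (fst b))) ` ?B))" using B that by (intro Max_ge) auto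
      then show ?thesis by (simp add: R_def)
    qed
    have "\<bar>q b\<bar> \<le> 2 * C * w b + d * \<bar>?p b\<bar>" if b: "R \<le> norm (dual_pos (fst b))" for b
    proof -
      have "\<bar>?g b\<bar> < t" using RB[of b] b by force
      then have "(?g b)\<^sup>2 \<le> t\<^sup>2" using power_mono[of "\<bar>?g b\<bar>" t 2] by simp
      then have "4 * K * (?g b)\<^sup>2 \<le> 4 * K * (d' / (4 * K))" unfolding t(2) using K0 by (intro mult_left_mono) auto
      then have "4 * K * (?g b)\<^sup>2 \<le> d'" using K0 by simp
      then have "4 * K * (?g b)\<^sup>2 * \<bar>?g b\<bar> \<le> d' * \<bar>?g b\<bar>" by (rule mult_right_mono) simp
      moreover have "d' * \<bar>?g b\<bar> \<le> d' * (\<bar>?p b\<bar> + \<bar>q b\<bar>)" using d' by (intro mult_left_mono) (auto simp: q_def)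
      moreover have "d' * \<bar>q b\<bar> \<le> 1/2 * \<bar>q b\<bar>" using d' by (intro mult_right_mono) auto
      ultimately have "\<bar>q b\<bar> \<le> 2 * C * w b + (2 * d') * \<bar>?p b\<bar>" using qb[of b] unfolding distrib_left by linarith
      moreover have "(2 * d') * \<bar>?p b\<bar> \<le> d * \<bar>?p b\<bar>" using d' by (intro mult_right_mono) auto
      ultimately show ?thesis by linarith
    qed
    then show ?thesis by blast
  qed
  have lw: "l2 (\<lambda>b. ssize (fst b) powr \<alpha> * (2 * C * w b))"
  proof -
    have "l2 (\<lambda>b :: bond. ssize (fst b) powr (- (3 - 2 * \<alpha>) / 2))"
      unfolding l2_def by (rule summable_ssize_decay) (use \<alpha> in simp)
    moreover have e: "ssize (fst b) powr \<alpha> * (2 * C * w b) = 2 * C * ssize (fst b) powr (- (3 - 2 * \<alpha>) / 2)" for b :: bond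
    proof -
      have "ssize (fst b) powr \<alpha> * w b = ssize (fst b) powr (\<alpha> + - 3/2)" by (simp only: w_def powr_add)
      also have "\<alpha> + - 3/2 = - (3 - 2 * \<alpha>) / 2" by (simp add: field_simps)
      finally show ?thesis by simp
    qed
    ultimately show ?thesis unfolding e by (intro l2_cmult)
  qed
  have lp: "l2 (\<lambda>b. ssize (fst b) powr \<alpha> * ?p b)"
    unfolding s(1)[symmetric]
  proof (rule stream_decay[OF s(2) sp _ \<alpha> _ lw])
    fix \<tau> assume \<tau>: "finitely_supported \<tau>" "\<And>l. l \<in> cracked \<Longrightarrow> \<tau> l = 0"
    have f: "(\<lambda>b. h b * cdiff \<tau> b) summable_on UNIV" for h
      by (rule summable_finite_support[OF cdiff_finite[OF \<tau>(1)]]) auto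
    have "(\<Sum>\<^sub>\<infinity>b. q b * cdiff \<tau> b) = (\<Sum>\<^sub>\<infinity>b. ?p b * cdiff \<tau> b - ?g b * cdiff \<tau> b)"
      by (simp add: q_def left_diff_distrib)
    also have "\<dots> = (\<Sum>\<^sub>\<infinity>b. ?p b * cdiff \<tau> b) - (\<Sum>\<^sub>\<infinity>b. ?g b * cdiff \<tau> b)" by (rule infsum_diff_real[OF f f])
    finally show "(\<Sum>\<^sub>\<infinity>b. q b * cdiff \<tau> b) = (\<Sum>\<^sub>\<infinity>b. cdiff s b * cdiff \<tau> b)"
      using gradients_are_curl_free[OF \<tau>] by (simp add: s(1))
  next
    show "0 \<le> 2 * C * w b" for b using C0 w0 by simp
    show "\<exists>R. \<forall>b. R \<le> norm (dual_pos (fst b)) \<longrightarrow> \<bar>q b\<bar> \<le> 2 * C * w b + d * \<bar>cdiff s b\<bar>" if "0 < d" for d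
      unfolding s(1) by (rule small[OF that])
  qed
  obtain R where R: "\<forall>b. R \<le> norm (dual_pos (fst b)) \<longrightarrow> \<bar>q b\<bar> \<le> 2 * C * w b + 1 * \<bar>?p b\<bar>" using small[OF zero_less_one] by blast
  let ?A = "{l. norm (dual_pos l) \<le> R} \<times> (UNIV :: bool set)"
  have A: "finite ?A" using finite_norm_ball by auto
  let ?P = "\<lambda>b. ssize (fst b) powr \<alpha> * ?p b" and ?W = "\<lambda>b. ssize (fst b) powr \<alpha> * (2 * C * w b)"
  let ?G = "\<lambda>b. ssize (fst b) powr \<alpha> * ?g b"
  let ?n = "\<lambda>b. if b \<in> ?A then (?G b)\<^sup>2 else 0"
  have n: "?n summable_on UNIV" by (rule infsum_indicator(1)[OF A])
  have l: "(\<lambda>b. (?P b)\<^sup>2) summable_on UNIV" "(\<lambda>b. (?W b)\<^sup>2) summable_on UNIV" using lp lw by (auto simp: l2_def)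
  show ?thesis unfolding l2_def
  proof (rule summable_by_bound)
    show "(\<lambda>b. 8 * (?P b)\<^sup>2 + 2 * (?W b)\<^sup>2 + ?n b) summable_on UNIV"
      by (intro summable_on_add summable_on_cmult_right l n)
    fix b
    show "\<bar>(?G b)\<^sup>2\<bar> \<le> 8 * (?P b)\<^sup>2 + 2 * (?W b)\<^sup>2 + ?n b"
    proof (cases "b \<in> ?A")
      case True then show ?thesis by simp
    next
      case False
      then have "R \<le> norm (dual_pos (fst b))" by (cases b) auto
      then have "\<bar>?g b\<bar> \<le> 2 * \<bar>?p b\<bar> + 2 * C * w b" using R[rule_format, of b] by (simp add: q_def; linarith)
      then have "ssize (fst b) powr \<alpha> * \<bar>?g b\<bar> \<le> ssize (fst b) powr \<alpha> * (2 * \<bar>?p b\<bar> + 2 * C * w b)" by (rule mult_left_mono) simp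
      then have "\<bar>?G b\<bar> \<le> 2 * \<bar>?P b\<bar> + ?W b" by (simp add: abs_mult distrib_left mult_ac)
      then have "(?G b)\<^sup>2 \<le> (2 * \<bar>?P b\<bar> + ?W b)\<^sup>2" using power_mono[of "\<bar>?G b\<bar>" "2 * \<bar>?P b\<bar> + ?W b" 2] by simp
      also have "\<dots> \<le> 2 * (2 * \<bar>?P b\<bar>)\<^sup>2 + 2 * (?W b)\<^sup>2"
        using sum_squares_bound[of "2 * \<bar>?P b\<bar>" "?W b"] unfolding power2_sum by linarith
      finally show ?thesis using False by (simp add: power_mult_distrib)
    qed
  qed
qed

section \<open>Minimisation over finitely many sites\<close>

lemma H0_finite: "finite \<Omega> \<Longrightarrow> v \<in> H0 \<Omega> \<Longrightarrow> finitely_supported v"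
  unfolding finitely_supported_def by (rule finite_subset[of _ \<Omega>]) (auto simp: H0_def)

lemma H0_outside: "v \<in> H0 \<Omega> \<Longrightarrow> l \<notin> \<Omega> \<Longrightarrow> v l = 0"
  unfolding H0_def by blast

text \<open>Walking to the right from any site one leaves the finite set, and no horizontal bond is severed.\<close>

lemma H0_bound:
  assumes \<Omega>: "finite \<Omega>" obtains M where "0 \<le> M" "\<And>z l. z \<in> H0 \<Omega> \<Longrightarrow> \<bar>z l\<bar> \<le> M * l2norm (bdiff z)"
proof -
  define X where "X = Max (insert 0 ((\<lambda>l. \<bar>fst l\<bar>) ` \<Omega>))"
  have X0: "0 \<le> X" unfolding X_def using \<Omega> by (intro Max_ge) auto
  have X: "\<bar>fst l\<bar> \<le> X" if "l \<in> \<Omega>" for l unfolding X_def using \<Omega> that by (intro Max_ge) auto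
  let ?M = "sqrt (of_int (2 * X + 1))"
  show ?thesis
  proof (rule that[of ?M])
    show "0 \<le> ?M" using X0 by simp
    fix z :: "site \<Rightarrow> real" and l :: site assume z: "z \<in> H0 \<Omega>"
    have lz: "l2 (bdiff z)" by (rule l2_bdiff_finite[OF H0_finite[OF \<Omega> z]])
    obtain x y where l: "l = (x, y)" by (metis surj_pair)
    show "\<bar>z l\<bar> \<le> ?M * l2norm (bdiff z)"
    proof (cases "l \<in> \<Omega>")
      case False then show ?thesis using H0_outside[OF z False] X0 by simp
    next
      case True
      have x: "- X \<le> x" "x \<le> X" using X[OF True] l by auto
      have "(X + 1, y) \<notin> \<Omega>" using X[of "(X + 1, y)"] by auto
      then have z0: "z (X + 1, y) = 0" by (rule H0_outside[OF z])
      have "(z (X + 1, y) - z (x, y))\<^sup>2 \<le> of_int (X + 1 - (- X)) * (\<Sum>k\<in>{-X<..X+1}. (z (k, y) - z (k - 1, y))\<^sup>2)"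
        by (rule path_estimate) (use x X0 in auto)
      also have "(\<Sum>k\<in>{-X<..X+1}. (z (k, y) - z (k - 1, y))\<^sup>2) = (\<Sum>k\<in>{-X..X}. \<Sum>j\<in>{y}. (bdiff z ((k, j), False))\<^sup>2)"
        by (rule sum.reindex_bij_witness[where i="\<lambda>k. k + 1" and j="\<lambda>k. k - 1"]) (auto simp: bdiff_def)
      also have "of_int (X + 1 - (- X)) * \<dots> \<le> of_int (X + 1 - (- X)) * (l2norm (bdiff z))\<^sup>2"
        unfolding l2norm_sq using lz X0 by (intro mult_left_mono bond_rectangle_le) (auto simp: l2_def)
      finally have "(z l)\<^sup>2 \<le> of_int (2 * X + 1) * (l2norm (bdiff z))\<^sup>2" using z0 l by simp
      then have "sqrt ((z l)\<^sup>2) \<le> sqrt (of_int (2 * X + 1) * (l2norm (bdiff z))\<^sup>2)" by (rule real_sqrt_le_mono)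
      then show ?thesis by (simp only: real_sqrt_mult real_sqrt_abs abs_of_nonneg[OF l2norm_nonneg])
    qed
  qed
qed

lemma compact_box: "compact (PiE UNIV (\<lambda>l :: site. {f l .. (g l :: real)}))"
proof -
  have "compactin (product_topology (\<lambda>l :: site. euclidean :: real topology) UNIV) (PiE UNIV (\<lambda>l. {f l .. g l}))"
    unfolding compactin_PiE by simp
  then show ?thesis by (simp add: euclidean_product_topology)
qed

lemma continuous_bdiff [continuous_intros]: "continuous_on UNIV (\<lambda>v. bdiff v b)"
  unfolding bdiff_def by (cases "snd b"; cases "fst b \<in> cracked") (auto intro!: continuous_intros)

text \<open>Only finitely many bonds and sites are involved, so the ball is compact and the energy
  continuous in the topology of pointwise convergence.\<close>

lemma minimiser_exists:
  assumes \<Omega>: "finite \<Omega>" and v0: "v0 \<in> H0 \<Omega>" and r: "0 \<le> r"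
  obtains w where "w \<in> H0 \<Omega>" "l2norm (\<lambda>b. bdiff w b - bdiff v0 b) \<le> r"
    "\<And>v. v \<in> H0 \<Omega> \<Longrightarrow> l2norm (\<lambda>b. bdiff v b - bdiff v0 b) \<le> r \<Longrightarrow> en (bdiff w) \<le> en (bdiff v)"
proof -
  obtain M where M: "0 \<le> M" "\<And>z l. z \<in> H0 \<Omega> \<Longrightarrow> \<bar>z l\<bar> \<le> M * l2norm (bdiff z)" using H0_bound[OF \<Omega>] by blast
  let ?N = "{b. fst b \<in> \<Omega> \<or> bond_end b \<in> \<Omega>}"
  have N: "finite ?N"
  proof (rule finite_subset)
    show "?N \<subseteq> (\<Omega> \<union> {l. l + (1,0) \<in> \<Omega>} \<union> {l. l + (0,1) \<in> \<Omega>}) \<times> UNIV" by (auto simp: bond_end_def split: if_splits)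
    show "finite ((\<Omega> \<union> {l. l + (1,0) \<in> \<Omega>} \<union> {l. l + (0,1) \<in> \<Omega>}) \<times> (UNIV :: bool set))"
      using \<Omega> finite_shift_img[OF \<Omega>] by auto
  qed
  have out: "bdiff v b = 0" if "v \<in> H0 \<Omega>" "b \<notin> ?N" for v b
  proof -
    have "v (fst b) = 0" "v (bond_end b) = 0" using that(2) by (auto intro: H0_outside[OF that(1)])
    then show ?thesis by (auto simp: bdiff_def bond_end_def split: if_splits)
  qed
  define D where "D v = (\<Sum>b\<in>?N. (bdiff v b - bdiff v0 b)\<^sup>2)" for v
  define J where "J v = (\<Sum>b\<in>?N. \<phi> (bdiff (predictor \<epsilon>) b + bdiff v b) - \<phi> (bdiff (predictor \<epsilon>) b) - cdiff (conjugate \<epsilon>) b * bdiff v b)" for v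
  have D: "(l2norm (\<lambda>b. bdiff v b - bdiff v0 b))\<^sup>2 = D v" if "v \<in> H0 \<Omega>" for v
  proof -
    have "(\<Sum>\<^sub>\<infinity>b. (bdiff v b - bdiff v0 b)\<^sup>2) = infsum (\<lambda>b. (bdiff v b - bdiff v0 b)\<^sup>2) ?N"
      by (rule infsum_cong_neutral) (use out[OF that] out[OF v0] in auto)
    then show ?thesis using N by (simp add: l2norm_sq D_def)
  qed
  have J: "en (bdiff v) = J v" if "v \<in> H0 \<Omega>" for v
  proof -
    have "en (bdiff v) = infsum (\<lambda>b. \<phi> (bdiff (predictor \<epsilon>) b + bdiff v b) - \<phi> (bdiff (predictor \<epsilon>) b) - cdiff (conjugate \<epsilon>) b * bdiff v b) ?N"
      unfolding en_def by (rule infsum_cong_neutral) (use out[OF that] in auto)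
    then show ?thesis using N by (simp add: J_def)
  qed
  have Dr: "l2norm (\<lambda>b. bdiff v b - bdiff v0 b) \<le> r \<longleftrightarrow> D v \<le> r\<^sup>2" if "v \<in> H0 \<Omega>" for v
    unfolding D[OF that, symmetric] using r by (simp add: abs_le_square_iff[symmetric])
  have c\<phi>: "continuous_on UNIV \<phi>" using D0 by (meson DERIV_isCont continuous_at_imp_continuous_on)
  have cD: "continuous_on UNIV D" unfolding D_def by (intro continuous_intros)
  have cJ: "continuous_on UNIV J"
    unfolding J_def by (intro continuous_intros continuous_on_compose2[OF c\<phi>]) auto
  let ?box = "PiE UNIV (\<lambda>l. {(if l \<in> \<Omega> then v0 l - M * r else 0) .. (if l \<in> \<Omega> then v0 l + M * r else 0)})"
  have box: "v \<in> ?box \<Longrightarrow> v \<in> H0 \<Omega>" for v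
  proof -
    assume vb: "v \<in> ?box"
    have "v l \<in> {(if l \<in> \<Omega> then v0 l - M * r else 0) .. (if l \<in> \<Omega> then v0 l + M * r else 0)}" for l
      by (rule PiE_mem[OF vb UNIV_I])
    then have "v l = 0" if "l \<notin> \<Omega>" for l using that by (metis atLeastAtMost_iff order_antisym)
    then show "v \<in> H0 \<Omega>" by (auto simp: H0_def)
  qed
  let ?S = "?box \<inter> {v. D v \<le> r\<^sup>2}"
  have cl: "closed {v. D v \<le> r\<^sup>2}"
    using cD by (intro closed_Collect_le) (auto simp: continuous_on_const)
  have cS: "compact ?S" by (rule compact_Int_closed[OF compact_box cl])
  have inS: "v \<in> ?S" if v: "v \<in> H0 \<Omega>" "l2norm (\<lambda>b. bdiff v b - bdiff v0 b) \<le> r" for v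
  proof -
    have z: "(\<lambda>l. v l - v0 l) \<in> H0 \<Omega>" using v(1) v0 by (auto simp: H0_def)
    have "\<bar>v l - v0 l\<bar> \<le> M * r" for l
    proof -
      have "\<bar>v l - v0 l\<bar> \<le> M * l2norm (\<lambda>b. bdiff v b - bdiff v0 b)" using M(2)[OF z, of l] by (simp add: bdiff_diff)
      also have "\<dots> \<le> M * r" using v(2) M(1) by (rule mult_left_mono)
      finally show ?thesis .
    qed
    then have "v l \<in> {(if l \<in> \<Omega> then v0 l - M * r else 0) .. (if l \<in> \<Omega> then v0 l + M * r else 0)}" for l
    proof (cases "l \<in> \<Omega>")
      case True
      have "\<bar>v l - v0 l\<bar> \<le> M * r" by fact
      then show ?thesis using True by auto
    next
      case False then show ?thesis using H0_outside[OF v(1) False] by simp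
    qed
    then have "v \<in> ?box" by (auto simp: PiE_def)
    then show ?thesis using Dr[OF v(1)] v(2) by simp
  qed
  have "v0 \<in> ?S" by (rule inS[OF v0]) (simp add: l2norm_def r)
  then have ne: "?S \<noteq> {}" by blast
  obtain w where w: "w \<in> ?S" "\<And>v. v \<in> ?S \<Longrightarrow> J w \<le> J v"
    using continuous_attains_inf[OF cS ne continuous_on_subset[OF cJ subset_UNIV]] by blast
  have wH: "w \<in> H0 \<Omega>" using box w(1) by blast
  show ?thesis
  proof (rule that[OF wH])
    show "l2norm (\<lambda>b. bdiff w b - bdiff v0 b) \<le> r" using Dr[OF wH] w(1) by simp
    show "en (bdiff w) \<le> en (bdiff v)" if "v \<in> H0 \<Omega>" "l2norm (\<lambda>b. bdiff v b - bdiff v0 b) \<le> r" for v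
      using w(2)[OF inS[OF that]] J[OF wH] J[OF that(1)] by simp
  qed
qed

section \<open>Quasi-optimal approximation\<close>

lemma hessian_coercive:
  assumes u: "l2 (bdiff u)" and st: "stable_on (energy \<phi> \<epsilon>) H1dot u"
  obtains \<mu> where "0 < \<mu>" "\<And>v. l2 (bdiff v) \<Longrightarrow> \<mu> * (l2norm (bdiff v))\<^sup>2 \<le> hess (bdiff u) (bdiff v)"
proof -
  obtain \<mu> where \<mu>: "0 < \<mu>" "\<And>v. v \<in> H1dot \<Longrightarrow> \<mu> * (dnorm v)\<^sup>2 \<le> second_variation (energy \<phi> \<epsilon>) u v"
    using st by (auto simp: stable_on_def)
  show ?thesis
  proof (rule that[OF \<mu>(1)])
    fix v assume v: "l2 (bdiff v)"
    let ?v = "\<lambda>m. v m - v xhat"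
    have b: "bdiff ?v = bdiff v" by (rule bdiff_const)
    have "?v \<in> H1dot" using v by (simp add: H1dot_def grad_in_l2_iff b)
    from \<mu>(2)[OF this] show "\<mu> * (l2norm (bdiff v))\<^sup>2 \<le> hess (bdiff u) (bdiff v)"
      using second_variation_eq[OF u, of ?v] v by (simp add: b dnorm_eq power_mult_distrib)
  qed
qed

text \<open>Within distance r0 of u the excess energy is comparable to the squared distance from u. The
  minimiser in a closed ball about v0 is compared with v0 itself; this shows that it lies in the
  interior of that ball.\<close>

theorem quasi_optimal:
  assumes m: "local_minimiser (energy \<phi> \<epsilon>) H1dot u" and st: "stable_on (energy \<phi> \<epsilon>) H1dot u"
  obtains C r where "0 < C" "0 < r"
    "\<And>\<Omega> v0. finite \<Omega> \<Longrightarrow> v0 \<in> H0 \<Omega> \<Longrightarrow> l2norm (\<lambda>b. bdiff v0 b - bdiff u b) < r \<Longrightarrow>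
       \<exists>w. local_minimiser (energy \<phi> \<epsilon>) (H0 \<Omega>) w \<and> stable_on (energy \<phi> \<epsilon>) (H0 \<Omega>) w \<and>
           dnorm (\<lambda>m. w m - u m) \<le> C * l2norm (\<lambda>b. bdiff v0 b - bdiff u b)"
proof -
  let ?g = "bdiff u"
  have u: "l2 ?g" using m by (auto simp: local_minimiser_def H1dot_def grad_in_l2_iff)
  obtain \<mu> where \<mu>: "0 < \<mu>" "\<And>v. l2 (bdiff v) \<Longrightarrow> \<mu> * (l2norm (bdiff v))\<^sup>2 \<le> hess ?g (bdiff v)"
    using hessian_coercive[OF u st] by blast
  obtain K where K: "derivative_bound (3 * \<epsilon> + l2norm ?g + 1) K" using ex_derivative_bound by blast
  have K0: "0 < K" by (rule K_pos[OF K])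
  \<comment> \<open>On this ball the cubic Taylor remainder and the change of the Hessian are at most a
    quarter of the coercivity.\<close>
  define r0 where "r0 = min 1 (\<mu> / (4 * K))"
  have r0: "0 < r0" "r0 \<le> 1" "K * r0 \<le> \<mu> / 4"
  proof -
    show "0 < r0" "r0 \<le> 1" using \<mu>(1) K0 by (auto simp: r0_def)
    have "K * r0 \<le> K * (\<mu> / (4 * K))" using K0 by (intro mult_left_mono) (auto simp: r0_def)
    then show "K * r0 \<le> \<mu> / 4" using K0 by simp
  qed
  have dk: "l2 (\<lambda>b. bdiff v b - ?g b)" if "l2 (bdiff v)" for v using l2_diff[OF that u] .
  have B: "3 * \<epsilon> + l2norm ?g + l2norm k \<le> 3 * \<epsilon> + l2norm ?g + 1" if "l2norm k \<le> r0" for k :: "bond \<Rightarrow> real"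
    using that r0 by simp
  have crit: "(\<Sum>\<^sub>\<infinity>b. stress ?g b * (bdiff v b - ?g b)) = 0" if "l2 (bdiff v)" for v
    using critical[OF m, of "\<lambda>l. v l - u l"] dk[OF that] by (simp add: bdiff_diff)
  have shift_back: "(\<lambda>b. ?g b + (bdiff v b - ?g b)) = bdiff v" for v by auto
  have upper: "en (bdiff v) \<le> en ?g + K * (l2norm (\<lambda>b. bdiff v b - ?g b))\<^sup>2"
    if v: "l2 (bdiff v)" "l2norm (\<lambda>b. bdiff v b - ?g b) \<le> r0" for v
    using en_taylor1[OF u dk[OF v(1)] K B[OF v(2)]] crit[OF v(1)] unfolding shift_back by linarith
  have lower: "en ?g + \<mu> / 4 * (l2norm (\<lambda>b. bdiff v b - ?g b))\<^sup>2 \<le> en (bdiff v)"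
    if v: "l2 (bdiff v)" "l2norm (\<lambda>b. bdiff v b - ?g b) \<le> r0" for v
  proof -
    let ?k = "\<lambda>b. bdiff v b - ?g b"
    have "\<bar>en (bdiff v) - en ?g - hess ?g ?k / 2\<bar> \<le> K * l2norm ?k * (l2norm ?k)\<^sup>2"
      using en_taylor2[OF u dk[OF v(1)] K B[OF v(2)]] crit[OF v(1)] unfolding shift_back by simp
    moreover have "\<mu> * (l2norm ?k)\<^sup>2 \<le> hess ?g ?k"
      using \<mu>(2)[of "\<lambda>l. v l - u l"] dk[OF v(1)] by (simp add: bdiff_diff)
    moreover have "K * l2norm ?k * (l2norm ?k)\<^sup>2 \<le> \<mu> / 4 * (l2norm ?k)\<^sup>2"
    proof (rule mult_right_mono)
      have "K * l2norm ?k \<le> K * r0" using v(2) K0 by (intro mult_left_mono) auto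
      then show "K * l2norm ?k \<le> \<mu> / 4" using r0 by linarith
    qed simp
    ultimately show ?thesis by linarith
  qed
  have hs: "\<mu> / 2 * (l2norm (bdiff z))\<^sup>2 \<le> hess (bdiff v) (bdiff z)"
    if v: "l2 (bdiff v)" "l2norm (\<lambda>b. bdiff v b - ?g b) \<le> r0" and z: "l2 (bdiff z)" for v z
  proof -
    let ?k = "\<lambda>b. bdiff v b - ?g b"
    have "\<bar>hess (bdiff v) (bdiff z) - hess ?g (bdiff z)\<bar> \<le> K * l2norm ?k * (l2norm (bdiff z))\<^sup>2"
      using hess_lipschitz[OF u dk[OF v(1)] z K B[OF v(2)]] unfolding shift_back .
    moreover have "K * l2norm ?k * (l2norm (bdiff z))\<^sup>2 \<le> \<mu> / 4 * (l2norm (bdiff z))\<^sup>2"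
    proof (rule mult_right_mono)
      have "K * l2norm ?k \<le> K * r0" using v(2) K0 by (intro mult_left_mono) auto
      then show "K * l2norm ?k \<le> \<mu> / 4" using r0 by linarith
    qed simp
    moreover have "\<mu> / 2 * (l2norm (bdiff z))\<^sup>2 = \<mu> * (l2norm (bdiff z))\<^sup>2 - 2 * (\<mu> / 4 * (l2norm (bdiff z))\<^sup>2)" by simp
    moreover have "0 \<le> \<mu> / 4 * (l2norm (bdiff z))\<^sup>2" using \<mu>(1) by simp
    ultimately show ?thesis using \<mu>(2)[OF z] by linarith
  qed
  define c where "c = sqrt (4 * K / \<mu>)"
  have c: "0 < c" "c\<^sup>2 = 4 * K / \<mu>" using K0 \<mu>(1) by (auto simp: c_def)
  \<comment> \<open>Small enough for e + d to stay below r0/2 when the distance d of v0 from u is below r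
    and e \<le> c d.\<close>
  define r where "r = r0 / (2 * (c + 1))"
  have r: "0 < r" "(c + 1) * r = r0 / 2" using r0 c by (simp_all add: r_def add_pos_pos field_simps)
  have rr: "r \<le> r0 / 2"
  proof -
    have "1 * r \<le> (c + 1) * r" using r(1) c(1) by (intro mult_right_mono) auto
    then show ?thesis using r(2) by simp
  qed
  show ?thesis
  proof (rule that[of "sqrt 2 * c" r])
    show "0 < sqrt 2 * c" using c by simp
    show "0 < r" by (rule r(1))
    fix \<Omega> v0 assume \<Omega>: "finite \<Omega>" and v0: "v0 \<in> H0 \<Omega>" and dr: "l2norm (\<lambda>b. bdiff v0 b - ?g b) < r"
    let ?d = "l2norm (\<lambda>b. bdiff v0 b - ?g b)"
    have lv: "l2 (bdiff v)" if "v \<in> H0 \<Omega>" for v by (rule l2_bdiff_finite[OF H0_finite[OF \<Omega> that]])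
    obtain w where w: "w \<in> H0 \<Omega>" "l2norm (\<lambda>b. bdiff w b - bdiff v0 b) \<le> r0 / 2"
      "\<And>v. v \<in> H0 \<Omega> \<Longrightarrow> l2norm (\<lambda>b. bdiff v b - bdiff v0 b) \<le> r0 / 2 \<Longrightarrow> en (bdiff w) \<le> en (bdiff v)"
      using minimiser_exists[OF \<Omega> v0, of "r0 / 2"] r0 by auto
    have lw: "l2 (bdiff w)" by (rule lv[OF w(1)])
    let ?e = "l2norm (\<lambda>b. bdiff w b - ?g b)"
    have tri: "l2norm (\<lambda>b. x b - z b) \<le> l2norm (\<lambda>b. x b - y b) + l2norm (\<lambda>b. y b - z b)"
      if "l2 x" "l2 y" "l2 z" for x y z :: "bond \<Rightarrow> real"
      using l2norm_triangle[OF l2_diff[OF that(1,2)] l2_diff[OF that(2,3)]] by simp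
    have er: "?e \<le> r0" using tri[OF lw lv[OF v0] u] w(2) dr rr by linarith
    have "en (bdiff w) \<le> en (bdiff v0)" by (rule w(3)[OF v0]) (use r0 in \<open>simp add: l2norm_def\<close>)
    also have "\<dots> \<le> en ?g + K * ?d\<^sup>2" by (rule upper[OF lv[OF v0]]) (use dr rr r0 in linarith)
    finally have "\<mu> / 4 * ?e\<^sup>2 \<le> K * ?d\<^sup>2" using lower[OF lw er] by linarith
    then have "?e\<^sup>2 \<le> (c * ?d)\<^sup>2" unfolding power_mult_distrib c(2) using \<mu>(1) by (simp add: field_simps)
    then have e: "?e \<le> c * ?d" by (rule power2_le_imp_le) (use c(1) in simp)
    have inner: "l2norm (\<lambda>b. bdiff w b - bdiff v0 b) < r0 / 2"
    proof -
      have "l2norm (\<lambda>b. bdiff w b - bdiff v0 b) \<le> ?e + ?d"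
        using tri[OF lw u lv[OF v0]] l2norm_minus_commute[of ?g "bdiff v0"] by simp
      also have "\<dots> \<le> (c + 1) * ?d" using e by (simp add: algebra_simps)
      also have "\<dots> < (c + 1) * r" using dr c(1) by (intro mult_strict_left_mono) auto
      finally show ?thesis using r(2) by simp
    qed
    have dn: "dnorm (\<lambda>m. v m - v' m) = sqrt 2 * l2norm (\<lambda>b. bdiff v b - bdiff v' b)" if "l2 (bdiff v)" "l2 (bdiff v')" for v v'
      using dnorm_eq[of "\<lambda>m. v m - v' m"] l2_diff[OF that] by (simp add: bdiff_diff)
    have "local_minimiser (energy \<phi> \<epsilon>) (H0 \<Omega>) w"
      unfolding local_minimiser_def
    proof (intro conjI exI[of _ "r0 / 2 - l2norm (\<lambda>b. bdiff w b - bdiff v0 b)"] ballI impI)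
      show "w \<in> H0 \<Omega>" by (rule w(1))
      show "r0 / 2 - l2norm (\<lambda>b. bdiff w b - bdiff v0 b) > 0" using inner by simp
      fix v assume v: "v \<in> H0 \<Omega>" and d: "dnorm (\<lambda>m. v m - w m) < r0 / 2 - l2norm (\<lambda>b. bdiff w b - bdiff v0 b)"
      have "l2norm (\<lambda>b. bdiff v b - bdiff w b) \<le> sqrt 2 * l2norm (\<lambda>b. bdiff v b - bdiff w b)"
        using mult_right_mono[of 1 "sqrt 2" "l2norm (\<lambda>b. bdiff v b - bdiff w b)"] by simp
      then have "l2norm (\<lambda>b. bdiff v b - bdiff v0 b) \<le> r0 / 2"
        using tri[OF lv[OF v] lw lv[OF v0]] d unfolding dn[OF lv[OF v] lw] by linarith
      then show "energy \<phi> \<epsilon> w \<le> energy \<phi> \<epsilon> v"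
        using w(3)[OF v] energy_eq[OF lw] energy_eq[OF lv[OF v]] by simp
    qed
    moreover have "stable_on (energy \<phi> \<epsilon>) (H0 \<Omega>) w"
      unfolding stable_on_def
    proof (intro exI[of _ "\<mu> / 2"] conjI ballI)
      show "0 < \<mu> / 2" using \<mu>(1) by simp
      fix v assume "v \<in> H0 \<Omega>"
      note l = lv[OF this]
      have "\<mu> / 2 * (dnorm v)\<^sup>2 = 2 * (\<mu> / 2 * (l2norm (bdiff v))\<^sup>2)" by (simp add: dnorm_eq[OF l] power_mult_distrib)
      then show "\<mu> / 2 * (dnorm v)\<^sup>2 \<le> second_variation (energy \<phi> \<epsilon>) w v"
        unfolding second_variation_eq[OF lw l] using hs[OF lw er l] by linarith
    qed
    moreover have "dnorm (\<lambda>m. w m - u m) \<le> sqrt 2 * c * ?d"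
      unfolding dn[OF lw u] using e by (simp add: mult.assoc)
    ultimately show "\<exists>w. local_minimiser (energy \<phi> \<epsilon>) (H0 \<Omega>) w \<and> stable_on (energy \<phi> \<epsilon>) (H0 \<Omega>) w \<and>
           dnorm (\<lambda>m. w m - u m) \<le> sqrt 2 * c * ?d" by blast
  qed
qed

lemma norm_pos_lt: assumes "rad l < k" shows "norm (pos l) < 2 * of_int k"
proof -
  have "\<bar>fst l\<bar> \<le> k - 1 \<and> fst l \<ge> 2 - k" "\<bar>snd l\<bar> \<le> k - 1 \<and> snd l \<ge> 2 - k" using assms by (auto simp: rad_def)
  then have "\<bar>real_of_int (fst l) - 1/2\<bar> < of_int k" "\<bar>real_of_int (snd l) - 1/2\<bar> < of_int k" by linarith+
  then show ?thesis using cmod_le[of "pos l"] by (simp add: pos_def)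
qed

text \<open>The truncation at radius n vanishes where rad is at least 2n, hence is supported in the ball of
  radius 4n, which leads to the choice n = R/4 rounded down.\<close>

theorem truncated_equilibrium:
  assumes m: "local_minimiser (energy \<phi> \<epsilon>) H1dot u" and \<alpha>: "0 < \<alpha>" "\<alpha> < 1/2"
  obtains D where "0 < D"
    "\<And>R \<Omega>. 4 \<le> R \<Longrightarrow> {m. pos m \<in> ball 0 R} \<subseteq> \<Omega> \<Longrightarrow>
       \<exists>v\<in>H0 \<Omega>. l2norm (\<lambda>b. bdiff v b - bdiff u b) \<le> D * R powr (- \<alpha>)"
proof -
  have u: "l2 (bdiff u)" using m by (auto simp: local_minimiser_def H1dot_def grad_in_l2_iff)
  define G where "G = l2norm (\<lambda>b. ssize (fst b) powr \<alpha> * bdiff u b)"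
  have g: "l2 (\<lambda>b. ssize (fst b) powr \<alpha> * bdiff u b)" by (rule equilibrium_decay[OF m \<alpha>])
  have G0: "0 \<le> G" by (simp add: G_def)
  show ?thesis
  proof (rule that[of "801 * 8 * G + 1"])
    show "0 < 801 * 8 * G + 1" using G0 by simp
    fix R :: real and \<Omega> assume R: "4 \<le> R" and \<Omega>: "{m. pos m \<in> ball 0 R} \<subseteq> \<Omega>"
    define n where "n = \<lfloor>R / 4\<rfloor>"
    have n: "1 \<le> n" "4 * real_of_int n \<le> R" using R unfolding n_def by linarith+
    \<comment> \<open>Rounding down costs at most a factor 2 since R is at least 4.\<close>
    have n8: "R / 8 \<le> real_of_int n"
    proof (cases "R < 8")
      case True then show ?thesis using n(1) by linarith
    next
      case False then show ?thesis unfolding n_def by linarith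
    qed
    obtain v where v: "\<And>l. 2 * n \<le> rad l \<Longrightarrow> v l = 0" and "l2 (bdiff (\<lambda>l. v l - u l))" and
      v2: "(l2norm (bdiff (\<lambda>l. v l - u l)))\<^sup>2 \<le> 640002 * tail n u" by (rule truncation[OF u n(1)]) blast
    have "v \<in> H0 \<Omega>"
    proof -
      have "v l = 0" if "l \<notin> \<Omega>" for l
      proof (rule v, rule ccontr)
        assume "\<not> 2 * n \<le> rad l"
        then have "norm (pos l) < 2 * of_int (2 * n)" by (intro norm_pos_lt) simp
        then have "pos l \<in> ball 0 R" using n(2) by simp
        then show False using \<Omega> that by blast
      qed
      then show ?thesis by (auto simp: H0_def)
    qed
    moreover have "l2norm (\<lambda>b. bdiff v b - bdiff u b) \<le> (801 * 8 * G + 1) * R powr (- \<alpha>)"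
    proof -
      have "(l2norm (bdiff (\<lambda>l. v l - u l)))\<^sup>2 \<le> 640002 * ((of_int n powr (- \<alpha>))\<^sup>2 * G\<^sup>2)"
        using v2 tail_decay[OF g \<alpha>(1) n(1) u] unfolding G_def by linarith
      \<comment> \<open>801^2 = 641601 exceeds 640002.\<close>
      also have "\<dots> \<le> 801\<^sup>2 * ((of_int n powr (- \<alpha>))\<^sup>2 * G\<^sup>2)" by (intro mult_right_mono) auto
      also have "\<dots> = (801 * (of_int n powr (- \<alpha>) * G))\<^sup>2" by (simp only: power_mult_distrib)
      finally have "l2norm (bdiff (\<lambda>l. v l - u l)) \<le> 801 * (of_int n powr (- \<alpha>) * G)"
        by (rule power2_le_imp_le) (use G0 in simp)
      also have "\<dots> \<le> 801 * ((8 * R powr (- \<alpha>)) * G)"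
      proof (intro mult_left_mono mult_right_mono G0)
        have "of_int n powr (- \<alpha>) \<le> (R / 8) powr (- \<alpha>)" using n8 R \<alpha> by (intro powr_mono2') auto
        also have "\<dots> = 8 powr \<alpha> * R powr (- \<alpha>)" using R by (simp add: powr_divide powr_minus_divide)
        also have "\<dots> \<le> 8 * R powr (- \<alpha>)" using powr_mono[of \<alpha> 1 8] \<alpha> by (intro mult_right_mono) auto
        finally show "of_int n powr (- \<alpha>) \<le> 8 * R powr (- \<alpha>)" .
      qed simp
      also have "\<dots> = (801 * 8 * G) * R powr (- \<alpha>)" by simp
      also have "\<dots> \<le> (801 * 8 * G + 1) * R powr (- \<alpha>)" by (intro mult_right_mono) auto
      finally show ?thesis by (simp add: bdiff_diff)
    qed
    ultimately show "\<exists>v\<in>H0 \<Omega>. l2norm (\<lambda>b. bdiff v b - bdiff u b) \<le> (801 * 8 * G + 1) * R powr (- \<alpha>)" by blast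
  qed
qed

end

lemma C_k_potential:
  assumes "k \<ge> 5" "C_k k \<phi>" "\<phi> 0 = 0" "\<And>r. \<phi> (- r) = \<phi> r" "(deriv ^^ 2) \<phi> 0 = 1"
  shows "potential \<phi> ((deriv ^^ 1) \<phi>) ((deriv ^^ 2) \<phi>) ((deriv ^^ 3) \<phi>) ((deriv ^^ 4) \<phi>)"
proof -
  have d: "((deriv ^^ j) \<phi> has_real_derivative (deriv ^^ i) \<phi> x) (at x)" if "j < 5" "i = Suc j" for i j x
  proof -
    have "(deriv ^^ j) \<phi> field_differentiable at x" using assms(1,2) that(1) by (simp add: C_k_def)
    then show ?thesis unfolding that(2) by (simp add: DERIV_deriv_iff_field_differentiable)
  qed
  have "((deriv ^^ 4) \<phi> has_real_derivative (deriv ^^ 5) \<phi> x) (at x)" for x by (rule d) simp_all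
  then have c: "continuous_on UNIV ((deriv ^^ 4) \<phi>)" by (meson DERIV_isCont continuous_at_imp_continuous_on)
  have D0: "(\<phi> has_real_derivative (deriv ^^ 1) \<phi> x) (at x)" for x using d[of 0 1 x] by simp
  show ?thesis by (intro potential.intro D0 d c assms(3-5)) simp_all
qed

theorem theorem2p8:
  fixes k :: nat and \<phi> :: "real \<Rightarrow> real" and \<epsilon> :: real
    and \<Omega> :: "real \<Rightarrow> site set" and ubar :: "site \<Rightarrow> real"
  assumes "k \<ge> 5"
    and "C_k k \<phi>"
    and "\<phi> 0 = 0"
    and "\<And>r. \<phi> (- r) = \<phi> r"
    and "(deriv ^^ 2) \<phi> 0 = 1"
    and "\<epsilon> \<ge> 0"
    and "\<And>R. R > 0 \<Longrightarrow> finite (\<Omega> R)"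
    and "\<And>R. R > 0 \<Longrightarrow> {m. pos m \<in> ball 0 R} \<subseteq> \<Omega> R"
    and "local_minimiser (energy \<phi> \<epsilon>) H1dot ubar"
    and "stable_on (energy \<phi> \<epsilon>) H1dot ubar"
  shows "\<forall>\<beta>>0. \<exists>C>0. \<exists>R0>0. \<forall>R>R0. \<exists>ubar_R.
           local_minimiser (energy \<phi> \<epsilon>) (H0 (\<Omega> R)) ubar_R \<and>
           stable_on (energy \<phi> \<epsilon>) (H0 (\<Omega> R)) ubar_R \<and>
           dnorm (\<lambda>m. ubar_R m - ubar m) \<le> C * R powr (- 1/2 + \<beta>)"
proof (intro allI impI)
  fix \<beta> :: real assume \<beta>: "\<beta> > 0"
  interpret potential \<phi> "(deriv ^^ 1) \<phi>" "(deriv ^^ 2) \<phi>" "(deriv ^^ 3) \<phi>" "(deriv ^^ 4) \<phi>"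
    by (rule C_k_potential[OF assms(1-5)])
  interpret crack_energy \<phi> "(deriv ^^ 1) \<phi>" "(deriv ^^ 2) \<phi>" "(deriv ^^ 3) \<phi>" "(deriv ^^ 4) \<phi>" \<epsilon>
    by unfold_locales (rule assms(6))
  \<comment> \<open>The exponent 1/2 - \<beta> itself may fail to be positive.\<close>
  define \<alpha> where "\<alpha> = max (1/4) (1/2 - \<beta>)"
  have \<alpha>: "0 < \<alpha>" "\<alpha> < 1/2" "- \<alpha> \<le> - 1/2 + \<beta>" using \<beta> by (auto simp: \<alpha>_def max_def)
  obtain C r where C: "0 < C" and r: "0 < r" and Q: "\<And>\<Omega> v0. finite \<Omega> \<Longrightarrow> v0 \<in> H0 \<Omega> \<Longrightarrow> l2norm (\<lambda>b. bdiff v0 b - bdiff ubar b) < r \<Longrightarrow>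
       \<exists>w. local_minimiser (energy \<phi> \<epsilon>) (H0 \<Omega>) w \<and> stable_on (energy \<phi> \<epsilon>) (H0 \<Omega>) w \<and>
           dnorm (\<lambda>m. w m - ubar m) \<le> C * l2norm (\<lambda>b. bdiff v0 b - bdiff ubar b)"
    by (rule quasi_optimal[OF assms(9,10)]) blast
  obtain D where D: "0 < D" and T: "\<And>R \<Omega>. 4 \<le> R \<Longrightarrow> {m. pos m \<in> ball 0 R} \<subseteq> \<Omega> \<Longrightarrow>
       \<exists>v\<in>H0 \<Omega>. l2norm (\<lambda>b. bdiff v b - bdiff ubar b) \<le> D * R powr (- \<alpha>)"
    by (rule truncated_equilibrium[OF assms(9) \<alpha>(1,2)]) blast
  define R0 where "R0 = max 4 ((D / r) powr (1 / \<alpha>))"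
  have small: "D * R powr (- \<alpha>) < r" if R: "R > R0" for R
  proof -
    have R': "4 < R" "(D / r) powr (1 / \<alpha>) < R" using R by (auto simp: R0_def)
    have "((D / r) powr (1 / \<alpha>)) powr \<alpha> < R powr \<alpha>" using R' \<alpha> by (intro powr_less_mono2) auto
    then have "D / r < R powr \<alpha>" using \<alpha> D r by (simp add: powr_powr)
    then have "D < r * R powr \<alpha>" using r by (simp add: pos_divide_less_eq mult.commute)
    then show ?thesis using R' by (simp add: powr_minus_divide pos_divide_less_eq)
  qed
  show "\<exists>C>0. \<exists>R0>0. \<forall>R>R0. \<exists>ubar_R.
           local_minimiser (energy \<phi> \<epsilon>) (H0 (\<Omega> R)) ubar_R \<and>
           stable_on (energy \<phi> \<epsilon>) (H0 (\<Omega> R)) ubar_R \<and>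
           dnorm (\<lambda>m. ubar_R m - ubar m) \<le> C * R powr (- 1/2 + \<beta>)"
  proof (rule exI[of _ "C * D"], intro conjI exI[of _ R0] allI impI)
    show "C * D > 0" using C D by simp
    show "R0 > 0" by (simp add: R0_def)
    fix R assume R: "R > R0"
    then have R4: "4 < R" by (simp add: R0_def)
    have ball: "{m. pos m \<in> ball 0 R} \<subseteq> \<Omega> R" by (rule assms(8)) (use R4 in simp)
    have fin: "finite (\<Omega> R)" by (rule assms(7)) (use R4 in simp)
    obtain v where v: "v \<in> H0 (\<Omega> R)" "l2norm (\<lambda>b. bdiff v b - bdiff ubar b) \<le> D * R powr (- \<alpha>)"
      using T[OF less_imp_le[OF R4] ball] by blast
    have "l2norm (\<lambda>b. bdiff v b - bdiff ubar b) < r" using v(2) small[OF R] by linarith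
    from Q[OF fin v(1) this] obtain w where w: "local_minimiser (energy \<phi> \<epsilon>) (H0 (\<Omega> R)) w" "stable_on (energy \<phi> \<epsilon>) (H0 (\<Omega> R)) w"
      "dnorm (\<lambda>m. w m - ubar m) \<le> C * l2norm (\<lambda>b. bdiff v b - bdiff ubar b)" by blast
    have "C * l2norm (\<lambda>b. bdiff v b - bdiff ubar b) \<le> C * (D * R powr (- \<alpha>))" using v(2) C by (intro mult_left_mono) auto
    also have "\<dots> \<le> C * (D * R powr (- 1/2 + \<beta>))" using C D R4 \<alpha>(3) by (intro mult_left_mono powr_mono) auto
    finally have "dnorm (\<lambda>m. w m - ubar m) \<le> C * D * R powr (- 1/2 + \<beta>)" using w(3) by (simp add: mult.assoc)
    then show "\<exists>ubar_R. local_minimiser (energy \<phi> \<epsilon>) (H0 (\<Omega> R)) ubar_R \<and>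
           stable_on (energy \<phi> \<epsilon>) (H0 (\<Omega> R)) ubar_R \<and>
           dnorm (\<lambda>m. ubar_R m - ubar m) \<le> C * D * R powr (- 1/2 + \<beta>)" using w by blast
  qed
qed

end
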